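(* Let $M$ be a connected, closed, oriented three-dimensional Riemannian manifold with total volume $1$, and let $R=\mathbb{R}[\epsilon,d\epsilon]$. (1) Every solution $(\rho,u,p)$ to the compressible Euler equations $$\dot\rho+\nabla\cdot(\rho u)=0,\qquad \dot u+\nabla\Big(\frac{u\cdot u}{2}\Big)-u\times(\nabla\times u)+\frac{\nabla p}{\rho}=0$$ gives rise to a homotopy $$f+X\,dt+V\epsilon+\pi\,dt\,\epsilon+\sigma\,d\epsilon+\Phi\,dt\,d\epsilon+\Psi\,\epsilon\,d\epsilon$$ of $R$-collections of homotopy random variables under the identifications $\exp(f)=\rho$, $$X=u^\flat,\quad V=-\frac{\star d(\rho X)}{\rho},\quad \pi=\tfrac12\delta(X\wedge\star X)-\delta(X)\star X,\quad \sigma=\star X,\quad \Phi=\frac{\star p}{\rho},\quad \Psi=X\wedge dX.$$ (2) Conversely, every homotopy (in the notation of the displayed expression in (1), with $\rho=\exp(f)$) of $R$-collections of homotopy random variables which satisfies the additional conditions $$\sigma=\star X,\qquad \pi=\tfrac12\delta(X\wedge\star X)-\delta(X)(\star X)$$ arises from a solution to the compressible Euler equations with density $\rho$, velocity $X^\sharp$, and pressure $\star(\rho\Phi)$.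
   Context: Operators on $M$ ($\dim M=3$): $\flat,\sharp$ are the musical isomorphisms between vector (multivector) fields and forms; $\star$ is the Hodge star, $\alpha\wedge\star\beta=\langle\alpha,\beta\rangle dV$; the codifferential is $\delta=(-1)^{3i+1}\star d\star:\Omega^i(M)\to\Omega^{i-1}(M)$; $\nabla\cdot u=\delta(u^\flat)$; $\nabla f=(df)^\sharp$ for functions; $\nabla\times u=(\star d(u^\flat))^\sharp$; $u\times v=(\star(u^\flat\wedge v^\flat))^\sharp$; $u\cdot v=g(u,v)$ for the metric $g$. A dot or $\partial_t$ denotes the time derivative; time-dependent objects are power series in $t$ with smooth coefficients (time is identified with the homotopy parameter). The density $\rho$ is a positive function, $u$ is a vector field, $p$ is a function. Homotopies: $R=\mathbb{R}[\epsilon,d\epsilon]$ is the differential graded parameter ring with $\epsilon$ of degree $-1$, $d\epsilon$ of degree $-2$, $d(\epsilon)=d\epsilon$, $d(d\epsilon)=0$ (so $\epsilon^2=0$, while $d\epsilon$ is even and not nilpotent). $R[[t,dt]]$ adjoins $t$ of degree $0$ and $dt$ of degree $-1$ with $d(t)=dt$, $d(dt)=0$. Forms of degree $k$ have degree $k$, and the differential on $\Omega^\bullet(M)\otimes R[[t,dt]]$, also written $\delta$, is the graded tensor product differential (codifferential plus parameter-ring differential, Koszul signs). A homotopy of $R$-collections of homotopy random variables is a degree zero element $\mathcal{X}$ of $\Omega^\bullet(M)\otimes R[[t,dt]]$ with $\delta(\exp(\mathcal{X}))=0$. Such an element has the form $f+X\,dt+V\epsilon+\pi\,dt\,\epsilon+\sigma\,d\epsilon+\Phi\,dt\,d\epsilon+\Psi\,\epsilon\,d\epsilon$,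 where $f$; $X,V$; $\pi,\sigma$; $\Phi,\Psi$ are power series in $t$ with coefficients respectively functions; one-forms; two-forms; three-forms. Writing $\rho=\exp(f)$ and juxtaposition for the wedge product, the condition $\delta(\exp(\mathcal{X}))=0$ is equivalent to the system $$\dot\rho+\delta(\rho X)=0,\quad \delta(\rho V)=0,\quad -\partial_t(\rho V)+\delta(\rho\pi-\rho XV)=0,$$ $$\delta(\rho\sigma)-\rho V=0,\quad \delta(\rho V\sigma+\rho\Psi)=0,\quad -\rho V\sigma-\rho\Psi=0,$$ $$-\partial_t(\rho(V\sigma+\Psi))=0,\quad \rho(XV-\pi)+\partial_t(\rho\sigma)+\delta(\rho X\sigma+\rho\Phi)=0.$$ *)

theory Defs
  imports
    "HOL-Analysis.Analysis"
    "HOL-Computational_Algebra.Formal_Power_Series"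
    "HOL-Library.Function_Algebras"
begin

unbundle no cross3_syntax

section \<open>Smooth maps on open subsets of a normed space\<close>

primrec Ck_on ::
  "nat \<Rightarrow> 'a::real_normed_vector set \<Rightarrow> ('a \<Rightarrow> 'b::real_normed_vector) \<Rightarrow> bool" where
  "Ck_on 0 S f \<longleftrightarrow> continuous_on S f"
| "Ck_on (Suc k) S f \<longleftrightarrow>
     (\<forall>x\<in>S. f differentiable (at x)) \<and>
     (\<forall>v. Ck_on k S (\<lambda>x. frechet_derivative f (at x) v))"

text \<open>Only used for open sets of a finite-dimensional space.\<close>

definition smooth_on ::
  "'a::real_normed_vector set \<Rightarrow> ('a \<Rightarrow> 'b::real_normed_vector) \<Rightarrow> bool" where
  "smooth_on S f \<longleftrightarrow> (\<forall>k. Ck_on k S f)"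


section \<open>Closed oriented Riemannian three-manifolds\<close>

text \<open>
  The underlying topological space is the whole type \<open>'m\<close>.  A chart is a pair \<open>(U, \<phi>)\<close>, where only
  the values of \<open>\<phi>\<close> on \<open>U\<close> matter.

  The tangent space at a point \<open>p\<close> is identified with \<open>real^3\<close> by means of one chosen chart
  \<open>chart_at M p\<close> around \<open>p\<close>.  Under this identification a vector field is a function on \<open>'m\<close> with
  values in \<open>real^3\<close>, and metrics and differential forms are functions on \<open>'m\<close> with values in
  (multi)linear maps on \<open>real^3\<close>.  The value at \<open>p\<close> transforms to the coordinates of any other
  chart by the derivative of the coordinate change (\<open>jac\<close>); smoothness is tested in all charts.
\<close>

type_synonym 'm chart = "'m set \<times> ('m \<Rightarrow> real^3)"

record 'm riem_manifold =
  charts :: "'m chart set"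
  metric :: "'m \<Rightarrow> real^3 \<Rightarrow> real^3 \<Rightarrow> real"

definition chart_inv :: "'m chart \<Rightarrow> real^3 \<Rightarrow> 'm" where
  "chart_inv c = inv_into (fst c) (snd c)"

definition chart_at :: "('m, 'z) riem_manifold_scheme \<Rightarrow> 'm \<Rightarrow> 'm chart" where
  "chart_at M p = (SOME c. c \<in> charts M \<and> p \<in> fst c)"

definition jac :: "'m chart \<Rightarrow> 'm chart \<Rightarrow> 'm \<Rightarrow> real^3 \<Rightarrow> real^3" where
  "jac c d p = frechet_derivative (snd d \<circ> chart_inv c) (at (snd c p))"

definition oriented_smooth_atlas :: "'m::topological_space chart set \<Rightarrow> bool" where
  "oriented_smooth_atlas A \<longleftrightarrow>
     (\<Union>c\<in>A. fst c) = UNIV \<and>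
     (\<forall>c\<in>A. open (fst c) \<and> open (snd c ` fst c) \<and>
        homeomorphism (fst c) (snd c ` fst c) (snd c) (chart_inv c)) \<and>
     (\<forall>c\<in>A. \<forall>d\<in>A. smooth_on (snd c ` (fst c \<inter> fst d)) (snd d \<circ> chart_inv c)) \<and>
     (\<forall>c\<in>A. \<forall>d\<in>A. \<forall>p\<in>fst c \<inter> fst d. det (matrix (jac c d p)) > 0)"

definition local_metric ::
  "('m, 'z) riem_manifold_scheme \<Rightarrow> 'm chart \<Rightarrow> real^3 \<Rightarrow> real^3 \<Rightarrow> real^3 \<Rightarrow> real" where
  "local_metric M c x v w = (let p = chart_inv c x; T = jac c (chart_at M p) p
     in metric M p (T v) (T w))"

definition riemannian_metric :: "('m, 'z) riem_manifold_scheme \<Rightarrow> bool" where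
  "riemannian_metric M \<longleftrightarrow>
     (\<forall>p. bilinear (metric M p) \<and>
          (\<forall>v w. metric M p v w = metric M p w v) \<and>
          (\<forall>v. v \<noteq> 0 \<longrightarrow> metric M p v v > 0)) \<and>
     (\<forall>c\<in>charts M. \<forall>v w. smooth_on (snd c ` fst c) (\<lambda>x. local_metric M c x v w))"

definition closed_oriented_riemannian_3manifold ::
  "('m::t2_space, 'z) riem_manifold_scheme \<Rightarrow> bool" where
  "closed_oriented_riemannian_3manifold M \<longleftrightarrow>
     compact (UNIV :: 'm set) \<and> oriented_smooth_atlas (charts M) \<and> riemannian_metric M"

text \<open>The Riemannian measure has density \<open>sqrt (det (g\<^sub>i\<^sub>j))\<close> in every chart.\<close>

definition riemannian_measure ::
  "('m::topological_space, 'z) riem_manifold_scheme \<Rightarrow> 'm measure \<Rightarrow> bool" where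
  "riemannian_measure M \<mu> \<longleftrightarrow> sets \<mu> = sets borel \<and>
     (\<forall>c\<in>charts M. \<forall>S\<in>sets borel. S \<subseteq> fst c \<longrightarrow>
        emeasure \<mu> S =
          (\<integral>\<^sup>+ x. ennreal (sqrt (det (\<chi> i j. local_metric M c x (axis i 1) (axis j 1))))
               * indicator (snd c ` S) x \<partial>lborel))"

definition has_total_volume ::
  "('m::topological_space, 'z) riem_manifold_scheme \<Rightarrow> ennreal \<Rightarrow> bool" where
  "has_total_volume M v \<longleftrightarrow> (\<exists>\<mu>. riemannian_measure M \<mu> \<and> emeasure \<mu> UNIV = v)"


section \<open>Alternating forms on the tangent spaces\<close>

text \<open>
  Time-dependent objects are power series in the time \<open>t\<close>, so that scalars are \<open>real fps\<close>
  throughout.  A \<open>k\<close>-form on \<open>real^3\<close> is an alternating multilinear function of lists of length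
  \<open>k\<close>, extended by zero to all other lists; an inhomogeneous form is a sum of such functions for
  different \<open>k\<close>, so that the degree is the length of the list.
\<close>

type_synonym alt = "(real^3) list \<Rightarrow> real fps"

definition alt_form :: "nat \<Rightarrow> alt \<Rightarrow> bool" where
  "alt_form k \<alpha> \<longleftrightarrow>
     (\<forall>vs. length vs \<noteq> k \<longrightarrow> \<alpha> vs = 0) \<and>
     (\<forall>vs. \<not> distinct vs \<longrightarrow> \<alpha> vs = 0) \<and>
     (\<forall>vs ws a b v w. \<alpha> (vs @ (a *\<^sub>R v + b *\<^sub>R w) # ws) =
        fps_const a * \<alpha> (vs @ v # ws) + fps_const b * \<alpha> (vs @ w # ws))"

definition part :: "nat \<Rightarrow> alt \<Rightarrow> alt" where
  "part k \<alpha> vs = (if length vs = k then \<alpha> vs else 0)"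

text \<open>
  The sign of the shuffle which moves the arguments with positions in \<open>S\<close> to the front.
\<close>

definition shuffle_sign :: "nat \<Rightarrow> nat set \<Rightarrow> real fps" where
  "shuffle_sign n S = (-1) ^ card {(i, j). i < j \<and> j < n \<and> i \<notin> S \<and> j \<in> S}"

definition wedge_alt :: "alt \<Rightarrow> alt \<Rightarrow> alt" where
  "wedge_alt \<alpha> \<beta> vs =
     (\<Sum>S\<in>Pow {..<length vs}. shuffle_sign (length vs) S * \<alpha> (nths vs S) * \<beta> (nths vs (- S)))"

definition onb :: "(real^3 \<Rightarrow> real^3 \<Rightarrow> real) \<Rightarrow> (real^3) list \<Rightarrow> bool" where
  "onb g es \<longleftrightarrow> length es = 3 \<and>
     (\<forall>i<3. \<forall>j<3. g (es ! i) (es ! j) = (if i = j then 1 else 0))"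

text \<open>
  The inner product induced by \<open>g\<close> on forms: the increasing products of the elements of the basis
  dual to an orthonormal one are orthonormal.  The value does not depend on the chosen basis.
\<close>

definition inner_alt :: "(real^3 \<Rightarrow> real^3 \<Rightarrow> real) \<Rightarrow> alt \<Rightarrow> alt \<Rightarrow> real fps" where
  "inner_alt g \<alpha> \<beta> = (let es = (SOME es. onb g es)
     in \<Sum>I\<in>Pow {..<3}. \<alpha> (nths es I) * \<beta> (nths es I))"

definition vol_alt :: "(real^3 \<Rightarrow> real^3 \<Rightarrow> real) \<Rightarrow> alt" where
  "vol_alt g vs = (if length vs = 3
     then fps_const (sqrt (det (\<chi> i j. g (axis i 1) (axis j 1))) * det (vector vs :: real^3^3))
     else 0)"

definition hodge_alt :: "(real^3 \<Rightarrow> real^3 \<Rightarrow> real) \<Rightarrow> nat \<Rightarrow> alt \<Rightarrow> alt" where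
  "hodge_alt g k \<beta> = (THE \<gamma>. alt_form (3 - k) \<gamma> \<and>
     (\<forall>\<alpha>. alt_form k \<alpha> \<longrightarrow> wedge_alt \<alpha> \<gamma> = (\<lambda>vs. inner_alt g \<alpha> \<beta> * vol_alt g vs)))"


section \<open>Differential forms and vector fields\<close>

type_synonym 'm fn = "'m \<Rightarrow> real fps"
type_synonym 'm form = "'m \<Rightarrow> alt"
type_synonym 'm vfield = "'m \<Rightarrow> (real fps)^3"

definition local_form ::
  "('m, 'z) riem_manifold_scheme \<Rightarrow> 'm chart \<Rightarrow> 'm form \<Rightarrow> real^3 \<Rightarrow> alt" where
  "local_form M c \<omega> x vs = (let p = chart_inv c x
     in \<omega> p (map (jac c (chart_at M p) p) vs))"

definition smooth_form ::
  "('m, 'z) riem_manifold_scheme \<Rightarrow> nat \<Rightarrow> 'm form \<Rightarrow> bool" where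
  "smooth_form M k \<omega> \<longleftrightarrow> (\<forall>p. alt_form k (\<omega> p)) \<and>
     (\<forall>c\<in>charts M. \<forall>n vs. smooth_on (snd c ` fst c) (\<lambda>x. fps_nth (local_form M c \<omega> x vs) n))"

definition smooth_fn :: "('m, 'z) riem_manifold_scheme \<Rightarrow> 'm fn \<Rightarrow> bool" where
  "smooth_fn M f \<longleftrightarrow>
     (\<forall>c\<in>charts M. \<forall>n. smooth_on (snd c ` fst c) (\<lambda>x. fps_nth (f (chart_inv c x)) n))"

definition smooth_vfield :: "('m, 'z) riem_manifold_scheme \<Rightarrow> 'm vfield \<Rightarrow> bool" where
  "smooth_vfield M u \<longleftrightarrow>
     (\<forall>c\<in>charts M. \<forall>n. smooth_on (snd c ` fst c)
        (\<lambda>x. let p = chart_inv c x in jac (chart_at M p) c p (\<chi> i. fps_nth (u p $ i) n)))"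

definition form0 :: "'m fn \<Rightarrow> 'm form" where
  "form0 f p vs = (if vs = [] then f p else 0)"

definition fn_of :: "'m form \<Rightarrow> 'm fn" where
  "fn_of \<omega> p = \<omega> p []"

definition scale :: "'m fn \<Rightarrow> 'm form \<Rightarrow> 'm form"  (infixr \<open>\<cdot>\<close> 75) where
  "(f \<cdot> \<omega>) p vs = f p * \<omega> p vs"

definition vscale :: "'m fn \<Rightarrow> 'm vfield \<Rightarrow> 'm vfield"  (infixr \<open>\<cdot>\<^sub>v\<close> 75) where
  "(f \<cdot>\<^sub>v u) p = f p *s u p"

definition recip :: "'m fn \<Rightarrow> 'm fn" where
  "recip f p = inverse (f p)"

definition half :: "'m fn" where
  "half p = fps_const (1 / 2)"

definition wedge :: "'m form \<Rightarrow> 'm form \<Rightarrow> 'm form"  (infixr \<open>\<wedge>\<close> 72) where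
  "(\<alpha> \<wedge> \<beta>) p = wedge_alt (\<alpha> p) (\<beta> p)"

definition hodge :: "('m, 'z) riem_manifold_scheme \<Rightarrow> 'm form \<Rightarrow> 'm form" where
  "hodge M \<omega> p = (\<Sum>k\<le>3. hodge_alt (metric M p) k (part k (\<omega> p)))"

definition dir_deriv :: "(real^3 \<Rightarrow> real fps) \<Rightarrow> real^3 \<Rightarrow> real^3 \<Rightarrow> real fps" where
  "dir_deriv F x v = Abs_fps (\<lambda>n. frechet_derivative (\<lambda>y. fps_nth (F y) n) (at x) v)"

text \<open>Exterior derivative, in the coordinates which identify the tangent space at \<open>p\<close>.\<close>

definition ext_d :: "('m, 'z) riem_manifold_scheme \<Rightarrow> 'm form \<Rightarrow> 'm form" where
  "ext_d M \<omega> p vs = (let c = chart_at M p in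
     \<Sum>i<length vs. (-1) ^ i *
       dir_deriv (\<lambda>x. local_form M c \<omega> x (take i vs @ drop (Suc i) vs)) (snd c p) (vs ! i))"

definition codiff :: "('m, 'z) riem_manifold_scheme \<Rightarrow> 'm form \<Rightarrow> 'm form" where
  "codiff M \<omega> = (\<lambda>p vs. \<Sum>i\<le>3.
     (-1) ^ (3 * i + 1) * hodge M (ext_d M (hodge M (\<lambda>q. part i (\<omega> q)))) p vs)"

definition flat :: "('m, 'z) riem_manifold_scheme \<Rightarrow> 'm vfield \<Rightarrow> 'm form" where
  "flat M u p vs = (if length vs = 1
     then (\<Sum>i\<in>UNIV. u p $ i * fps_const (metric M p (axis i 1) (hd vs))) else 0)"

definition sharp :: "('m, 'z) riem_manifold_scheme \<Rightarrow> 'm form \<Rightarrow> 'm vfield" where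
  "sharp M \<alpha> = (THE u. flat M u = \<alpha>)"

definition dot :: "('m, 'z) riem_manifold_scheme \<Rightarrow> 'm vfield \<Rightarrow> 'm vfield \<Rightarrow> 'm fn" where
  "dot M u v p =
     (\<Sum>i\<in>UNIV. \<Sum>j\<in>UNIV. u p $ i * v p $ j * fps_const (metric M p (axis i 1) (axis j 1)))"

definition grad :: "('m, 'z) riem_manifold_scheme \<Rightarrow> 'm fn \<Rightarrow> 'm vfield" where
  "grad M f = sharp M (ext_d M (form0 f))"

definition divergence :: "('m, 'z) riem_manifold_scheme \<Rightarrow> 'm vfield \<Rightarrow> 'm fn" where
  "divergence M u = fn_of (codiff M (flat M u))"

definition curl :: "('m, 'z) riem_manifold_scheme \<Rightarrow> 'm vfield \<Rightarrow> 'm vfield" where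
  "curl M u = sharp M (hodge M (ext_d M (flat M u)))"

definition cross :: "('m, 'z) riem_manifold_scheme \<Rightarrow> 'm vfield \<Rightarrow> 'm vfield \<Rightarrow> 'm vfield" where
  "cross M u v = sharp M (hodge M (flat M u \<wedge> flat M v))"

definition dt_fn :: "'m fn \<Rightarrow> 'm fn" where
  "dt_fn f p = fps_deriv (f p)"

definition dt_vfield :: "'m vfield \<Rightarrow> 'm vfield" where
  "dt_vfield u p = (\<chi> i. fps_deriv (u p $ i))"

definition dt_form :: "'m form \<Rightarrow> 'm form" where
  "dt_form \<omega> p vs = fps_deriv (\<omega> p vs)"


section \<open>The compressible Euler equations\<close>

text \<open>A power series in \<open>t\<close> is positive if its value at \<open>t = 0\<close> is.\<close>

definition euler_solution ::
  "('m, 'z) riem_manifold_scheme \<Rightarrow> 'm fn \<Rightarrow> 'm vfield \<Rightarrow> 'm fn \<Rightarrow> bool" where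
  "euler_solution M \<rho> u pr \<longleftrightarrow>
     smooth_fn M \<rho> \<and> smooth_vfield M u \<and> smooth_fn M pr \<and> (\<forall>x. fps_nth (\<rho> x) 0 > 0) \<and>
     dt_fn \<rho> + divergence M (\<rho> \<cdot>\<^sub>v u) = 0 \<and>
     dt_vfield u + grad M (half * dot M u u) - cross M u (curl M u) + recip \<rho> \<cdot>\<^sub>v grad M pr = 0"


section \<open>Homotopies of collections of homotopy random variables\<close>

text \<open>
  The triple \<open>(a, b, m)\<close> stands for the monomial \<open>dt\<^sup>a \<epsilon>\<^sup>b (d\<epsilon>)\<^sup>m\<close> (factors in this order, with \<open>a\<close>
  and \<open>b\<close> exponents \<open>0\<close> or \<open>1\<close>), whose degree is minus \<open>mdeg (a, b, m)\<close>.  An element of the tensor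
  product of the forms with \<open>R[[t, dt]]\<close> assigns to each monomial its coefficient, a form that
  is a power series in \<open>t\<close> and stands to the left of the monomial.
\<close>

type_synonym mono = "bool \<times> bool \<times> nat"
type_synonym 'm elem = "mono \<Rightarrow> 'm form"

fun mdeg :: "mono \<Rightarrow> nat" where
  "mdeg (a, b, m) = of_bool a + of_bool b + 2 * m"

definition tens :: "'m form \<Rightarrow> mono \<Rightarrow> 'm elem"  (infix \<open>\<otimes>\<close> 70) where
  "(\<omega> \<otimes> \<mu>) \<nu> = (if \<nu> = \<mu> then \<omega> else 0)"

definition grade_sign :: "nat \<Rightarrow> 'm form \<Rightarrow> 'm form" where
  "grade_sign k \<omega> p vs = (-1) ^ (k * length vs) * \<omega> p vs"

text \<open>
  Koszul signs: moving a monomial \<open>\<mu>\<close> past a form \<open>\<omega>\<close> gives \<open>(-1)\<^bsup>|\<mu>||\<omega>|\<^esup>\<close>, and moving the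
  \<open>\<epsilon>\<close> of the first factor past the \<open>dt\<close> of the second gives another sign.
\<close>

fun elem_mult :: "'m elem \<Rightarrow> 'm elem \<Rightarrow> 'm elem" where
  "elem_mult x y (a, b, m) = (\<lambda>p vs.
     \<Sum>a1\<in>{a1. a1 \<longrightarrow> a}. \<Sum>b1\<in>{b1. b1 \<longrightarrow> b}. \<Sum>m1\<le>m.
       (let a2 = (a \<and> \<not> a1); b2 = (b \<and> \<not> b1); \<mu> = (a1, b1, m1); \<nu> = (a2, b2, m - m1) in
         (if b1 \<and> a2 then -1 else 1) * (x \<mu> \<wedge> grade_sign (mdeg \<mu>) (y \<nu>)) p vs))"

definition elem_one :: "'m elem" where
  "elem_one = form0 (\<lambda>_. 1) \<otimes> (False, False, 0)"

definition elem_power :: "'m elem \<Rightarrow> nat \<Rightarrow> 'm elem" where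
  "elem_power x k = (elem_mult x ^^ k) elem_one"

text \<open>
  Both exponentials are the exponential series, summed coefficientwise.  The exponential series
  of a power series \<open>f\<close> converges for all values of its constant coefficient.
\<close>

definition exp_fn :: "'m fn \<Rightarrow> 'm fn" where
  "exp_fn f p = Abs_fps (\<lambda>n. \<Sum>k. fps_nth (f p ^ k) n / fact k)"

definition elem_exp :: "'m elem \<Rightarrow> 'm elem" where
  "elem_exp x \<mu> p vs = Abs_fps (\<lambda>n. \<Sum>k. fps_nth (elem_power x k \<mu> p vs) n / fact k)"

text \<open>
  The total differential: \<open>\<omega> \<otimes> r\<close> is sent to \<open>\<delta>\<omega> \<otimes> r + (-1)\<^bsup>|\<omega>|\<^esup> \<omega> \<otimes> dr\<close>, where
  \<open>d(\<phi> dt\<^sup>a \<epsilon>\<^sup>b (d\<epsilon>)\<^sup>m) = \<phi>' dt dt\<^sup>a \<epsilon>\<^sup>b (d\<epsilon>)\<^sup>m + (-1)\<^sup>a \<phi> dt\<^sup>a d(\<epsilon>\<^sup>b) (d\<epsilon>)\<^sup>m\<close> for a power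
  series \<open>\<phi>\<close> in \<open>t\<close>.
\<close>

fun elem_diff :: "('m, 'z) riem_manifold_scheme \<Rightarrow> 'm elem \<Rightarrow> 'm elem" where
  "elem_diff M x (a, b, m) = codiff M (x (a, b, m))
     + (if a then grade_sign 1 (dt_form (x (False, b, m))) else 0)
     + (if \<not> b \<and> m > 0
        then (if a then -1 else 1) * grade_sign 1 (x (a, True, m - 1)) else 0)"

definition degree_zero :: "('m, 'z) riem_manifold_scheme \<Rightarrow> 'm elem \<Rightarrow> bool" where
  "degree_zero M x \<longleftrightarrow> (\<forall>\<mu>. smooth_form M (mdeg \<mu>) (x \<mu>))"

definition homotopy :: "('m, 'z) riem_manifold_scheme \<Rightarrow> 'm elem \<Rightarrow> bool" where
  "homotopy M x \<longleftrightarrow> degree_zero M x \<and> elem_diff M (elem_exp x) = 0"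

definition elem_of ::
  "'m fn \<Rightarrow> 'm form \<Rightarrow> 'm form \<Rightarrow> 'm form \<Rightarrow> 'm form \<Rightarrow> 'm form \<Rightarrow> 'm form \<Rightarrow> 'm elem" where
  "elem_of f X V \<pi> \<sigma> \<Phi> \<Psi> =
     form0 f \<otimes> (False, False, 0)
     + X \<otimes> (True, False, 0) + V \<otimes> (False, True, 0)
     + \<pi> \<otimes> (True, True, 0) + \<sigma> \<otimes> (False, False, 1)
     + \<Phi> \<otimes> (True, False, 1) + \<Psi> \<otimes> (False, True, 1)"

definition \<pi>_of :: "('m, 'z) riem_manifold_scheme \<Rightarrow> 'm form \<Rightarrow> 'm form" where
  "\<pi>_of M X = half \<cdot> codiff M (X \<wedge> hodge M X) - codiff M X \<wedge> hodge M X"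

definition euler_identification ::
  "('m, 'z) riem_manifold_scheme \<Rightarrow> 'm fn \<Rightarrow> 'm vfield \<Rightarrow> 'm fn \<Rightarrow>
   'm fn \<Rightarrow> 'm form \<Rightarrow> 'm form \<Rightarrow> 'm form \<Rightarrow> 'm form \<Rightarrow> 'm form \<Rightarrow> 'm form \<Rightarrow> bool" where
  "euler_identification M \<rho> u pr f X V \<pi> \<sigma> \<Phi> \<Psi> \<longleftrightarrow>
     exp_fn f = \<rho> \<and>
     X = flat M u \<and>
     V = - (recip \<rho> \<cdot> hodge M (ext_d M (\<rho> \<cdot> X))) \<and>
     \<pi> = \<pi>_of M X \<and>
     \<sigma> = hodge M X \<and>
     \<Phi> = recip \<rho> \<cdot> hodge M (form0 pr) \<and>
     \<Psi> = X \<wedge> ext_d M X"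

text \<open>Every element of degree zero has the form \<open>elem_of f X V \<pi> \<sigma> \<Phi> \<Psi>\<close>.\<close>

lemma alt_form_sum:
  assumes "alt_form k \<alpha>" "finite T"
  shows "\<alpha> (vs @ (\<Sum>w\<in>T. c w *\<^sub>R w) # ws) = (\<Sum>w\<in>T. fps_const (c w) * \<alpha> (vs @ w # ws))"
  using assms(2)
proof (induction T)
  case empty
  have "\<alpha> (vs @ (0 *\<^sub>R 0 + 0 *\<^sub>R 0) # ws) = fps_const 0 * \<alpha> (vs @ 0 # ws) + fps_const 0 * \<alpha> (vs @ 0 # ws)"
    using assms(1) unfolding alt_form_def by blast
  then show ?case by simp
next
  case (insert w T)
  have "\<alpha> (vs @ (c w *\<^sub>R w + 1 *\<^sub>R (\<Sum>w\<in>T. c w *\<^sub>R w)) # ws) =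
      fps_const (c w) * \<alpha> (vs @ w # ws) + fps_const 1 * \<alpha> (vs @ (\<Sum>w\<in>T. c w *\<^sub>R w) # ws)"
    using assms(1) unfolding alt_form_def by blast
  then show ?case using insert by simp
qed

lemma alt_form_gt_3:
  assumes a: "alt_form k \<alpha>" and k: "k > 3"
  shows "\<alpha> = 0"
proof (rule ext)
  fix vs :: "(real^3) list"
  show "\<alpha> vs = 0 vs"
  proof (cases "length vs = k \<and> distinct vs")
    case False
    then show ?thesis using a unfolding alt_form_def by auto
  next
    case True
    then have "card (set vs) > DIM(real^3)"
      using k by (simp add: distinct_card)
    then have "dependent (set vs)"
      using independent_card_le[of "set vs"] by force
    then obtain v where v: "v \<in> set vs" "v \<in> span (set vs - {v})"
      unfolding dependent_def by blast
    obtain xs ys where vs: "vs = xs @ v # ys" using v(1) by (meson split_list)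
    have "finite (set vs - {v})" by simp
    from v(2)[unfolded span_finite[OF this]]
    obtain c where c: "v = (\<Sum>w\<in>set vs - {v}. c w *\<^sub>R w)" by blast
    have z: "\<alpha> (xs @ w # ys) = 0" if "w \<in> set vs - {v}" for w
    proof -
      have "\<not> distinct (xs @ w # ys)" using that vs by auto
      then show ?thesis using a unfolding alt_form_def by blast
    qed
    have "\<alpha> vs = \<alpha> (xs @ (\<Sum>w\<in>set vs - {v}. c w *\<^sub>R w) # ys)"
      by (subst c[symmetric]) (simp only: vs)
    also have "\<dots> = (\<Sum>w\<in>set vs - {v}. fps_const (c w) * \<alpha> (xs @ w # ys))"
      by (rule alt_form_sum[OF a]) simp
    also have "\<dots> = 0" using z by (intro sum.neutral) auto
    finally show ?thesis by simp
  qed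
qed

lemma degree_zero_elem_of:
  assumes "degree_zero M x"
  shows "\<exists>f X V \<pi> \<sigma> \<Phi> \<Psi>. x = elem_of f X V \<pi> \<sigma> \<Phi> \<Psi>"
proof -
  have alt: "alt_form (mdeg \<mu>) (x \<mu> p)" for \<mu> p
    using assms unfolding degree_zero_def smooth_form_def by blast
  have z: "x \<mu> = 0" if "mdeg \<mu> > 3" for \<mu>
    using alt_form_gt_3[OF alt that] by (auto simp: fun_eq_iff)
  have "alt_form 0 (x (False, False, 0) p)" for p using alt[of "(False, False, 0)" p] by simp
  then have f: "form0 (fn_of (x (False, False, 0))) = x (False, False, 0)"
    by (auto simp: fun_eq_iff form0_def fn_of_def alt_form_def)
  let ?y = "elem_of (fn_of (x (False, False, 0))) (x (True, False, 0))
      (x (False, True, 0)) (x (True, True, 0)) (x (False, False, 1)) (x (True, False, 1))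
      (x (False, True, 1))"
  have "x (a, b, m) = ?y (a, b, m)" for a b m
  proof (cases "mdeg (a, b, m) > 3")
    case True
    then have "m \<ge> 2 \<or> m = 1 \<and> a \<and> b" by (cases a; cases b) auto
    then show ?thesis unfolding z[OF True] by (auto simp: elem_of_def tens_def simp del: mdeg.simps)
  next
    case False
    then have "m = 0 \<or> m = 1 \<and> \<not> (a \<and> b)" by (cases a; cases b) auto
    then show ?thesis by (cases a; cases b) (auto simp: elem_of_def tens_def f)
  qed
  then have "x \<mu> = ?y \<mu>" for \<mu> by (metis prod.exhaust)
  then have "x = ?y" by (rule ext)
  then show ?thesis by blast
qed

end

theory Submission
  imports Defs
begin

text \<open>
  Write \<open>\<star>\<close> for the Hodge star, \<open>\<delta>\<close> for the codifferential and \<open>r = exp f\<close> for the density.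

  In an element of degree zero the coefficient of a monomial is a form whose degree is that of the
  monomial.  All terms other than \<open>f\<close> contain forms of positive degree, and a product of three of
  them vanishes; so the exponential is \<open>r\<close> times a polynomial of degree two in these terms
  (\<open>elem_exp_values\<close>).  Reading off the coefficients of its differential turns the homotopy
  condition into seven equations (\<open>homotopy_iff\<close>), the eighth being the time derivative of
  \<open>r (\<Psi> + V \<sigma>) = 0\<close>.

  Let \<open>\<sigma> = \<star>X\<close>.  Since \<open>\<delta> = - \<star>d\<star>\<close> on two-forms, the equation \<open>\<delta>(r \<sigma>) = r V\<close> is
  \<open>r V = - \<star>d(r X)\<close>.  It implies \<open>V \<sigma> = - X dX\<close>, because \<open>\<star>B \<wedge> \<star>X = X \<wedge> B\<close> for a two-form \<open>B\<close>
  and \<open>X \<wedge> dr \<wedge> X = 0\<close>; so \<open>r (\<Psi> + V \<sigma>) = 0\<close> says \<open>\<Psi> = X dX\<close>.  The momentum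
  equation is contained in the coefficient of \<open>dt d\<epsilon>\<close>.  Let \<open>E\<close> be the one-form dual to the left hand
  side of the momentum equation, with pressure \<open>\<star>(r \<Phi>)\<close>.  The Leibniz rule and the vector identity
  \<open>a \<times> (b \<times> a) = |a|\<^sup>2 b - (a \<cdot> b) a\<close> show that this coefficient equals
  \<open>r \<star>E + (r' + \<delta>(r X)) \<star>X\<close> whenever \<open>r V = - \<star>d(r X)\<close> and \<open>\<pi>\<close> has the prescribed form
  (\<open>momentum_identity\<close>).  The second summand vanishes by the continuity equation, which is the
  coefficient of \<open>dt\<close>.  Hence the system contains the Euler equations and determines \<open>V\<close> and \<open>\<Psi>\<close>,
  which proves the second half.  For the first half \<open>f\<close> is the logarithm of the density, and
  the remaining equations follow from the ones above by applying \<open>\<delta>\<close>, with \<open>\<delta>\<delta> = 0\<close> and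
  \<open>\<delta> \<partial>\<^sub>t = \<partial>\<^sub>t \<delta>\<close>.

  The rest is the calculus of forms.  Tangent spaces at different points are identified with
  \<open>real^3\<close> by unrelated charts.  So smoothness of \<open>\<star>\<omega>\<close> and \<open>d\<omega>\<close>, and \<open>dd = 0\<close>, rest on the
  compatibility of both operators with changes of coordinates (\<open>hodge_alt_pullback\<close>,
  \<open>coord_d_pullback\<close>).  For the star this follows from its defining property, because the inner
  product of forms does not depend on the orthonormal basis; for \<open>d\<close> it is the symmetry
  of second derivatives.  In coordinates the star acts on components by the matrices
  \<open>vol g \<cdot> G\<^sup>-\<^sup>1\<close> and \<open>vol g \<cdot> cofactors (G\<^sup>-\<^sup>1)\<close>, where \<open>G\<close> is the Gram matrix of the metric.
\<close>

section \<open>The wedge product\<close>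

text \<open>
  The degree is left open, so that the property survives fixing the first argument and changing
  signs degree by degree; this permits induction along the list of arguments.
\<close>

definition alternating :: "alt \<Rightarrow> bool" where
  "alternating \<alpha> \<longleftrightarrow> (\<forall>xs v zs. \<alpha> (xs @ v # v # zs) = 0) \<and>
     (\<forall>vs ws a b v w. \<alpha> (vs @ (a *\<^sub>R v + b *\<^sub>R w) # ws) =
        fps_const a * \<alpha> (vs @ v # ws) + fps_const b * \<alpha> (vs @ w # ws))"

lemma alternating_linear:
  "alternating \<alpha> \<Longrightarrow> \<alpha> (vs @ (a *\<^sub>R v + b *\<^sub>R w) # ws) =
     fps_const a * \<alpha> (vs @ v # ws) + fps_const b * \<alpha> (vs @ w # ws)"
  unfolding alternating_def by blast

lemma alternating_swap:
  assumes "alternating \<alpha>"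
  shows "\<alpha> (xs @ v # w # zs) = - \<alpha> (xs @ w # v # zs)"
proof -
  have l: "\<alpha> (ys @ (a + b) # ws) = \<alpha> (ys @ a # ws) + \<alpha> (ys @ b # ws)" for ys ws a b
    using alternating_linear[OF assms, of ys 1 a 1 b ws] by simp
  have z: "\<alpha> (ys @ a # a # ws) = 0" for ys ws a
    using assms unfolding alternating_def by blast
  have "0 = \<alpha> (xs @ (v + w) # (v + w) # zs)" using z by simp
  also have "\<dots> = \<alpha> (xs @ v # (v + w) # zs) + \<alpha> (xs @ w # (v + w) # zs)" by (rule l)
  also have "\<dots> = \<alpha> ((xs @ [v]) @ (v + w) # zs) + \<alpha> ((xs @ [w]) @ (v + w) # zs)" by simp
  also have "\<dots> = \<alpha> (xs @ v # w # zs) + \<alpha> (xs @ w # v # zs)"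
    unfolding l using z[of xs v zs] z[of xs w zs] by simp
  finally show ?thesis by (simp add: eq_neg_iff_add_eq_0)
qed

text \<open>
  Equal arguments are brought next to each other by transpositions of neighbours.
\<close>

lemma alternating_not_distinct:
  assumes "alternating \<alpha>" "\<not> distinct vs"
  shows "\<alpha> vs = 0"
proof -
  obtain xs ys zs y where vs: "vs = xs @ [y] @ ys @ [y] @ zs"
    using not_distinct_decomp[OF assms(2)] by blast
  have "\<alpha> (xs @ y # ys @ y # zs) = 0" for xs
  proof (induction ys arbitrary: xs)
    case Nil
    then show ?case using assms(1) unfolding alternating_def by simp
  next
    case (Cons u ys)
    have "\<alpha> (xs @ y # (u # ys) @ y # zs) = - \<alpha> (xs @ u # y # ys @ y # zs)"
      using alternating_swap[OF assms(1), of xs y u "ys @ y # zs"] by simp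
    also have "\<dots> = - \<alpha> ((xs @ [u]) @ y # ys @ y # zs)" by simp
    finally show ?case using Cons[of "xs @ [u]"] by simp
  qed
  then show ?thesis using vs by simp
qed

lemma alt_form_iff: "alt_form k \<alpha> \<longleftrightarrow> alternating \<alpha> \<and> (\<forall>vs. length vs \<noteq> k \<longrightarrow> \<alpha> vs = 0)"
proof
  assume a: "alt_form k \<alpha>"
  then have "\<alpha> (xs @ v # v # zs) = 0" for xs v zs
    unfolding alt_form_def by (metis distinct_append distinct_length_2_or_more)
  then show "alternating \<alpha> \<and> (\<forall>vs. length vs \<noteq> k \<longrightarrow> \<alpha> vs = 0)"
    using a unfolding alt_form_def alternating_def by blast
next
  assume "alternating \<alpha> \<and> (\<forall>vs. length vs \<noteq> k \<longrightarrow> \<alpha> vs = 0)"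
  then show "alt_form k \<alpha>"
    using alternating_not_distinct[of \<alpha>] unfolding alt_form_def alternating_def by blast
qed

lemma alt_form_imp_alternating: "alt_form k \<alpha> \<Longrightarrow> alternating \<alpha>"
  by (simp add: alt_form_iff)

lemma alt_form_length: "alt_form k \<alpha> \<Longrightarrow> length vs \<noteq> k \<Longrightarrow> \<alpha> vs = 0"
  by (simp add: alt_form_iff)

text \<open>
  The sum over shuffles is split according to whether the first argument goes to the left factor.
\<close>

lemma sum_Pow_lessThan_Suc:
  fixes h :: "nat set \<Rightarrow> 'a::comm_monoid_add"
  shows "(\<Sum>S\<in>Pow {..<Suc n}. h S) =
    (\<Sum>S\<in>Pow {..<n}. h (insert 0 (Suc ` S))) + (\<Sum>S\<in>Pow {..<n}. h (Suc ` S))"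
proof -
  let ?A = "(\<lambda>S. insert 0 (Suc ` S)) ` Pow {..<n}" and ?B = "(\<lambda>S. Suc ` S) ` Pow {..<n}"
  have P: "Pow {..<Suc n} = ?A \<union> ?B"
  proof (intro equalityI subsetI)
    fix S assume S: "S \<in> Pow {..<Suc n}"
    define T where "T = {j. Suc j \<in> S}"
    have T: "T \<in> Pow {..<n}" using S by (auto simp: T_def)
    have ST: "Suc ` T = S - {0}"
      by (auto simp: T_def image_iff) (metis not0_implies_Suc)
    show "S \<in> ?A \<union> ?B"
    proof (cases "0 \<in> S")
      case True
      then have "S = insert 0 (Suc ` T)" using ST by auto
      then show ?thesis using T by blast
    next
      case False
      then have "S = Suc ` T" using ST by auto
      then show ?thesis using T by blast
    qed
  qed (auto simp: less_Suc_eq_0_disj)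
  have iA: "inj_on (\<lambda>S. insert 0 (Suc ` S)) (Pow {..<n})"
  proof (rule inj_onI)
    fix S T :: "nat set"
    assume "insert 0 (Suc ` S) = insert 0 (Suc ` T)"
    then have "Suc ` S = Suc ` T" by auto
    then show "S = T" by (simp add: inj_image_eq_iff)
  qed
  have iB: "inj_on (\<lambda>S. Suc ` S) (Pow {..<n})"
    by (rule inj_onI) (simp add: inj_image_eq_iff)
  have "?A \<inter> ?B = {}" by auto
  then have "sum h (?A \<union> ?B) = sum h ?A + sum h ?B" by (intro sum.union_disjoint) auto
  then show ?thesis unfolding P by (simp add: sum.reindex[OF iA] sum.reindex[OF iB] o_def)
qed

lemma nths_Cons_in: "nths (v # vs) (insert 0 (Suc ` S)) = v # nths vs S"
  by (simp add: nths_Cons inj_image_mem_iff)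

lemma nths_Cons_out: "nths (v # vs) (Suc ` S) = nths vs S"
  by (simp add: nths_Cons inj_image_mem_iff image_iff)

lemma nths_Cons_cin: "nths (v # vs) (- insert 0 (Suc ` S)) = nths vs (- S)"
  by (simp add: nths_Cons inj_image_mem_iff Collect_neg_eq)

lemma nths_Cons_cout: "nths (v # vs) (- (Suc ` S)) = v # nths vs (- S)"
  by (simp add: nths_Cons inj_image_mem_iff image_iff Collect_neg_eq)

lemma Suc_Suc_mem_image: "(Suc a, Suc b) \<in> map_prod Suc Suc ` I \<longleftrightarrow> (a, b) \<in> I"
  by force

lemma zero_mem_image: "(0, b) \<notin> map_prod Suc Suc ` I" "(a, 0) \<notin> map_prod Suc Suc ` I"
  by force+

lemma card_map_prod_Suc: "card (map_prod Suc Suc ` I) = card I"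
  by (rule card_image) (auto simp: inj_on_def)

lemma shuffle_sign_in: "shuffle_sign (Suc n) (insert 0 (Suc ` S)) = shuffle_sign n S"
proof -
  have "(a, b) \<in> {(i, j). i < j \<and> j < Suc n \<and> i \<notin> insert 0 (Suc ` S) \<and> j \<in> insert 0 (Suc ` S)} \<longleftrightarrow>
      (a, b) \<in> map_prod Suc Suc ` {(i, j). i < j \<and> j < n \<and> i \<notin> S \<and> j \<in> S}" for a b
    by (cases a; cases b) (simp_all add: Suc_Suc_mem_image zero_mem_image inj_image_mem_iff)
  then have "{(i, j). i < j \<and> j < Suc n \<and> i \<notin> insert 0 (Suc ` S) \<and> j \<in> insert 0 (Suc ` S)} =
      map_prod Suc Suc ` {(i, j). i < j \<and> j < n \<and> i \<notin> S \<and> j \<in> S}"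
    unfolding set_eq_iff split_paired_All by (intro allI)
  then show ?thesis
    unfolding shuffle_sign_def by (simp only: card_map_prod_Suc)
qed

text \<open>
  The new inversions are the pairs of the first position with the positions in \<open>S\<close>.
\<close>

lemma shuffle_sign_out:
  assumes "S \<subseteq> {..<n}"
  shows "shuffle_sign (Suc n) (Suc ` S) = (-1) ^ card S * shuffle_sign n S"
proof -
  let ?I = "{(i, j). i < j \<and> j < n \<and> i \<notin> S \<and> j \<in> S}"
  have "(a, b) \<in> {(i, j). i < j \<and> j < Suc n \<and> i \<notin> Suc ` S \<and> j \<in> Suc ` S} \<longleftrightarrow>
      (a, b) \<in> (\<lambda>j. (0, Suc j)) ` S \<union> map_prod Suc Suc ` ?I" for a b
    using assms
    by (cases a; cases b) (auto simp: Suc_Suc_mem_image zero_mem_image inj_image_mem_iff image_iff)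
  then have e: "{(i, j). i < j \<and> j < Suc n \<and> i \<notin> Suc ` S \<and> j \<in> Suc ` S} =
      (\<lambda>j. (0, Suc j)) ` S \<union> map_prod Suc Suc ` ?I"
    unfolding set_eq_iff split_paired_All by (intro allI)
  have f: "finite S" using assms finite_subset by blast
  have "?I \<subseteq> {..<n} \<times> {..<n}" by auto
  then have fI: "finite ?I" by (rule finite_subset) simp
  have "card ((\<lambda>j. (0::nat, Suc j)) ` S \<union> map_prod Suc Suc ` ?I) =
      card ((\<lambda>j. (0::nat, Suc j)) ` S) + card (map_prod Suc Suc ` ?I)"
    using f fI by (intro card_Un_disjoint) auto
  also have "\<dots> = card S + card ?I" by (simp add: card_image card_map_prod_Suc inj_on_def)
  finally show ?thesis unfolding shuffle_sign_def e by (simp add: power_add)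
qed

lemma wedge_alt_Nil: "wedge_alt \<alpha> \<beta> [] = \<alpha> [] * \<beta> []"
  by (simp add: wedge_alt_def shuffle_sign_def)

text \<open>
  The first argument is contracted into either factor; this antiderivation rule
  replaces the sum over shuffles in everything that follows.
\<close>

lemma wedge_alt_Cons:
  "wedge_alt \<alpha> \<beta> (v # vs) = wedge_alt (\<lambda>ws. \<alpha> (v # ws)) \<beta> vs
     + wedge_alt (\<lambda>ws. (-1) ^ length ws * \<alpha> ws) (\<lambda>ws. \<beta> (v # ws)) vs"
proof -
  let ?n = "length vs"
  have "shuffle_sign (Suc ?n) (Suc ` S) * \<alpha> (nths vs S) * \<beta> (v # nths vs (- S)) =
    shuffle_sign ?n S * ((-1) ^ length (nths vs S) * \<alpha> (nths vs S)) * \<beta> (v # nths vs (- S))"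
    if "S \<in> Pow {..<?n}" for S
  proof -
    have "{i. i < ?n \<and> i \<in> S} = S" using that by auto
    then have "length (nths vs S) = card S" by (simp add: length_nths)
    then show ?thesis using that by (simp add: shuffle_sign_out mult_ac)
  qed
  then show ?thesis
    unfolding wedge_alt_def
    by (simp only: list.size(4) add_0_right add_Suc_right One_nat_def sum_Pow_lessThan_Suc
        nths_Cons_in nths_Cons_out nths_Cons_cin nths_Cons_cout shuffle_sign_in cong: sum.cong)
qed

lemma alternating_Cons:
  assumes "alternating \<alpha>"
  shows "alternating (\<lambda>ws. \<alpha> (v # ws))"
proof -
  have "\<alpha> ((v # xs) @ u # u # zs) = 0" for xs u zs using assms unfolding alternating_def by blast
  moreover note alternating_linear[OF assms, of "v # xs" for xs]
  ultimately show ?thesis unfolding alternating_def by simp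
qed

lemma alternating_sign:
  assumes "alternating \<alpha>"
  shows "alternating (\<lambda>ws. (-1) ^ length ws * \<alpha> ws)"
  using assms unfolding alternating_def by (simp add: algebra_simps)

lemma wedge_alt_add_left: "wedge_alt (\<lambda>ws. \<alpha> ws + \<alpha>' ws) \<beta> vs = wedge_alt \<alpha> \<beta> vs + wedge_alt \<alpha>' \<beta> vs"
  unfolding wedge_alt_def by (simp add: algebra_simps sum.distrib)

lemma wedge_alt_add_right: "wedge_alt \<alpha> (\<lambda>ws. \<beta> ws + \<beta>' ws) vs = wedge_alt \<alpha> \<beta> vs + wedge_alt \<alpha> \<beta>' vs"
  unfolding wedge_alt_def by (simp add: algebra_simps sum.distrib)

lemma wedge_alt_scale_left: "wedge_alt (\<lambda>ws. c * \<alpha> ws) \<beta> vs = c * wedge_alt \<alpha> \<beta> vs"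
  unfolding wedge_alt_def by (simp add: mult_ac sum_distrib_left)

lemma wedge_alt_scale_right: "wedge_alt \<alpha> (\<lambda>ws. c * \<beta> ws) vs = c * wedge_alt \<alpha> \<beta> vs"
  unfolding wedge_alt_def by (simp add: mult_ac sum_distrib_left)

lemma wedge_alt_zero_left: "wedge_alt (\<lambda>ws. 0) \<beta> vs = 0"
  unfolding wedge_alt_def by simp

lemma wedge_alt_zero_right: "wedge_alt \<alpha> (\<lambda>ws. 0) vs = 0"
  unfolding wedge_alt_def by simp

lemmas wedge_alt_linear = wedge_alt_add_left wedge_alt_add_right wedge_alt_scale_left
  wedge_alt_scale_right wedge_alt_zero_left wedge_alt_zero_right

text \<open>
  Two equal neighbouring arguments are contracted one after the other: the terms in which both go
  to the same factor vanish, and the two mixed terms cancel.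
\<close>

lemma alternating_wedge:
  assumes "alternating \<alpha>" "alternating \<beta>"
  shows "alternating (wedge_alt \<alpha> \<beta>)"
proof -
  have "wedge_alt \<alpha> \<beta> (xs @ v # v # zs) = 0" for xs v zs
    using assms
  proof (induction xs arbitrary: \<alpha> \<beta>)
    case Nil
    have z: "\<alpha> (v # v # ws) = 0" "\<beta> (v # v # ws) = 0" for ws
      using Nil[unfolded alternating_def] by (metis append_Nil)+
    have m: "wedge_alt (\<lambda>ws. (-1) ^ length (v # ws) * \<alpha> (v # ws)) (\<lambda>ws. \<beta> (v # ws)) zs
        = - wedge_alt (\<lambda>ws. (-1) ^ length ws * \<alpha> (v # ws)) (\<lambda>ws. \<beta> (v # ws)) zs"
      using wedge_alt_scale_left[of "-1" "\<lambda>ws. (-1) ^ length ws * \<alpha> (v # ws)"] by simp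
    show ?case
      by (simp only: append_Nil wedge_alt_Cons z wedge_alt_linear mult_zero_right m)
        (simp add: wedge_alt_linear)
  next
    case (Cons x xs)
    show ?case
      by (simp add: wedge_alt_Cons Cons alternating_Cons alternating_sign)
  qed
  moreover have "wedge_alt \<alpha> \<beta> (xs @ (a *\<^sub>R v + b *\<^sub>R w) # zs) =
      fps_const a * wedge_alt \<alpha> \<beta> (xs @ v # zs) + fps_const b * wedge_alt \<alpha> \<beta> (xs @ w # zs)"
    for xs a b v w zs
    using assms
  proof (induction xs arbitrary: \<alpha> \<beta>)
    case Nil
    show ?case
      using alternating_linear[OF Nil(1), of "[]"] alternating_linear[OF Nil(2), of "[]"]
      by (simp add: wedge_alt_Cons wedge_alt_linear algebra_simps)
  next
    case (Cons x xs)
    show ?case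
      by (simp add: wedge_alt_Cons Cons alternating_Cons alternating_sign) (simp add: algebra_simps)
  qed
  ultimately show ?thesis unfolding alternating_def by blast
qed

lemma alt_form_wedge:
  assumes "alt_form k \<alpha>" "alt_form l \<beta>"
  shows "alt_form (k + l) (wedge_alt \<alpha> \<beta>)"
proof -
  have "wedge_alt \<alpha> \<beta> vs = 0" if n: "length vs \<noteq> k + l" for vs
  proof -
    have "\<alpha> (nths vs S) = 0 \<or> \<beta> (nths vs (- S)) = 0" for S
    proof -
      have "length (nths vs S) + length (nths vs (- S)) = length vs"
      proof -
        let ?A = "{i. i < length vs \<and> i \<in> S}" and ?B = "{i. i < length vs \<and> i \<in> - S}"
        have "card (?A \<union> ?B) = card ?A + card ?B" by (intro card_Un_disjoint) auto
        moreover have "?A \<union> ?B = {..<length vs}" by auto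
        ultimately show ?thesis by (simp add: length_nths)
      qed
      then have "length (nths vs S) \<noteq> k \<or> length (nths vs (- S)) \<noteq> l" using n by linarith
      then show ?thesis using alt_form_length[OF assms(1)] alt_form_length[OF assms(2)] by blast
    qed
    then show ?thesis unfolding wedge_alt_def by (intro sum.neutral) auto
  qed
  then show ?thesis using alternating_wedge assms by (auto simp: alt_form_iff)
qed

text \<open>
  Only one-element sets contribute.  The formula has the shape of the exterior derivative, which
  gives the Leibniz rule for functions in all degrees at once.
\<close>

lemma wedge_alt_one_form:
  assumes "\<And>vs. length vs \<noteq> 1 \<Longrightarrow> \<alpha> vs = 0"
  shows "wedge_alt \<alpha> \<beta> vs =
    (\<Sum>i<length vs. (-1) ^ i * \<alpha> [vs ! i] * \<beta> (take i vs @ drop (Suc i) vs))"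
proof (induction vs arbitrary: \<beta>)
  case Nil
  then show ?case using assms by (simp add: wedge_alt_Nil)
next
  case (Cons v vs)
  have s: "(\<lambda>ws. (-1) ^ length ws * \<alpha> ws) = (\<lambda>ws. (-1) * \<alpha> ws)"
  proof
    show "(-1) ^ length ws * \<alpha> ws = (-1) * \<alpha> ws" for ws
      using assms[of ws] by (cases "length ws = 1") auto
  qed
  have "wedge_alt (\<lambda>ws. \<alpha> (v # ws)) \<beta> us = \<alpha> [v] * \<beta> us" for us
  proof -
    have z: "\<alpha> (v # u # ws) = 0" for u ws using assms[of "v # u # ws"] by simp
    have "wedge_alt (\<lambda>ws. c * (if ws = [] then 1 else 0)) \<gamma> us = c * \<gamma> us" for c \<gamma>
    proof (induction us arbitrary: c \<gamma>)
      case (Cons u us)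
      have e: "(\<lambda>ws. (-1) ^ length ws * (c * (if ws = [] then 1 else 0))) =
        (\<lambda>ws. c * (if ws = [] then 1 else 0))" by auto
      show ?case by (simp only: wedge_alt_Cons e Cons) (simp add: wedge_alt_linear)
    qed (simp add: wedge_alt_Nil)
    moreover have "(\<lambda>ws. \<alpha> (v # ws)) = (\<lambda>ws. \<alpha> [v] * (if ws = [] then 1 else 0))"
      by (auto simp: fun_eq_iff neq_Nil_conv z)
    ultimately show ?thesis by simp
  qed
  then show ?case
    by (simp only: wedge_alt_Cons s wedge_alt_scale_left Cons list.size(4) add_0_right add_Suc_right
        One_nat_def sum.lessThan_Suc_shift)
      (simp add: sum_distrib_left sum_negf mult_ac)
qed

section \<open>Forms in components\<close>

text \<open>
  Forms of degree zero to three on \<open>real^3\<close> with given components.  Two-forms are parametrized by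
  vectors via \<open>(v, w) \<mapsto> a \<cdot> (v \<times> w)\<close>, three-forms by multiples of the determinant; then the
  wedge product becomes the cross product and the dot product.
\<close>

fun F0 :: "real fps \<Rightarrow> alt" where
  "F0 a [] = a" | "F0 a (v # vs) = 0"

fun F1 :: "(real fps)^3 \<Rightarrow> alt" where
  "F1 a [v] = a$1 * fps_const (v$1) + a$2 * fps_const (v$2) + a$3 * fps_const (v$3)"
| "F1 a _ = 0"

fun F2 :: "(real fps)^3 \<Rightarrow> alt" where
  "F2 a [v, w] = a$1 * fps_const (v$2 * w$3 - v$3 * w$2) + a$2 * fps_const (v$3 * w$1 - v$1 * w$3)
     + a$3 * fps_const (v$1 * w$2 - v$2 * w$1)"
| "F2 a _ = 0"

fun F3 :: "real fps \<Rightarrow> alt" where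
  "F3 a [u, v, w] = a * fps_const (u$1 * (v$2 * w$3 - v$3 * w$2) + u$2 * (v$3 * w$1 - v$1 * w$3)
     + u$3 * (v$1 * w$2 - v$2 * w$1))"
| "F3 a _ = 0"

lemma F0_if: "F0 a vs = (if vs = [] then a else 0)"
  by (cases vs) simp_all

text \<open>
  These rules push \<open>fps_const\<close> to the atoms, so that polynomial identities become identities in a
  commutative ring.
\<close>

lemmas fps_const_ring = fps_const_add[symmetric] fps_const_sub[symmetric] fps_const_mult[symmetric]
  fps_const_neg[symmetric]

lemma alt_form_F0: "alt_form 0 (F0 a)"
proof -
  have "F0 a vs = 0" if "vs \<noteq> []" for vs using that by (cases vs) auto
  then show ?thesis by (auto simp: alt_form_iff alternating_def)
qed

lemma alt_form_F1: "alt_form 1 (F1 a)"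
proof -
  have z: "F1 a vs = 0" if "length vs \<noteq> 1" for vs
    using that by (cases "(a, vs)" rule: F1.cases) auto
  have "F1 a (vs @ (s *\<^sub>R v + t *\<^sub>R w) # ws) =
      fps_const s * F1 a (vs @ v # ws) + fps_const t * F1 a (vs @ w # ws)" for vs ws s t v w
  proof (cases "vs = [] \<and> ws = []")
    case True
    then show ?thesis
      by (simp only: append_Nil F1.simps vector_add_component vector_scaleR_component real_scaleR_def fps_const_ring)
        (simp only: algebra_simps)
  next
    case False
    then have "length (vs @ u # ws) \<noteq> 1" for u :: "real^3" by auto
    then show ?thesis by (simp add: z)
  qed
  moreover have "F1 a (xs @ v # v # zs) = 0" for xs v zs by (rule z) simp
  ultimately show ?thesis using z by (auto simp: alt_form_iff alternating_def)
qed

lemma alt_form_F2: "alt_form 2 (F2 a)"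
proof -
  have z: "F2 a vs = 0" if "length vs \<noteq> 2" for vs
    using that by (cases "(a, vs)" rule: F2.cases) auto
  have "F2 a (vs @ (s *\<^sub>R v + t *\<^sub>R w) # ws) =
      fps_const s * F2 a (vs @ v # ws) + fps_const t * F2 a (vs @ w # ws)" for vs ws s t v w
  proof (cases "length vs + length ws = 1")
    case True
    then consider y where "vs = []" "ws = [y]" | y where "vs = [y]" "ws = []"
      by (auto simp: add_is_1 length_Suc_conv)
    then show ?thesis
      by cases (simp_all only: append_Nil append_Cons F2.simps vector_add_component
          vector_scaleR_component real_scaleR_def fps_const_ring, simp_all only: algebra_simps)
  next
    case False
    then have "length (vs @ u # ws) \<noteq> 2" for u :: "real^3" by auto
    then show ?thesis by (simp add: z)
  qed
  moreover have "F2 a (xs @ v # v # zs) = 0" for xs v zs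
    by (cases "length (xs @ v # v # zs) = 2") (auto simp: z)
  ultimately show ?thesis using z by (auto simp: alt_form_iff alternating_def)
qed

lemma alt_form_F3: "alt_form 3 (F3 a)"
proof -
  have z: "F3 a vs = 0" if "length vs \<noteq> 3" for vs
    using that by (cases "(a, vs)" rule: F3.cases) auto
  have "F3 a (vs @ (s *\<^sub>R v + t *\<^sub>R w) # ws) =
      fps_const s * F3 a (vs @ v # ws) + fps_const t * F3 a (vs @ w # ws)" for vs ws s t v w
  proof (cases "length vs + length ws = 2")
    case True
    then consider y x where "vs = []" "ws = [x, y]" | x y where "vs = [x]" "ws = [y]"
      | x y where "vs = [x, y]" "ws = []"
      by (cases vs rule: remdups_adj.cases; cases ws rule: remdups_adj.cases) auto
    then show ?thesis
      by cases (simp_all only: append_Nil append_Cons F3.simps vector_add_component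
          vector_scaleR_component real_scaleR_def fps_const_ring, simp_all only: algebra_simps)
  next
    case False
    then have "length (vs @ u # ws) \<noteq> 3" for u :: "real^3" by auto
    then show ?thesis by (simp add: z)
  qed
  moreover have "F3 a (xs @ v # v # zs) = 0" for xs v zs
  proof (cases "length xs + length zs = 1")
    case True
    then consider y where "xs = []" "zs = [y]" | y where "xs = [y]" "zs = []"
      by (auto simp: add_is_1 length_Suc_conv)
    then show ?thesis by cases (auto simp: algebra_simps)
  next
    case False
    then show ?thesis by (intro z) auto
  qed
  ultimately show ?thesis using z by (auto simp: alt_form_iff alternating_def)
qed

abbreviation "e1 \<equiv> axis (1::3) (1::real)"
abbreviation "e2 \<equiv> axis (2::3) (1::real)"
abbreviation "e3 \<equiv> axis (3::3) (1::real)"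

lemma axis3_simps [simp]:
  "e1 $ 1 = 1" "e1 $ 2 = 0" "e1 $ 3 = 0" "e2 $ 1 = 0" "e2 $ 2 = 1" "e2 $ 3 = 0"
  "e3 $ 1 = 0" "e3 $ 2 = 0" "e3 $ 3 = 1"
  by (simp_all add: axis_def)

text \<open>
  The order of the arguments in degree two matches the cyclic order of the cross product.
\<close>

definition comp1 :: "alt \<Rightarrow> (real fps)^3" where
  "comp1 \<alpha> = vector [\<alpha> [e1], \<alpha> [e2], \<alpha> [e3]]"

definition comp2 :: "alt \<Rightarrow> (real fps)^3" where
  "comp2 \<alpha> = vector [\<alpha> [e2, e3], \<alpha> [e3, e1], \<alpha> [e1, e2]]"

definition comp3 :: "alt \<Rightarrow> real fps" where
  "comp3 \<alpha> = \<alpha> [e1, e2, e3]"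

lemma comp1_F1 [simp]: "comp1 (F1 a) = a"
  by (simp add: comp1_def vec_eq_iff forall_3)

lemma comp3_F3 [simp]: "comp3 (F3 a) = a"
  by (simp add: comp3_def)

lemma alternating_expand:
  assumes "alternating \<alpha>"
  shows "\<alpha> (xs @ v # ys) = fps_const (v$1) * \<alpha> (xs @ e1 # ys) + fps_const (v$2) * \<alpha> (xs @ e2 # ys)
    + fps_const (v$3) * \<alpha> (xs @ e3 # ys)"
proof -
  have v: "v = (v$1) *\<^sub>R e1 + 1 *\<^sub>R ((v$2) *\<^sub>R e2 + (v$3) *\<^sub>R e3)"
    by (simp add: vec_eq_iff forall_3)
  show ?thesis
    by (subst v) (simp only: alternating_linear[OF assms] fps_const_1_eq_1 mult_1 add.assoc)
qed

lemma alt_form_0_eq: "alt_form 0 \<alpha> \<Longrightarrow> \<alpha> = F0 (\<alpha> [])"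
proof
  fix vs assume "alt_form 0 \<alpha>"
  then show "\<alpha> vs = F0 (\<alpha> []) vs" by (cases vs) (auto simp: alt_form_length)
qed

lemma alt_form_1_eq:
  assumes "alt_form 1 \<alpha>"
  shows "\<alpha> = F1 (comp1 \<alpha>)"
proof
  fix vs
  show "\<alpha> vs = F1 (comp1 \<alpha>) vs"
  proof (cases "length vs = 1")
    case True
    then obtain v where vs: "vs = [v]" by (auto simp: length_Suc_conv)
    show ?thesis
      using alternating_expand[OF alt_form_imp_alternating[OF assms], of "[]" v "[]"]
      by (simp add: vs comp1_def mult_ac)
  next
    case False
    then show ?thesis using assms alt_form_F1 by (metis alt_form_length)
  qed
qed

lemma alt_form_2_eq:
  assumes "alt_form 2 \<alpha>"
  shows "\<alpha> = F2 (comp2 \<alpha>)"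
proof
  fix vs
  have m: "alternating \<alpha>" using assms by (rule alt_form_imp_alternating)
  show "\<alpha> vs = F2 (comp2 \<alpha>) vs"
  proof (cases "length vs = 2")
    case True
    then obtain v w where vs: "vs = [v, w]" by (auto simp: length_Suc_conv numeral_2_eq_2)
    have e: "\<alpha> [e1, e1] = 0" "\<alpha> [e2, e2] = 0" "\<alpha> [e3, e3] = 0"
      by (simp_all add: alternating_not_distinct[OF m])
    have s: "\<alpha> [e2, e1] = - \<alpha> [e1, e2]" "\<alpha> [e3, e2] = - \<alpha> [e2, e3]" "\<alpha> [e1, e3] = - \<alpha> [e3, e1]"
      using alternating_swap[OF m, of "[]" e2 e1 "[]"] alternating_swap[OF m, of "[]" e3 e2 "[]"]
        alternating_swap[OF m, of "[]" e1 e3 "[]"] by (simp_all only: append_Nil)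
    have l: "\<alpha> [x, w] = fps_const (w$1) * \<alpha> [x, e1] + fps_const (w$2) * \<alpha> [x, e2]
        + fps_const (w$3) * \<alpha> [x, e3]" for x
      using alternating_expand[OF m, of "[x]" w "[]"] by simp
    have k: "\<alpha> [v, w] = fps_const (v$1) * \<alpha> [e1, w] + fps_const (v$2) * \<alpha> [e2, w]
        + fps_const (v$3) * \<alpha> [e3, w]"
      using alternating_expand[OF m, of "[]" v "[w]"] by simp
    show ?thesis
      unfolding vs k unfolding l by (simp only: e s comp2_def F2.simps vector_3 fps_const_ring) algebra
  next
    case False
    then show ?thesis using assms alt_form_F2 by (metis alt_form_length)
  qed
qed

lemma alt_form_3_eq:
  assumes "alt_form 3 \<alpha>"
  shows "\<alpha> = F3 (comp3 \<alpha>)"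
proof
  fix vs
  have m: "alternating \<alpha>" using assms by (rule alt_form_imp_alternating)
  show "\<alpha> vs = F3 (comp3 \<alpha>) vs"
  proof (cases "length vs = 3")
    case True
    then obtain u v w where vs: "vs = [u, v, w]" by (auto simp: length_Suc_conv numeral_3_eq_3)
    have z: "\<alpha> [x, x, y] = 0" "\<alpha> [x, y, x] = 0" "\<alpha> [y, x, x] = 0" for x y
      by (simp_all add: alternating_not_distinct[OF m])
    have s: "\<alpha> [x, y, z] = - \<alpha> [y, x, z]" "\<alpha> [x, y, z] = - \<alpha> [x, z, y]" for x y z
      using alternating_swap[OF m, of "[]" x y "[z]"] alternating_swap[OF m, of "[x]" y z "[]"] by simp_all
    have p: "\<alpha> [e2, e1, e3] = - comp3 \<alpha>" "\<alpha> [e1, e3, e2] = - comp3 \<alpha>" "\<alpha> [e3, e1, e2] = comp3 \<alpha>"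
      "\<alpha> [e2, e3, e1] = comp3 \<alpha>" "\<alpha> [e3, e2, e1] = - comp3 \<alpha>" "\<alpha> [e1, e2, e3] = comp3 \<alpha>"
      unfolding comp3_def using s by metis+
    have l: "\<alpha> [x, v, w] = fps_const (v$1) * \<alpha> [x, e1, w] + fps_const (v$2) * \<alpha> [x, e2, w]
        + fps_const (v$3) * \<alpha> [x, e3, w]" for x
      using alternating_expand[OF m, of "[x]" v "[w]"] by simp
    have k: "\<alpha> [x, y, w] = fps_const (w$1) * \<alpha> [x, y, e1] + fps_const (w$2) * \<alpha> [x, y, e2]
        + fps_const (w$3) * \<alpha> [x, y, e3]" for x y
      using alternating_expand[OF m, of "[x, y]" w "[]"] by simp
    have j: "\<alpha> [u, v, w] = fps_const (u$1) * \<alpha> [e1, v, w] + fps_const (u$2) * \<alpha> [e2, v, w]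
        + fps_const (u$3) * \<alpha> [e3, v, w]"
      using alternating_expand[OF m, of "[]" u "[v, w]"] by simp
    show ?thesis
      unfolding vs j unfolding l unfolding k
      by (simp only: z p F3.simps fps_const_ring) algebra
  next
    case False
    then show ?thesis using assms alt_form_F3 by (metis alt_form_length)
  qed
qed

subsection \<open>The wedge product in components\<close>

definition crossv :: "(real fps)^3 \<Rightarrow> (real fps)^3 \<Rightarrow> (real fps)^3" where
  "crossv a b = vector [a$2 * b$3 - a$3 * b$2, a$3 * b$1 - a$1 * b$3, a$1 * b$2 - a$2 * b$1]"

definition dotv :: "(real fps)^3 \<Rightarrow> (real fps)^3 \<Rightarrow> real fps" where
  "dotv a b = a$1 * b$1 + a$2 * b$2 + a$3 * b$3"

lemma alt_form_wedge': "alt_form k \<alpha> \<Longrightarrow> alt_form l \<beta> \<Longrightarrow> k + l = n \<Longrightarrow> alt_form n (wedge_alt \<alpha> \<beta>)"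
  using alt_form_wedge by blast

lemma wedge_alt_0:
  assumes "alt_form 0 \<alpha>"
  shows "wedge_alt \<alpha> \<beta> vs = \<alpha> [] * \<beta> vs"
proof -
  have z: "\<alpha> (u # ws) = 0" for u ws using assms by (simp add: alt_form_length)
  have e: "(\<lambda>ws. (-1) ^ length ws * \<alpha> ws) = \<alpha>"
  proof
    show "(-1) ^ length ws * \<alpha> ws = \<alpha> ws" for ws by (cases ws) (simp_all add: z)
  qed
  show ?thesis
    by (induction vs arbitrary: \<beta>) (simp_all only: wedge_alt_Nil wedge_alt_Cons z e wedge_alt_linear add_0_left)
qed

lemma wedge_alt_0_right:
  assumes "alt_form 0 \<beta>"
  shows "wedge_alt \<alpha> \<beta> vs = \<alpha> vs * \<beta> []"
proof -
  have z: "\<beta> (u # ws) = 0" for u ws using assms by (simp add: alt_form_length)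
  show ?thesis
    by (induction vs arbitrary: \<alpha>) (simp_all add: wedge_alt_Nil wedge_alt_Cons z wedge_alt_linear)
qed

lemma wedge_F0_left: "wedge_alt (F0 a) \<beta> = (\<lambda>vs. a * \<beta> vs)"
  using wedge_alt_0[OF alt_form_F0] by (simp add: fun_eq_iff)

lemma wedge_F0_right: "wedge_alt \<alpha> (F0 a) = (\<lambda>vs. a * \<alpha> vs)"
  using wedge_alt_0_right[OF alt_form_F0] by (simp add: fun_eq_iff mult_ac)

lemma wedge_F1: "wedge_alt (F1 a) \<beta> vs =
    (\<Sum>i<length vs. (-1) ^ i * F1 a [vs ! i] * \<beta> (take i vs @ drop (Suc i) vs))"
  by (rule wedge_alt_one_form) (rule alt_form_length[OF alt_form_F1])

lemma fps_const_minus_one: "fps_const (- 1 :: real) = - 1"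
  by (simp add: fps_const_neg[symmetric] del: fps_const_neg)

lemma wedge_F1_F1: "wedge_alt (F1 a) (F1 b) = F2 (crossv a b)"
proof -
  have "comp2 (wedge_alt (F1 a) (F1 b)) = crossv a b"
    by (simp add: comp2_def wedge_F1 crossv_def vec_eq_iff forall_3 algebra_simps)
  moreover have "alt_form 2 (wedge_alt (F1 a) (F1 b))"
    by (rule alt_form_wedge'[OF alt_form_F1 alt_form_F1]) simp
  ultimately show ?thesis using alt_form_2_eq by metis
qed

lemma wedge_F1_F2: "wedge_alt (F1 a) (F2 b) = F3 (dotv a b)"
proof -
  have "comp3 (wedge_alt (F1 a) (F2 b)) = dotv a b"
    by (simp add: comp3_def wedge_F1 dotv_def numeral_3_eq_3 fps_const_minus_one)
  moreover have "alt_form 3 (wedge_alt (F1 a) (F2 b))"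
    by (rule alt_form_wedge'[OF alt_form_F1 alt_form_F2]) simp
  ultimately show ?thesis using alt_form_3_eq by metis
qed

lemma wedge_F2_F1: "wedge_alt (F2 b) (F1 a) = F3 (dotv a b)"
proof -
  have "comp3 (wedge_alt (F2 b) (F1 a)) = dotv a b"
    by (simp add: comp3_def wedge_alt_Cons wedge_alt_Nil dotv_def fps_const_minus_one)
  moreover have "alt_form 3 (wedge_alt (F2 b) (F1 a))"
    by (rule alt_form_wedge'[OF alt_form_F2 alt_form_F1]) simp
  ultimately show ?thesis using alt_form_3_eq by metis
qed

section \<open>Inner products and the Hodge star at a point\<close>

type_synonym ip = "real^3 \<Rightarrow> real^3 \<Rightarrow> real"

definition inner_product :: "ip \<Rightarrow> bool" where
  "inner_product g \<longleftrightarrow> bilinear g \<and> (\<forall>v w. g v w = g w v) \<and> (\<forall>v. v \<noteq> 0 \<longrightarrow> g v v > 0)"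

definition gram :: "ip \<Rightarrow> real^3^3" where
  "gram g = (\<chi> i j. g (axis i 1) (axis j 1))"

text \<open>
  The matrix whose transpose is the adjugate.
\<close>

definition cofactors :: "real^3^3 \<Rightarrow> real^3^3" where
  "cofactors A = vector
    [vector [A$2$2*A$3$3 - A$2$3*A$3$2, A$2$3*A$3$1 - A$2$1*A$3$3, A$2$1*A$3$2 - A$2$2*A$3$1],
     vector [A$3$2*A$1$3 - A$3$3*A$1$2, A$3$3*A$1$1 - A$3$1*A$1$3, A$3$1*A$1$2 - A$3$2*A$1$1],
     vector [A$1$2*A$2$3 - A$1$3*A$2$2, A$1$3*A$2$1 - A$1$1*A$2$3, A$1$1*A$2$2 - A$1$2*A$2$1]]"

text \<open>
  The inverse of the Gram matrix, by Cramer's rule: the Gram matrix of the dual basis.  The explicit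
  formula shows that it depends smoothly on the metric.
\<close>

definition dual_gram :: "ip \<Rightarrow> real^3^3" where
  "dual_gram g = (1 / det (gram g)) *\<^sub>R cofactors (gram g)"

definition vol :: "ip \<Rightarrow> real" where
  "vol g = sqrt (det (gram g))"

lemma ip_sum:
  assumes "inner_product g"
  shows "g v w = (\<Sum>i\<in>UNIV. \<Sum>j\<in>UNIV. v$i * w$j * gram g $ i $ j)"
proof -
  have b: "bilinear g" using assms unfolding inner_product_def by blast
  have v: "v = (\<Sum>i\<in>UNIV. v$i *\<^sub>R axis i 1)" for v :: "real^3"
    by (simp add: vec_eq_iff forall_3 sum_3)
  have "g v w = g (\<Sum>i\<in>UNIV. v$i *\<^sub>R axis i 1) (\<Sum>j\<in>UNIV. w$j *\<^sub>R axis j 1)"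
    using v[of v] v[of w] by simp
  also have "\<dots> = (\<Sum>(i, j)\<in>UNIV \<times> UNIV. g (v$i *\<^sub>R axis i 1) (w$j *\<^sub>R axis j 1))"
    by (rule bilinear_sum[OF b])
  also have "\<dots> = (\<Sum>i\<in>UNIV. \<Sum>j\<in>UNIV. v$i * w$j * gram g $ i $ j)"
    unfolding sum.cartesian_product[symmetric] gram_def
    by (simp add: bilinear_lmul[OF b] bilinear_rmul[OF b] mult_ac)
  finally show ?thesis .
qed

lemma ip_add: "inner_product g \<Longrightarrow> g (u + v) w = g u w + g v w" "inner_product g \<Longrightarrow> g w (u + v) = g w u + g w v"
  unfolding inner_product_def by (simp_all add: bilinear_ladd bilinear_radd)

lemma ip_diff: "inner_product g \<Longrightarrow> g (u - v) w = g u w - g v w" "inner_product g \<Longrightarrow> g w (u - v) = g w u - g w v"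
  unfolding inner_product_def by (simp_all add: bilinear_lsub bilinear_rsub)

lemma ip_scale: "inner_product g \<Longrightarrow> g (c *\<^sub>R v) w = c * g v w" "inner_product g \<Longrightarrow> g w (c *\<^sub>R v) = c * g w v"
  unfolding inner_product_def by (simp_all add: bilinear_lmul bilinear_rmul)

lemma ip_sym: "inner_product g \<Longrightarrow> g v w = g w v"
  unfolding inner_product_def by blast

lemma gram_sym:
  assumes "inner_product g"
  shows "gram g $ i $ j = gram g $ j $ i"
  using ip_sym[OF assms] by (simp add: gram_def)

text \<open>
  Gram-Schmidt on the standard basis.  Since the process is triangular, a coordinate of each
  new vector is 1 before normalization, so that it does not vanish.
\<close>

lemma onb_exists:
  assumes g: "inner_product g"
  shows "\<exists>es. onb g es"
proof -
  have pos: "v \<noteq> 0 \<Longrightarrow> g v v > 0" for v using g unfolding inner_product_def by blast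
  define n where "n v = (1 / sqrt (g v v)) *\<^sub>R v" for v
  have nn: "g (n v) (n v) = 1" if "v \<noteq> 0" for v
    using pos[OF that] by (simp add: n_def ip_scale[OF g])
  define a where "a = n e1"
  define v2 where "v2 = e2 - g e2 a *\<^sub>R a"
  define b where "b = n v2"
  define v3 where "v3 = e3 - g e3 a *\<^sub>R a - g e3 b *\<^sub>R b"
  define c where "c = n v3"
  have a0: "a $ 2 = 0" "a $ 3 = 0" by (simp_all add: a_def n_def)
  have "v2 $ 2 = 1" using a0 by (simp add: v2_def)
  then have v2: "v2 \<noteq> 0" by auto
  have b0: "b $ 3 = 0" using a0 by (simp add: b_def n_def v2_def)
  have "v3 $ 3 = 1" using a0 b0 by (simp add: v3_def)
  then have v3: "v3 \<noteq> 0" by auto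
  have "e1 \<noteq> 0" by (simp add: vec_eq_iff forall_3)
  then have aa: "g a a = 1" unfolding a_def by (rule nn)
  have bb: "g b b = 1" unfolding b_def using v2 by (rule nn)
  have cc: "g c c = 1" unfolding c_def using v3 by (rule nn)
  have "g v2 a = 0" using aa by (simp add: v2_def ip_diff[OF g] ip_scale[OF g])
  then have ba: "g b a = 0" by (simp add: b_def n_def ip_scale[OF g])
  then have ab: "g a b = 0" using ip_sym[OF g] by metis
  have "g v3 a = 0" "g v3 b = 0"
    using aa bb ab ba by (simp_all add: v3_def ip_diff[OF g] ip_scale[OF g])
  then have ca: "g c a = 0" "g c b = 0" by (simp_all add: c_def n_def ip_scale[OF g])
  then have ac: "g a c = 0" "g b c = 0" using ip_sym[OF g] by metis+
  have "onb g [a, b, c]"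
    unfolding onb_def using aa bb cc ab ba ca ac
    by (auto simp: less_Suc_eq numeral_3_eq_3)
  then show ?thesis by blast
qed

lemma det_cofactors: "A ** transpose (cofactors A) = det A *\<^sub>R mat 1"
  by (simp add: vec_eq_iff forall_3 matrix_matrix_mult_def sum_3 cofactors_def transpose_def mat_def
      det_3 algebra_simps)

lemma gram_dual_gram_aux:
  assumes g: "inner_product g" and pos: "det (gram g) > 0"
  shows "gram g ** dual_gram g = mat 1"
proof -
  have sym: "transpose (cofactors (gram g)) = cofactors (gram g)"
    using gram_sym[OF g, of 1 2] gram_sym[OF g, of 1 3] gram_sym[OF g, of 2 3]
    by (simp add: vec_eq_iff forall_3 transpose_def cofactors_def mult_ac)
  have "gram g ** dual_gram g = (1 / det (gram g)) *\<^sub>R (gram g ** transpose (cofactors (gram g)))"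
    by (simp add: dual_gram_def sym matrix_scalar_ac scalar_matrix_assoc)
  then show ?thesis using pos by (simp add: det_cofactors)
qed

text \<open>
  If the rows of \<open>E\<close> are orthonormal, then \<open>E G E\<^sup>T = 1\<close> for the Gram matrix \<open>G\<close>, hence \<open>E\<^sup>T E = G\<^sup>-\<^sup>1\<close>
  does not depend on the basis.
\<close>

lemma onb_facts:
  assumes g: "inner_product g" and es: "onb g [a, b, c]"
  shows "det (gram g) > 0"
    and "dual_gram g $ i $ j = a$i * a$j + b$i * b$j + c$i * c$j"
    and "det (vector [a, b, c] :: real^3^3) * det (vector [a, b, c] :: real^3^3) = det (dual_gram g)"
proof -
  define E :: "real^3^3" where "E = vector [a, b, c]"
  have o: "g a a = 1" "g b b = 1" "g c c = 1" "g a b = 0" "g b a = 0" "g a c = 0" "g c a = 0"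
    "g b c = 0" "g c b = 0"
    using es unfolding onb_def by (auto simp: numeral_3_eq_3 less_Suc_eq)
  have ent: "(E ** gram g ** transpose E) $ i $ j = g (E $ i) (E $ j)" for i j
    unfolding ip_sum[OF g, of "E $ i" "E $ j"]
    by (simp add: matrix_matrix_mult_def transpose_def sum_3 algebra_simps)
  have 1: "E ** gram g ** transpose E = mat 1"
    by (simp add: vec_eq_iff forall_3 ent mat_def) (simp add: E_def o)
  then have "det E * det (gram g) * det E = 1"
    by (metis det_I det_mul det_transpose)
  then have "(det E)\<^sup>2 * det (gram g) = 1" by (simp add: power2_eq_square mult_ac)
  then show pos: "det (gram g) > 0"
    by (metis not_less zero_le_power2 zero_less_one mult_nonneg_nonpos)
  have "gram g ** dual_gram g = mat 1" using g pos by (rule gram_dual_gram_aux)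
  moreover have "transpose E ** E ** gram g = mat 1"
    using 1 by (metis matrix_left_right_inverse matrix_mul_assoc)
  ultimately have EE: "transpose E ** E = dual_gram g"
    by (metis matrix_mul_assoc matrix_mul_lid matrix_mul_rid)
  then show "det (vector [a, b, c] :: real^3^3) * det (vector [a, b, c] :: real^3^3) = det (dual_gram g)"
    unfolding E_def by (metis det_mul det_transpose)
  from EE have "dual_gram g $ i $ j = (transpose E ** E) $ i $ j" by simp
  then show "dual_gram g $ i $ j = a$i * a$j + b$i * b$j + c$i * c$j"
    by (simp add: matrix_matrix_mult_def transpose_def sum_3 E_def)
qed

lemma onb_cases:
  assumes "onb g es"
  obtains a b c where "es = [a, b, c]"
  using assms unfolding onb_def by (auto simp: numeral_3_eq_3 length_Suc_conv)

lemma det_gram_pos: "inner_product g \<Longrightarrow> det (gram g) > 0"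
  using onb_exists onb_cases onb_facts(1) by metis

lemma vol_square: "inner_product g \<Longrightarrow> vol g * vol g = det (gram g)"
  using det_gram_pos[of g] by (simp add: vol_def)

lemma gram_dual_gram:
  assumes g: "inner_product g"
  shows "gram g ** dual_gram g = mat 1" "dual_gram g ** gram g = mat 1"
  using gram_dual_gram_aux[OF g det_gram_pos[OF g]] by (simp_all add: matrix_left_right_inverse)

lemma dual_gram_sym: "inner_product g \<Longrightarrow> dual_gram g $ i $ j = dual_gram g $ j $ i"
  using onb_exists onb_cases onb_facts(2) by (metis mult.commute)

lemma det_dual_gram: "inner_product g \<Longrightarrow> det (dual_gram g) = 1 / det (gram g)"
  using gram_dual_gram[of g] det_gram_pos[of g] by (metis det_I det_mul nonzero_eq_divide_eq less_irrefl)

subsection \<open>The induced inner product of forms\<close>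

lemma sum_nths_3:
  "(\<Sum>I\<in>Pow {..<3}. h (nths [a, b, c] I)) =
    h [a, b, c] + h [a, b] + h [a, c] + h [a] + h [b, c] + h [b] + h [c] + (h [] :: 'a::comm_monoid_add)"
  by (simp only: numeral_3_eq_3 sum_Pow_lessThan_Suc nths_Cons_in nths_Cons_out) (simp add: add_ac)

definition mat_act :: "real^3^3 \<Rightarrow> (real fps)^3 \<Rightarrow> (real fps)^3" where
  "mat_act A a = (\<chi> i. fps_const (A$i$1) * a$1 + fps_const (A$i$2) * a$2 + fps_const (A$i$3) * a$3)"

lemma F1_gram_sum:
  assumes "\<And>i j. S$i$j = p$i * p$j + q$i * q$j + r$i * r$j"
  shows "F1 x [p] * F1 y [p] + F1 x [q] * F1 y [q] + F1 x [r] * F1 y [r] = dotv x (mat_act S y)"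
  unfolding dotv_def mat_act_def
  by (simp only: F1.simps vec_lambda_beta assms fps_const_ring) algebra

lemma F2_eq_F1_cross: "F2 a [v, w] = F1 a [cross3 v w]"
  by (simp add: cross3_def)

lemma F3_det: "F3 a [u, v, w] = a * fps_const (det (vector [u, v, w] :: real^3^3))"
proof -
  have "u$1 * (v$2 * w$3 - v$3 * w$2) + u$2 * (v$3 * w$1 - v$1 * w$3) + u$3 * (v$1 * w$2 - v$2 * w$1)
    = det (vector [u, v, w] :: real^3^3)"
    by (simp add: det_3 algebra_simps)
  then show ?thesis by simp
qed

text \<open>
  The sums depend on the basis only through \<open>\<Sum>\<^sub>k e\<^sub>k e\<^sub>k\<^sup>T = G\<^sup>-\<^sup>1\<close>; in degree two the cross products of
  the basis vectors contribute its cofactors (Cauchy-Binet), in degree three its determinant.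
\<close>

lemma inner_onb:
  assumes g: "inner_product g" and es: "onb g es"
  shows "(\<Sum>I\<in>Pow {..<3}. F0 x (nths es I) * F0 y (nths es I)) = x * y"
    and "(\<Sum>I\<in>Pow {..<3}. F1 a (nths es I) * F1 b (nths es I)) = dotv a (mat_act (dual_gram g) b)"
    and "(\<Sum>I\<in>Pow {..<3}. F2 a (nths es I) * F2 b (nths es I)) = dotv a (mat_act (cofactors (dual_gram g)) b)"
    and "(\<Sum>I\<in>Pow {..<3}. F3 x (nths es I) * F3 y (nths es I)) = fps_const (det (dual_gram g)) * x * y"
proof -
  obtain p q r where es3: "es = [p, q, r]" using es by (rule onb_cases)
  note f = onb_facts(2,3)[OF g es[unfolded es3]]
  show "(\<Sum>I\<in>Pow {..<3}. F0 x (nths es I) * F0 y (nths es I)) = x * y"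
    unfolding es3 using sum_nths_3[of "\<lambda>l. F0 x l * F0 y l" p q r] by simp
  have "(\<Sum>I\<in>Pow {..<3}. F1 a (nths es I) * F1 b (nths es I)) =
      F1 a [p] * F1 b [p] + F1 a [q] * F1 b [q] + F1 a [r] * F1 b [r]"
    unfolding es3 using sum_nths_3[of "\<lambda>l. F1 a l * F1 b l" p q r] by simp
  also have "\<dots> = dotv a (mat_act (dual_gram g) b)" by (rule F1_gram_sum) (rule f)
  finally show "(\<Sum>I\<in>Pow {..<3}. F1 a (nths es I) * F1 b (nths es I)) = dotv a (mat_act (dual_gram g) b)" .
  have "(\<Sum>I\<in>Pow {..<3}. F2 a (nths es I) * F2 b (nths es I)) =
      F2 a [p, q] * F2 b [p, q] + F2 a [p, r] * F2 b [p, r] + F2 a [q, r] * F2 b [q, r]"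
    unfolding es3 using sum_nths_3[of "\<lambda>l. F2 a l * F2 b l" p q r] by simp
  also have "\<dots> = dotv a (mat_act (cofactors (dual_gram g)) b)" unfolding F2_eq_F1_cross
  proof (rule F1_gram_sum)
    fix i j :: 3
    have "\<forall>i j. cofactors (dual_gram g) $ i $ j = cross3 p q $ i * cross3 p q $ j
        + cross3 p r $ i * cross3 p r $ j + cross3 q r $ i * cross3 q r $ j"
      by (simp add: forall_3 cofactors_def f(1) cross3_def) (simp add: algebra_simps)
    then show "cofactors (dual_gram g) $ i $ j = cross3 p q $ i * cross3 p q $ j
        + cross3 p r $ i * cross3 p r $ j + cross3 q r $ i * cross3 q r $ j" by blast
  qed
  finally show "(\<Sum>I\<in>Pow {..<3}. F2 a (nths es I) * F2 b (nths es I)) = dotv a (mat_act (cofactors (dual_gram g)) b)" .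
  have "(\<Sum>I\<in>Pow {..<3}. F3 x (nths es I) * F3 y (nths es I)) = F3 x [p, q, r] * F3 y [p, q, r]"
    unfolding es3 using sum_nths_3[of "\<lambda>l. F3 x l * F3 y l" p q r] by simp
  also have "\<dots> = fps_const (det (dual_gram g)) * x * y"
    unfolding F3_det f(2)[symmetric] fps_const_mult[symmetric] by (simp only: mult_ac)
  finally show "(\<Sum>I\<in>Pow {..<3}. F3 x (nths es I) * F3 y (nths es I)) = fps_const (det (dual_gram g)) * x * y" .
qed

lemma alt_form_le_3_cases:
  assumes "alt_form k \<alpha>" "k \<le> 3"
  obtains x where "k = 0" "\<alpha> = F0 x" | a where "k = 1" "\<alpha> = F1 a"
    | a where "k = 2" "\<alpha> = F2 a" | x where "k = 3" "\<alpha> = F3 x"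
proof -
  consider "k = 0" | "k = 1" | "k = 2" | "k = 3" using assms(2) by linarith
  then show ?thesis
    using assms(1) alt_form_0_eq alt_form_1_eq alt_form_2_eq alt_form_3_eq that
    by cases blast+
qed

text \<open>
  This removes the choice of an orthonormal basis from the inner product.
\<close>

lemma inner_alt_onb:
  assumes g: "inner_product g" and k: "k \<le> 3" and \<alpha>: "alt_form k \<alpha>" and \<beta>: "alt_form k \<beta>"
    and es: "onb g es"
  shows "inner_alt g \<alpha> \<beta> = (\<Sum>I\<in>Pow {..<3}. \<alpha> (nths es I) * \<beta> (nths es I))"
proof -
  have o: "onb g (SOME es. onb g es)" using es by (rule someI)
  have "inner_alt g \<alpha> \<beta> = (\<Sum>I\<in>Pow {..<3}. \<alpha> (nths (SOME es. onb g es) I) * \<beta> (nths (SOME es. onb g es) I))"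
    by (simp add: inner_alt_def Let_def)
  also have "\<dots> = (\<Sum>I\<in>Pow {..<3}. \<alpha> (nths es I) * \<beta> (nths es I))"
  proof (rule alt_form_le_3_cases[OF \<alpha> k])
    fix x assume k: "k = 0" "\<alpha> = F0 x"
    obtain y where "\<beta> = F0 y" using alt_form_0_eq \<beta> k(1) by blast
    then show ?thesis using inner_onb(1)[OF g o] inner_onb(1)[OF g es] k by simp
  next
    fix x assume k: "k = 1" "\<alpha> = F1 x"
    obtain y where "\<beta> = F1 y" using alt_form_1_eq \<beta> k(1) by blast
    then show ?thesis using inner_onb(2)[OF g o] inner_onb(2)[OF g es] k by simp
  next
    fix x assume k: "k = 2" "\<alpha> = F2 x"
    obtain y where "\<beta> = F2 y" using alt_form_2_eq \<beta> k(1) by blast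
    then show ?thesis using inner_onb(3)[OF g o] inner_onb(3)[OF g es] k by simp
  next
    fix x assume k: "k = 3" "\<alpha> = F3 x"
    obtain y where "\<beta> = F3 y" using alt_form_3_eq \<beta> k(1) by blast
    then show ?thesis using inner_onb(4)[OF g o] inner_onb(4)[OF g es] k by simp
  qed
  finally show ?thesis .
qed

lemma inner_alt_F:
  assumes g: "inner_product g"
  shows "inner_alt g (F0 x) (F0 y) = x * y"
    and "inner_alt g (F1 a) (F1 b) = dotv a (mat_act (dual_gram g) b)"
    and "inner_alt g (F2 a) (F2 b) = dotv a (mat_act (cofactors (dual_gram g)) b)"
    and "inner_alt g (F3 x) (F3 y) = fps_const (det (dual_gram g)) * x * y"
proof -
  obtain es where es: "onb g es" using onb_exists[OF g] by blast
  show "inner_alt g (F0 x) (F0 y) = x * y"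
    using inner_alt_onb[OF g _ alt_form_F0 alt_form_F0 es] inner_onb(1)[OF g es] by simp
  show "inner_alt g (F1 a) (F1 b) = dotv a (mat_act (dual_gram g) b)"
    using inner_alt_onb[OF g _ alt_form_F1 alt_form_F1 es] inner_onb(2)[OF g es] by simp
  show "inner_alt g (F2 a) (F2 b) = dotv a (mat_act (cofactors (dual_gram g)) b)"
    using inner_alt_onb[OF g _ alt_form_F2 alt_form_F2 es] inner_onb(3)[OF g es] by simp
  show "inner_alt g (F3 x) (F3 y) = fps_const (det (dual_gram g)) * x * y"
    using inner_alt_onb[OF g _ alt_form_F3 alt_form_F3 es] inner_onb(4)[OF g es] by simp
qed

lemma F3_Nil: "length vs \<noteq> 3 \<Longrightarrow> F3 a vs = 0"
  by (rule alt_form_length[OF alt_form_F3])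

lemma vol_alt_F3: "vol_alt g = F3 (fps_const (vol g))"
proof
  fix vs
  show "vol_alt g vs = F3 (fps_const (vol g)) vs"
  proof (cases "length vs = 3")
    case True
    then obtain u v w where "vs = [u, v, w]" by (auto simp: length_Suc_conv numeral_3_eq_3)
    then show ?thesis unfolding F3_det by (simp add: vol_alt_def F3_det vol_def gram_def del: F3.simps)
  qed (simp add: vol_alt_def F3_Nil)
qed

subsection \<open>The Hodge star\<close>

definition is_hodge :: "ip \<Rightarrow> nat \<Rightarrow> alt \<Rightarrow> alt \<Rightarrow> bool" where
  "is_hodge g k \<beta> \<gamma> \<longleftrightarrow> alt_form (3 - k) \<gamma> \<and>
     (\<forall>\<alpha>. alt_form k \<alpha> \<longrightarrow> wedge_alt \<alpha> \<gamma> = (\<lambda>vs. inner_alt g \<alpha> \<beta> * vol_alt g vs))"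

lemma F3_scale: "F3 (c * x) = (\<lambda>vs. c * F3 x vs)"
proof
  show "F3 (c * x) vs = c * F3 x vs" for vs
    by (cases "(x, vs)" rule: F3.cases) (auto simp: mult_ac)
qed

lemma F3_inject: "F3 x = F3 y \<longleftrightarrow> x = y"
  by (metis comp3_F3)

lemma dotv_axis: "dotv (axis i 1) a = a $ i"
proof -
  have "\<forall>i. dotv (axis i 1) a = a $ i" by (simp add: forall_3 dotv_def axis_def)
  then show ?thesis by blast
qed

text \<open>
  Wedging with the coordinate forms of complementary degree returns the components.
\<close>

lemma wedge_nondegenerate:
  assumes k: "k \<le> 3" and \<gamma>: "alt_form (3 - k) \<gamma>" "alt_form (3 - k) \<gamma>'"
    and eq: "\<And>\<alpha>. alt_form k \<alpha> \<Longrightarrow> wedge_alt \<alpha> \<gamma> = wedge_alt \<alpha> \<gamma>'"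
  shows "\<gamma> = \<gamma>'"
proof -
  consider "k = 0" | "k = 1" | "k = 2" | "k = 3" using k by linarith
  then show ?thesis
  proof cases
    case 1
    then show ?thesis using eq[of "F0 1"] alt_form_F0 by (simp add: wedge_F0_left)
  next
    case 2
    then obtain a b where ab: "\<gamma> = F2 a" "\<gamma>' = F2 b" using \<gamma> alt_form_2_eq by fastforce
    have "a $ i = b $ i" for i
      using eq[of "F1 (axis i 1)"] alt_form_F1 2 unfolding ab wedge_F1_F2 F3_inject dotv_axis by blast
    then have "a = b" by (simp add: vec_eq_iff)
    then show ?thesis unfolding ab by simp
  next
    case 3
    then obtain a b where ab: "\<gamma> = F1 a" "\<gamma>' = F1 b" using \<gamma> alt_form_1_eq by fastforce
    have "dotv a (axis i 1) = dotv b (axis i 1)" for i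
      using eq[of "F2 (axis i 1)"] alt_form_F2 3 unfolding ab wedge_F2_F1 F3_inject by blast
    then have "a $ i = b $ i" for i using dotv_axis unfolding dotv_def by (metis mult.commute)
    then have "a = b" by (simp add: vec_eq_iff)
    then show ?thesis unfolding ab by simp
  next
    case 4
    then obtain a b where ab: "\<gamma> = F0 a" "\<gamma>' = F0 b" using \<gamma> alt_form_0_eq by fastforce
    have "F3 (a * 1) = F3 (b * 1)"
      using eq[of "F3 1"] alt_form_F3 4 unfolding ab wedge_F0_right F3_scale by blast
    then show ?thesis unfolding ab F3_inject by simp
  qed
qed

lemma hodge_alt_eqI:
  assumes "k \<le> 3" "is_hodge g k \<beta> \<gamma>"
  shows "hodge_alt g k \<beta> = \<gamma>"
  unfolding hodge_alt_def
proof (rule the_equality)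
  show "alt_form (3 - k) \<gamma> \<and> (\<forall>\<alpha>. alt_form k \<alpha> \<longrightarrow> wedge_alt \<alpha> \<gamma> = (\<lambda>vs. inner_alt g \<alpha> \<beta> * vol_alt g vs))"
    using assms(2) unfolding is_hodge_def .
next
  fix \<gamma>'
  assume a: "alt_form (3 - k) \<gamma>' \<and> (\<forall>\<alpha>. alt_form k \<alpha> \<longrightarrow> wedge_alt \<alpha> \<gamma>' = (\<lambda>vs. inner_alt g \<alpha> \<beta> * vol_alt g vs))"
  show "\<gamma>' = \<gamma>"
  proof (rule wedge_nondegenerate[OF assms(1)])
    show "alt_form (3 - k) \<gamma>'" using a by blast
    show "alt_form (3 - k) \<gamma>" using assms(2) unfolding is_hodge_def by blast
    show "wedge_alt \<alpha> \<gamma>' = wedge_alt \<alpha> \<gamma>" if "alt_form k \<alpha>" for \<alpha>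
      using a assms(2) that unfolding is_hodge_def by simp
  qed
qed

lemma dotv_mat_act_scale: "dotv a (mat_act (c *\<^sub>R A) b) = dotv a (mat_act A b) * fps_const c"
  unfolding dotv_def mat_act_def
  by (simp only: vec_lambda_beta vector_scaleR_component real_scaleR_def fps_const_ring) algebra

text \<open>
  With \<open>\<langle>\<alpha>, \<beta>\<rangle> = \<alpha>\<^sup>T A \<beta>\<close> in components, \<open>\<alpha> \<wedge> \<gamma>\<close> is the dot product of the components,
  so that \<open>\<gamma>\<close> must have components \<open>vol g \<cdot> A \<beta>\<close>.
\<close>

lemma is_hodge_F:
  assumes g: "inner_product g"
  shows "is_hodge g 0 (F0 x) (F3 (fps_const (vol g) * x))"
    and "is_hodge g 1 (F1 a) (F2 (mat_act (vol g *\<^sub>R dual_gram g) a))"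
    and "is_hodge g 2 (F2 a) (F1 (mat_act (vol g *\<^sub>R cofactors (dual_gram g)) a))"
    and "is_hodge g 3 (F3 x) (F0 (fps_const (vol g * det (dual_gram g)) * x))"
proof -
  have F: "(\<lambda>vs. c * vol_alt g vs) = F3 (c * fps_const (vol g))" for c
    unfolding vol_alt_F3 F3_scale ..
  show "is_hodge g 0 (F0 x) (F3 (fps_const (vol g) * x))"
    unfolding is_hodge_def F
  proof (intro conjI allI impI)
    fix \<alpha> assume "alt_form 0 \<alpha>"
    then obtain y where y: "\<alpha> = F0 y" using alt_form_0_eq by blast
    show "wedge_alt \<alpha> (F3 (fps_const (vol g) * x)) = F3 (inner_alt g \<alpha> (F0 x) * fps_const (vol g))"
      unfolding y wedge_F0_left inner_alt_F[OF g] F3_scale[symmetric] by (simp add: mult_ac)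
  qed (simp add: alt_form_F3)
  show "is_hodge g 1 (F1 a) (F2 (mat_act (vol g *\<^sub>R dual_gram g) a))"
    unfolding is_hodge_def F
  proof (intro conjI allI impI)
    fix \<alpha> assume "alt_form 1 \<alpha>"
    then obtain y where y: "\<alpha> = F1 y" using alt_form_1_eq by blast
    show "wedge_alt \<alpha> (F2 (mat_act (vol g *\<^sub>R dual_gram g) a)) = F3 (inner_alt g \<alpha> (F1 a) * fps_const (vol g))"
      unfolding y wedge_F1_F2 inner_alt_F[OF g] dotv_mat_act_scale ..
  qed (simp add: alt_form_F2)
  show "is_hodge g 2 (F2 a) (F1 (mat_act (vol g *\<^sub>R cofactors (dual_gram g)) a))"
    unfolding is_hodge_def F
  proof (intro conjI allI impI)
    fix \<alpha> assume "alt_form 2 \<alpha>"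
    then obtain y where y: "\<alpha> = F2 y" using alt_form_2_eq by blast
    have "dotv (mat_act (vol g *\<^sub>R cofactors (dual_gram g)) a) y = dotv y (mat_act (vol g *\<^sub>R cofactors (dual_gram g)) a)"
      by (simp add: dotv_def mult_ac)
    then show "wedge_alt \<alpha> (F1 (mat_act (vol g *\<^sub>R cofactors (dual_gram g)) a)) = F3 (inner_alt g \<alpha> (F2 a) * fps_const (vol g))"
      unfolding y wedge_F2_F1 inner_alt_F[OF g] by (simp only: dotv_mat_act_scale)
  next
    show "alt_form (3 - 2) (F1 (mat_act (vol g *\<^sub>R cofactors (dual_gram g)) a))" using alt_form_F1 by simp
  qed
  show "is_hodge g 3 (F3 x) (F0 (fps_const (vol g * det (dual_gram g)) * x))"
    unfolding is_hodge_def F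
  proof (intro conjI allI impI)
    fix \<alpha> assume "alt_form 3 \<alpha>"
    then obtain y where y: "\<alpha> = F3 y" using alt_form_3_eq by blast
    show "wedge_alt \<alpha> (F0 (fps_const (vol g * det (dual_gram g)) * x)) = F3 (inner_alt g \<alpha> (F3 x) * fps_const (vol g))"
      unfolding y wedge_F0_right inner_alt_F[OF g] F3_scale[symmetric] fps_const_mult[symmetric]
      by (simp only: mult_ac)
  qed (simp add: alt_form_F0)
qed

lemma hodge_alt_F:
  assumes g: "inner_product g"
  shows "hodge_alt g 0 (F0 x) = F3 (fps_const (vol g) * x)"
    and "hodge_alt g 1 (F1 a) = F2 (mat_act (vol g *\<^sub>R dual_gram g) a)"
    and "hodge_alt g 2 (F2 a) = F1 (mat_act (vol g *\<^sub>R cofactors (dual_gram g)) a)"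
    and "hodge_alt g 3 (F3 x) = F0 (fps_const (vol g * det (dual_gram g)) * x)"
  by (rule hodge_alt_eqI; simp add: is_hodge_F[OF g] is_hodge_F(2)[OF g, unfolded One_nat_def])+

lemma is_hodge_hodge_alt:
  assumes g: "inner_product g" and k: "k \<le> 3" and \<beta>: "alt_form k \<beta>"
  shows "is_hodge g k \<beta> (hodge_alt g k \<beta>)"
  by (rule alt_form_le_3_cases[OF \<beta> k]) (simp_all only: is_hodge_F[OF g] hodge_alt_F[OF g])

lemma alt_form_hodge_alt:
  assumes "inner_product g" "k \<le> 3" "alt_form k \<beta>"
  shows "alt_form (3 - k) (hodge_alt g k \<beta>)"
  using is_hodge_hodge_alt[OF assms] by (simp add: is_hodge_def)

subsection \<open>Invariance of the star under linear maps\<close>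

definition pullback :: "(real^3 \<Rightarrow> real^3) \<Rightarrow> alt \<Rightarrow> alt" where
  "pullback T \<alpha> vs = \<alpha> (map T vs)"

definition pullback_ip :: "(real^3 \<Rightarrow> real^3) \<Rightarrow> ip \<Rightarrow> ip" where
  "pullback_ip T g v w = g (T v) (T w)"

lemma alt_form_pullback:
  assumes T: "linear T" and \<alpha>: "alt_form k \<alpha>"
  shows "alt_form k (pullback T \<alpha>)"
proof -
  have m: "alternating \<alpha>" using \<alpha> by (rule alt_form_imp_alternating)
  then have "\<alpha> (xs @ v # v # zs) = 0" for xs v zs unfolding alternating_def by blast
  then have "alternating (pullback T \<alpha>)"
    unfolding alternating_def pullback_def
    by (simp add: linear_add[OF T] linear_scale[OF T] alternating_linear[OF m])
  then show ?thesis using \<alpha> by (simp add: alt_form_iff pullback_def)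
qed

lemma wedge_pullback: "wedge_alt (pullback T \<alpha>) (pullback T \<beta>) = pullback T (wedge_alt \<alpha> \<beta>)"
  by (simp add: fun_eq_iff wedge_alt_def pullback_def nths_map)

lemma inner_product_pullback:
  assumes g: "inner_product g" and T: "linear T" "inj T"
  shows "inner_product (pullback_ip T g)"
proof -
  have "bilinear (pullback_ip T g)"
    using g T(1) unfolding inner_product_def bilinear_def pullback_ip_def
    by (auto intro!: linearI simp: linear_add linear_scale)
  moreover have "T v \<noteq> 0" if "v \<noteq> 0" for v using T that by (metis injD linear_0)
  ultimately show ?thesis using g unfolding inner_product_def pullback_ip_def by simp
qed

lemma onb_pullback: "onb (pullback_ip T g) es \<Longrightarrow> onb g (map T es)"
  by (simp add: onb_def pullback_ip_def)

lemma inner_alt_pullback: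
  assumes g: "inner_product g" and T: "linear T" "inj T" and k: "k \<le> 3"
    and \<alpha>: "alt_form k \<alpha>" and \<beta>: "alt_form k \<beta>"
  shows "inner_alt (pullback_ip T g) (pullback T \<alpha>) (pullback T \<beta>) = inner_alt g \<alpha> \<beta>"
proof -
  note g' = inner_product_pullback[OF g T]
  obtain es where es: "onb (pullback_ip T g) es" using onb_exists[OF g'] by blast
  show ?thesis
    unfolding inner_alt_onb[OF g' k alt_form_pullback[OF T(1) \<alpha>] alt_form_pullback[OF T(1) \<beta>] es]
      inner_alt_onb[OF g k \<alpha> \<beta> onb_pullback[OF es]]
    by (simp add: pullback_def nths_map)
qed

lemma gram_pullback:
  assumes g: "inner_product g" and T: "linear T"
  shows "gram (pullback_ip T g) = transpose (matrix T) ** gram g ** matrix T"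
proof -
  have "gram (pullback_ip T g) $ i $ j = (transpose (matrix T) ** gram g ** matrix T) $ i $ j" for i j
    unfolding gram_def pullback_ip_def
    by (simp add: ip_sum[OF g, of "T (axis i 1)" "T (axis j 1)"] matrix_matrix_mult_def transpose_def
        matrix_def sum_3 gram_def algebra_simps)
  then show ?thesis by (simp add: vec_eq_iff)
qed

text \<open>
  Here the orientation enters: \<open>sqrt ((det T)\<^sup>2) = det T\<close>.
\<close>

lemma vol_alt_pullback:
  assumes g: "inner_product g" and T: "linear T" "det (matrix T) > 0"
  shows "vol_alt (pullback_ip T g) = pullback T (vol_alt g)"
proof
  fix vs
  have v: "vol (pullback_ip T g) = det (matrix T) * vol g"
    unfolding vol_def gram_pullback[OF g T(1)] det_mul det_transpose
    using T(2) by (simp add: real_sqrt_mult)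
  have d: "det (vector [T u, T v, T w] :: real^3^3) =
      det (matrix T) * det (vector [u, v, w] :: real^3^3)" for u v w
  proof -
    have Tc: "T x $ i = matrix T $ i $ 1 * x $ 1 + matrix T $ i $ 2 * x $ 2 + matrix T $ i $ 3 * x $ 3" for x i
      using fun_cong[OF matrix_vector_mul(2)[OF T(1)], of x]
      by (simp add: vec_eq_iff matrix_vector_mult_def sum_3)
    have "vector [T u, T v, T w] = (vector [u, v, w] :: real^3^3) ** transpose (matrix T)"
      by (simp add: vec_eq_iff forall_3 matrix_matrix_mult_def transpose_def sum_3 Tc mult_ac)
    then show ?thesis by (simp add: det_mul)
  qed
  show "vol_alt (pullback_ip T g) vs = pullback T (vol_alt g) vs"
  proof (cases "length vs = 3")
    case True
    then obtain u v w where "vs = [u, v, w]" by (auto simp: length_Suc_conv numeral_3_eq_3)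
    then show ?thesis
      using v d
      unfolding vol_alt_F3 pullback_def by (simp add: F3_det mult_ac del: F3.simps)
  qed (simp add: vol_alt_def pullback_def)
qed

text \<open>
  Pullback preserves the wedge product, the inner product and the volume form, hence also the
  form that these determine; every test form is a pullback because \<open>T\<close> is invertible.
\<close>

lemma hodge_alt_pullback:
  assumes g: "inner_product g" and T: "linear T" "det (matrix T) > 0"
    and k: "k \<le> 3" and \<beta>: "alt_form k \<beta>"
  shows "hodge_alt (pullback_ip T g) k (pullback T \<beta>) = pullback T (hodge_alt g k \<beta>)"
proof (rule hodge_alt_eqI[OF k])
  have inj: "inj T" using T det_nz_iff_inj[OF T(1)] by simp
  obtain T' where T': "linear T'" "\<And>x. T' (T x) = x" "\<And>x. T (T' x) = x"
    using linear_injective_isomorphism[OF T(1) inj] by blast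
  note h = is_hodge_hodge_alt[OF g k \<beta>]
  show "is_hodge (pullback_ip T g) k (pullback T \<beta>) (pullback T (hodge_alt g k \<beta>))"
    unfolding is_hodge_def
  proof (intro conjI allI impI)
    show "alt_form (3 - k) (pullback T (hodge_alt g k \<beta>))"
      using h alt_form_pullback[OF T(1)] by (simp add: is_hodge_def)
  next
    fix \<alpha> assume \<alpha>: "alt_form k \<alpha>"
    define \<alpha>' where "\<alpha>' = pullback T' \<alpha>"
    have \<alpha>': "alt_form k \<alpha>'" unfolding \<alpha>'_def using T'(1) \<alpha> by (rule alt_form_pullback)
    have e: "\<alpha> = pullback T \<alpha>'" by (simp add: \<alpha>'_def pullback_def fun_eq_iff T'(2) o_def)
    have "wedge_alt \<alpha> (pullback T (hodge_alt g k \<beta>)) = pullback T (wedge_alt \<alpha>' (hodge_alt g k \<beta>))"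
      unfolding e wedge_pullback ..
    also have "\<dots> = pullback T (\<lambda>vs. inner_alt g \<alpha>' \<beta> * vol_alt g vs)"
      using h \<alpha>' by (simp add: is_hodge_def)
    also have "\<dots> = (\<lambda>vs. inner_alt g \<alpha>' \<beta> * vol_alt (pullback_ip T g) vs)"
      unfolding vol_alt_pullback[OF g T] by (simp add: pullback_def fun_eq_iff)
    also have "inner_alt g \<alpha>' \<beta> = inner_alt (pullback_ip T g) \<alpha> (pullback T \<beta>)"
      unfolding e using inner_alt_pullback[OF g T(1) inj k \<alpha>' \<beta>] by simp
    finally show "wedge_alt \<alpha> (pullback T (hodge_alt g k \<beta>)) =
      (\<lambda>vs. inner_alt (pullback_ip T g) \<alpha> (pullback T \<beta>) * vol_alt (pullback_ip T g) vs)" .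
  qed
qed

section \<open>Smooth functions\<close>

lemma Ck_on_cong:
  assumes "open S" "\<And>x. x \<in> S \<Longrightarrow> f x = g x" "Ck_on k S f"
  shows "Ck_on k S g"
  using assms(2,3)
proof (induction k arbitrary: f g)
  case 0
  then show ?case by (simp cong: continuous_on_cong)
next
  case (Suc k)
  have d: "(g has_derivative frechet_derivative f (at x)) (at x)" if "x \<in> S" for x
  proof (rule has_derivative_transform_within_open[OF _ assms(1) that])
    show "(f has_derivative frechet_derivative f (at x)) (at x)"
      using Suc.prems(2) that by (auto simp: frechet_derivative_works)
  qed (use Suc.prems(1) in auto)
  have e: "frechet_derivative f (at x) = frechet_derivative g (at x)" if "x \<in> S" for x
    using d[OF that] by (rule frechet_derivative_at)
  have "Ck_on k S (\<lambda>x. frechet_derivative g (at x) v)" for v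
  proof (rule Suc.IH)
    show "frechet_derivative f (at x) v = frechet_derivative g (at x) v" if "x \<in> S" for x
      by (simp only: e[OF that])
    show "Ck_on k S (\<lambda>x. frechet_derivative f (at x) v)" using Suc.prems(2) by simp
  qed
  then show ?case using d by (auto simp: differentiable_def)
qed

text \<open>
  It suffices to know some derivative; this avoids computing \<open>frechet_derivative\<close> in the closure
  properties below.
\<close>

lemma Ck_on_SucI:
  assumes "open S" "\<And>x. x \<in> S \<Longrightarrow> (f has_derivative f' x) (at x)" "\<And>v. Ck_on k S (\<lambda>x. f' x v)"
  shows "Ck_on (Suc k) S f"
proof -
  have "f' x = frechet_derivative f (at x)" if "x \<in> S" for x
    using assms(2)[OF that] by (rule frechet_derivative_at)
  have "Ck_on k S (\<lambda>x. frechet_derivative f (at x) v)" for v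
  proof (rule Ck_on_cong[OF assms(1) _ assms(3)])
    show "f' x v = frechet_derivative f (at x) v" if "x \<in> S" for x
      using \<open>\<And>x. x \<in> S \<Longrightarrow> f' x = frechet_derivative f (at x)\<close>[OF that] by (rule fun_cong)
  qed
  then show ?thesis using assms(2) by (auto simp: differentiable_def)
qed

lemma Ck_on_SucD: "Ck_on (Suc k) S f \<Longrightarrow> Ck_on k S f"
proof (induction k arbitrary: f)
  case 0
  then show ?case
    by (auto intro!: continuous_at_imp_continuous_on differentiable_imp_continuous_within)
next
  case (Suc k)
  then show ?case using Ck_on.simps(2) by blast
qed

lemma Ck_on_has_derivative:
  "Ck_on (Suc k) S f \<Longrightarrow> x \<in> S \<Longrightarrow> (f has_derivative frechet_derivative f (at x)) (at x)"
  by (simp add: frechet_derivative_works)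

lemma Ck_on_deriv: "Ck_on (Suc k) S f \<Longrightarrow> Ck_on k S (\<lambda>x. frechet_derivative f (at x) v)"
  by simp

lemma Ck_on_const: "open S \<Longrightarrow> Ck_on k S (\<lambda>x. c)"
  by (induction k arbitrary: c) auto

lemma Ck_on_linear:
  assumes "open S" "bounded_linear L" "Ck_on k S f"
  shows "Ck_on k S (\<lambda>x. L (f x))"
  using assms(3)
proof (induction k arbitrary: f)
  case 0
  then show ?case using assms(2) by (simp add: bounded_linear.continuous_on)
next
  case (Suc k)
  show ?case
  proof (rule Ck_on_SucI[OF assms(1)])
    show "((\<lambda>x. L (f x)) has_derivative (\<lambda>v. L (frechet_derivative f (at x) v))) (at x)" if "x \<in> S" for x
      using bounded_linear.has_derivative[OF assms(2) Ck_on_has_derivative[OF Suc.prems that]] .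
    show "Ck_on k S (\<lambda>x. L (frechet_derivative f (at x) v))" for v
      using Suc.IH[OF Ck_on_deriv[OF Suc.prems]] .
  qed
qed

lemma Ck_on_add:
  assumes "open S" "Ck_on k S f" "Ck_on k S g"
  shows "Ck_on k S (\<lambda>x. f x + g x)"
  using assms(2,3)
proof (induction k arbitrary: f g)
  case 0
  then show ?case by (simp add: continuous_on_add)
next
  case (Suc k)
  show ?case
  proof (rule Ck_on_SucI[OF assms(1)])
    show "((\<lambda>x. f x + g x) has_derivative
        (\<lambda>v. frechet_derivative f (at x) v + frechet_derivative g (at x) v)) (at x)" if "x \<in> S" for x
      using Ck_on_has_derivative[OF Suc.prems(1) that] Ck_on_has_derivative[OF Suc.prems(2) that]
      by (rule has_derivative_add)
    show "Ck_on k S (\<lambda>x. frechet_derivative f (at x) v + frechet_derivative g (at x) v)" for v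
      using Suc.IH[OF Ck_on_deriv[OF Suc.prems(1)] Ck_on_deriv[OF Suc.prems(2)]] .
  qed
qed

lemma Ck_on_mult:
  fixes f g :: "'a::real_normed_vector \<Rightarrow> real"
  assumes "open S" "Ck_on k S f" "Ck_on k S g"
  shows "Ck_on k S (\<lambda>x. f x * g x)"
  using assms(2,3)
proof (induction k arbitrary: f g)
  case 0
  then show ?case by (simp add: continuous_on_mult)
next
  case (Suc k)
  show ?case
  proof (rule Ck_on_SucI[OF assms(1)])
    show "((\<lambda>x. f x * g x) has_derivative
        (\<lambda>v. f x * frechet_derivative g (at x) v + frechet_derivative f (at x) v * g x)) (at x)"
      if "x \<in> S" for x
      using Ck_on_has_derivative[OF Suc.prems(1) that] Ck_on_has_derivative[OF Suc.prems(2) that]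
      by (rule has_derivative_mult)
    show "Ck_on k S (\<lambda>x. f x * frechet_derivative g (at x) v + frechet_derivative f (at x) v * g x)" for v
      by (intro Ck_on_add assms(1) Suc.IH Ck_on_deriv[OF Suc.prems(1)] Ck_on_deriv[OF Suc.prems(2)]
          Ck_on_SucD[OF Suc.prems(1)] Ck_on_SucD[OF Suc.prems(2)])
  qed
qed

lemma Ck_on_inverse:
  fixes f :: "'a::real_normed_vector \<Rightarrow> real"
  assumes "open S" "Ck_on k S f" "\<And>x. x \<in> S \<Longrightarrow> f x \<noteq> 0"
  shows "Ck_on k S (\<lambda>x. inverse (f x))"
  using assms(2)
proof (induction k)
  case 0
  then show ?case using assms(3) by (simp add: continuous_on_inverse)
next
  case (Suc k)
  note IH = Suc.IH[OF Ck_on_SucD[OF Suc.prems]]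
  show ?case
  proof (rule Ck_on_SucI[OF assms(1)])
    show "((\<lambda>x. inverse (f x)) has_derivative
        (\<lambda>v. (- 1) * (inverse (f x) * frechet_derivative f (at x) v * inverse (f x)))) (at x)"
      if "x \<in> S" for x
      using Deriv.has_derivative_inverse[OF assms(3)[OF that] Ck_on_has_derivative[OF Suc.prems that]] by simp
    show "Ck_on k S (\<lambda>x. (- 1) * (inverse (f x) * frechet_derivative f (at x) v * inverse (f x)))" for v
      by (intro Ck_on_mult Ck_on_const assms(1) IH Ck_on_deriv[OF Suc.prems])
  qed
qed

lemma Ck_on_sqrt:
  fixes f :: "'a::real_normed_vector \<Rightarrow> real"
  assumes "open S" "Ck_on k S f" "\<And>x. x \<in> S \<Longrightarrow> f x > 0"
  shows "Ck_on k S (\<lambda>x. sqrt (f x))"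
  using assms(2)
proof (induction k)
  case 0
  then show ?case by (simp add: continuous_on_real_sqrt)
next
  case (Suc k)
  note IH = Suc.IH[OF Ck_on_SucD[OF Suc.prems]]
  show ?case
  proof (rule Ck_on_SucI[OF assms(1)])
    show "((\<lambda>x. sqrt (f x)) has_derivative
        (\<lambda>v. frechet_derivative f (at x) v * inverse (2 * sqrt (f x)))) (at x)" if x: "x \<in> S" for x
    proof -
      have "DERIV sqrt (f x) :> inverse (sqrt (f x)) / 2"
        using assms(3)[OF x] by (rule DERIV_real_sqrt)
      from DERIV_compose_FDERIV[OF this Ck_on_has_derivative[OF Suc.prems x]]
      show ?thesis by (simp add: field_simps)
    qed
    show "Ck_on k S (\<lambda>x. frechet_derivative f (at x) v * inverse (2 * sqrt (f x)))" for v
      using assms(3)[THEN less_imp_neq, THEN not_sym]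
      by (intro Ck_on_mult Ck_on_inverse Ck_on_const assms(1) IH Ck_on_deriv[OF Suc.prems]) simp
  qed
qed

lemma Ck_on_exp:
  fixes f :: "'a::real_normed_vector \<Rightarrow> real"
  assumes "open S" "Ck_on k S f"
  shows "Ck_on k S (\<lambda>x. exp (f x))"
  using assms(2)
proof (induction k)
  case 0
  then show ?case by (simp add: continuous_on_exp)
next
  case (Suc k)
  show ?case
  proof (rule Ck_on_SucI[OF assms(1)])
    show "((\<lambda>x. exp (f x)) has_derivative (\<lambda>v. frechet_derivative f (at x) v * exp (f x))) (at x)"
      if x: "x \<in> S" for x
      using DERIV_compose_FDERIV[OF DERIV_exp Ck_on_has_derivative[OF Suc.prems x]] .
    show "Ck_on k S (\<lambda>x. frechet_derivative f (at x) v * exp (f x))" for v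
      by (intro Ck_on_mult assms(1) Suc.IH Ck_on_SucD[OF Suc.prems] Ck_on_deriv[OF Suc.prems])
  qed
qed

lemma Ck_on_ln:
  fixes f :: "'a::real_normed_vector \<Rightarrow> real"
  assumes "open S" "Ck_on k S f" "\<And>x. x \<in> S \<Longrightarrow> f x > 0"
  shows "Ck_on k S (\<lambda>x. ln (f x))"
proof (cases k)
  case 0
  then show ?thesis
    using assms(2) assms(3)[THEN less_imp_neq, THEN not_sym] by (simp add: continuous_on_ln)
next
  case (Suc l)
  note p = assms(2)[unfolded Suc]
  show ?thesis unfolding Suc
  proof (rule Ck_on_SucI[OF assms(1)])
    show "((\<lambda>x. ln (f x)) has_derivative (\<lambda>v. frechet_derivative f (at x) v * inverse (f x))) (at x)"
      if x: "x \<in> S" for x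
    proof -
      have "DERIV ln (f x) :> inverse (f x)" using assms(3)[OF x] by (rule DERIV_ln)
      from DERIV_compose_FDERIV[OF this Ck_on_has_derivative[OF p x]] show ?thesis .
    qed
    show "Ck_on l S (\<lambda>x. frechet_derivative f (at x) v * inverse (f x))" for v
      using assms(3)[THEN less_imp_neq, THEN not_sym]
      by (intro Ck_on_mult Ck_on_inverse assms(1) Ck_on_deriv[OF p] Ck_on_SucD[OF p]) simp
  qed
qed

lemma smooth_on_cong:
  "open S \<Longrightarrow> (\<And>x. x \<in> S \<Longrightarrow> f x = g x) \<Longrightarrow> smooth_on S f \<Longrightarrow> smooth_on S g"
  unfolding smooth_on_def using Ck_on_cong by blast

lemma smooth_on_const: "open S \<Longrightarrow> smooth_on S (\<lambda>x. c)"
  by (simp add: smooth_on_def Ck_on_const)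

lemma smooth_on_linear: "open S \<Longrightarrow> bounded_linear L \<Longrightarrow> smooth_on S f \<Longrightarrow> smooth_on S (\<lambda>x. L (f x))"
  by (simp add: smooth_on_def Ck_on_linear)

lemma smooth_on_add: "open S \<Longrightarrow> smooth_on S f \<Longrightarrow> smooth_on S g \<Longrightarrow> smooth_on S (\<lambda>x. f x + g x)"
  by (simp add: smooth_on_def Ck_on_add)

lemma smooth_on_mult:
  fixes f g :: "'a::real_normed_vector \<Rightarrow> real"
  shows "open S \<Longrightarrow> smooth_on S f \<Longrightarrow> smooth_on S g \<Longrightarrow> smooth_on S (\<lambda>x. f x * g x)"
  by (simp add: smooth_on_def Ck_on_mult)

lemma smooth_on_minus:
  fixes f :: "'a::real_normed_vector \<Rightarrow> real"
  shows "open S \<Longrightarrow> smooth_on S f \<Longrightarrow> smooth_on S (\<lambda>x. - f x)"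
  using smooth_on_mult[of S "\<lambda>x. -1" f] smooth_on_const[of S "-1"] by simp

lemma smooth_on_diff:
  fixes f g :: "'a::real_normed_vector \<Rightarrow> real"
  shows "open S \<Longrightarrow> smooth_on S f \<Longrightarrow> smooth_on S g \<Longrightarrow> smooth_on S (\<lambda>x. f x - g x)"
  using smooth_on_add[of S f "\<lambda>x. - g x"] smooth_on_minus[of S g] by simp

lemma smooth_on_sum:
  fixes f :: "'i \<Rightarrow> 'a::real_normed_vector \<Rightarrow> real"
  assumes "open S" "\<And>i. i \<in> I \<Longrightarrow> smooth_on S (f i)"
  shows "smooth_on S (\<lambda>x. \<Sum>i\<in>I. f i x)"
  using assms(2)
  by (induction I rule: infinite_finite_induct) (auto intro!: smooth_on_const smooth_on_add assms(1))

lemma smooth_on_inverse: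
  fixes f :: "'a::real_normed_vector \<Rightarrow> real"
  shows "open S \<Longrightarrow> smooth_on S f \<Longrightarrow> (\<And>x. x \<in> S \<Longrightarrow> f x \<noteq> 0) \<Longrightarrow> smooth_on S (\<lambda>x. inverse (f x))"
  by (simp add: smooth_on_def Ck_on_inverse)

lemma smooth_on_sqrt:
  fixes f :: "'a::real_normed_vector \<Rightarrow> real"
  shows "open S \<Longrightarrow> smooth_on S f \<Longrightarrow> (\<And>x. x \<in> S \<Longrightarrow> f x > 0) \<Longrightarrow> smooth_on S (\<lambda>x. sqrt (f x))"
  by (simp add: smooth_on_def Ck_on_sqrt)

lemma smooth_on_exp:
  fixes f :: "'a::real_normed_vector \<Rightarrow> real"
  shows "open S \<Longrightarrow> smooth_on S f \<Longrightarrow> smooth_on S (\<lambda>x. exp (f x))"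
  by (simp add: smooth_on_def Ck_on_exp)

lemma smooth_on_ln:
  fixes f :: "'a::real_normed_vector \<Rightarrow> real"
  shows "open S \<Longrightarrow> smooth_on S f \<Longrightarrow> (\<And>x. x \<in> S \<Longrightarrow> f x > 0) \<Longrightarrow> smooth_on S (\<lambda>x. ln (f x))"
  by (simp add: smooth_on_def Ck_on_ln)

lemma smooth_on_has_derivative:
  "smooth_on S f \<Longrightarrow> x \<in> S \<Longrightarrow> (f has_derivative frechet_derivative f (at x)) (at x)"
  unfolding smooth_on_def using Ck_on_has_derivative by blast

lemma smooth_on_differentiable: "smooth_on S f \<Longrightarrow> x \<in> S \<Longrightarrow> f differentiable (at x)"
  using smooth_on_has_derivative by (auto simp: differentiable_def)

lemma smooth_on_deriv: "smooth_on S f \<Longrightarrow> smooth_on S (\<lambda>x. frechet_derivative f (at x) v)"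
  unfolding smooth_on_def using Ck_on_deriv by blast

subsection \<open>Symmetry of the second derivative\<close>

lemma DERIV_along_line:
  assumes "f differentiable (at (p + s *\<^sub>R v))"
  shows "DERIV (\<lambda>s. f (p + s *\<^sub>R v)) s :> frechet_derivative f (at (p + s *\<^sub>R v)) v"
proof -
  let ?D = "frechet_derivative f (at (p + s *\<^sub>R v))"
  have "((\<lambda>s. p + s *\<^sub>R v) has_derivative (\<lambda>h. h *\<^sub>R v)) (at s)"
    by (auto intro!: derivative_eq_intros)
  moreover have fd: "(f has_derivative ?D) (at (p + s *\<^sub>R v))"
    using assms by (simp add: frechet_derivative_works)
  ultimately have "((\<lambda>s. f (p + s *\<^sub>R v)) has_derivative (\<lambda>h. ?D (h *\<^sub>R v))) (at s)"
    using has_derivative_compose by blast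
  moreover have "?D (h *\<^sub>R v) = ?D v * h" for h
    using linear_scale[OF linear_frechet_derivative[OF assms]] by simp
  ultimately show ?thesis by (simp add: has_field_derivative_def)
qed

text \<open>
  The mean value theorem in direction \<open>v\<close>, then in direction \<open>w\<close>.
\<close>

lemma second_difference:
  fixes f :: "'a::real_normed_vector \<Rightarrow> real"
  assumes f: "Ck_on 2 S f" and h: "h > 0"
    and S: "\<And>s t. 0 \<le> s \<Longrightarrow> s \<le> h \<Longrightarrow> 0 \<le> t \<Longrightarrow> t \<le> h \<Longrightarrow> x + s *\<^sub>R v + t *\<^sub>R w \<in> S"
  shows "\<exists>s t. 0 < s \<and> s < h \<and> 0 < t \<and> t < h \<and>
    f (x + h *\<^sub>R v + h *\<^sub>R w) - f (x + h *\<^sub>R v) - f (x + h *\<^sub>R w) + f x =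
      h * h * frechet_derivative (\<lambda>y. frechet_derivative f (at y) v) (at (x + s *\<^sub>R v + t *\<^sub>R w)) w"
proof -
  let ?D = "\<lambda>y. frechet_derivative f (at y) v"
  have d1: "f differentiable (at y)" if "y \<in> S" for y using f that by (simp add: numeral_2_eq_2)
  have d2: "?D differentiable (at y)" if "y \<in> S" for y using f that by (simp add: numeral_2_eq_2)
  have "\<exists>s. 0 < s \<and> s < h \<and>
      (f ((x + h *\<^sub>R w) + h *\<^sub>R v) - f (x + h *\<^sub>R v)) - (f ((x + h *\<^sub>R w) + 0 *\<^sub>R v) - f (x + 0 *\<^sub>R v)) =
      (h - 0) * (?D ((x + h *\<^sub>R w) + s *\<^sub>R v) - ?D (x + s *\<^sub>R v))"
  proof (rule MVT2[OF h])
    fix s :: real assume s: "0 \<le> s" "s \<le> h"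
    have "x + h *\<^sub>R w + s *\<^sub>R v \<in> S" using S[OF s, of h] h by (simp add: add_ac)
    moreover have "x + s *\<^sub>R v \<in> S" using S[OF s, of 0] h by simp
    ultimately show "DERIV (\<lambda>s. f ((x + h *\<^sub>R w) + s *\<^sub>R v) - f (x + s *\<^sub>R v)) s :>
        ?D ((x + h *\<^sub>R w) + s *\<^sub>R v) - ?D (x + s *\<^sub>R v)"
      by (intro DERIV_diff DERIV_along_line d1)
  qed
  then obtain s where s: "0 < s" "s < h" and e1:
    "f (x + h *\<^sub>R v + h *\<^sub>R w) - f (x + h *\<^sub>R v) - f (x + h *\<^sub>R w) + f x =
      h * (?D ((x + s *\<^sub>R v) + h *\<^sub>R w) - ?D ((x + s *\<^sub>R v) + 0 *\<^sub>R w))"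
    by (auto simp: add_ac)
  have "\<exists>t. 0 < t \<and> t < h \<and> ?D ((x + s *\<^sub>R v) + h *\<^sub>R w) - ?D ((x + s *\<^sub>R v) + 0 *\<^sub>R w) =
      (h - 0) * frechet_derivative ?D (at ((x + s *\<^sub>R v) + t *\<^sub>R w)) w"
  proof (rule MVT2[OF h])
    fix t :: real assume t: "0 \<le> t" "t \<le> h"
    show "DERIV (\<lambda>t. ?D ((x + s *\<^sub>R v) + t *\<^sub>R w)) t :>
        frechet_derivative ?D (at ((x + s *\<^sub>R v) + t *\<^sub>R w)) w"
      using S[OF _ _ t, of s] s by (intro DERIV_along_line d2) auto
  qed
  then obtain t where t: "0 < t" "t < h" and e2:
    "?D ((x + s *\<^sub>R v) + h *\<^sub>R w) - ?D ((x + s *\<^sub>R v) + 0 *\<^sub>R w) =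
      h * frechet_derivative ?D (at (x + s *\<^sub>R v + t *\<^sub>R w)) w" by auto
  show ?thesis
    by (rule exI[of _ s], rule exI[of _ t]) (use s t e1 e2 in simp)
qed

text \<open>
  The second difference is symmetric in \<open>v\<close> and \<open>w\<close>, so that the two mixed derivatives agree at
  points arbitrarily close to \<open>x\<close>, and they are continuous.
\<close>

lemma second_derivative_symmetric:
  fixes f :: "'a::real_normed_vector \<Rightarrow> real"
  assumes S: "open S" "x \<in> S" and f: "Ck_on 2 S f"
  shows "frechet_derivative (\<lambda>y. frechet_derivative f (at y) v) (at x) w =
    frechet_derivative (\<lambda>y. frechet_derivative f (at y) w) (at x) v"
    (is "?A x = ?B x")
proof (rule ccontr)
  assume ne: "?A x \<noteq> ?B x"
  define \<epsilon> where "\<epsilon> = \<bar>?A x - ?B x\<bar> / 2"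
  have \<epsilon>: "\<epsilon> > 0" using ne by (simp add: \<epsilon>_def)
  have "continuous_on S ?A" "continuous_on S ?B" using f by (simp_all add: numeral_2_eq_2)
  then have c: "isCont ?A x" "isCont ?B x" using S by (simp_all add: continuous_on_eq_continuous_at)
  obtain d1 where d1: "d1 > 0" "\<And>y. dist y x < d1 \<Longrightarrow> dist (?A y) (?A x) < \<epsilon>"
    using c(1) \<epsilon> unfolding continuous_at_eps_delta by blast
  obtain d2 where d2: "d2 > 0" "\<And>y. dist y x < d2 \<Longrightarrow> dist (?B y) (?B x) < \<epsilon>"
    using c(2) \<epsilon> unfolding continuous_at_eps_delta by blast
  obtain d3 where d3: "d3 > 0" "ball x d3 \<subseteq> S" using S open_contains_ball by blast
  define d where "d = min d1 (min d2 d3)"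
  have d: "d > 0" using d1 d2 d3 by (simp add: d_def)
  \<comment> \<open>With this choice all points x + s v + t w, where s and t lie between 0 and h, are within distance d of x.\<close>
  define N where "N = norm v + norm w + 1"
  have N: "N > 0" unfolding N_def using norm_ge_zero[of v] norm_ge_zero[of w] by linarith
  define h where "h = d / (2 * N)"
  have h: "h > 0" using d N by (simp add: h_def)
  have near: "dist (x + s *\<^sub>R v + t *\<^sub>R w) x < d" if "0 \<le> s" "s \<le> h" "0 \<le> t" "t \<le> h" for s t
  proof -
    have "dist (x + s *\<^sub>R v + t *\<^sub>R w) x = norm (s *\<^sub>R v + t *\<^sub>R w)" by (simp add: dist_norm)
    also have "\<dots> \<le> norm (s *\<^sub>R v) + norm (t *\<^sub>R w)" by (rule norm_triangle_ineq)
    also have "\<dots> \<le> h * norm v + h * norm w" using that by (auto intro!: add_mono mult_right_mono)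
    also have "\<dots> \<le> h * N" using h by (simp add: N_def algebra_simps)
    also have "\<dots> < d" using d N by (simp add: h_def)
    finally show ?thesis .
  qed
  have inS: "x + s *\<^sub>R v + t *\<^sub>R w \<in> S" if "0 \<le> s" "s \<le> h" "0 \<le> t" "t \<le> h" for s t
    using near[OF that] d3 unfolding d_def by (auto simp: dist_commute)
  have inS': "x + s *\<^sub>R w + t *\<^sub>R v \<in> S" if "0 \<le> s" "s \<le> h" "0 \<le> t" "t \<le> h" for s t
    using inS[OF that(3,4,1,2)] by (simp add: add_ac)
  obtain s t where st: "0 < s" "s < h" "0 < t" "t < h" and e1:
    "f (x + h *\<^sub>R v + h *\<^sub>R w) - f (x + h *\<^sub>R v) - f (x + h *\<^sub>R w) + f x = h * h * ?A (x + s *\<^sub>R v + t *\<^sub>R w)"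
    using second_difference[OF f h inS] by blast
  obtain s' t' where st': "0 < s'" "s' < h" "0 < t'" "t' < h" and e2:
    "f (x + h *\<^sub>R w + h *\<^sub>R v) - f (x + h *\<^sub>R w) - f (x + h *\<^sub>R v) + f x = h * h * ?B (x + s' *\<^sub>R w + t' *\<^sub>R v)"
    using second_difference[OF f h inS'] by blast
  have E: "x + h *\<^sub>R w + h *\<^sub>R v = x + h *\<^sub>R v + h *\<^sub>R w" by simp
  have "h * h * ?A (x + s *\<^sub>R v + t *\<^sub>R w) = h * h * ?B (x + s' *\<^sub>R w + t' *\<^sub>R v)"
    using e1 e2[unfolded E] by linarith
  then have eq: "?A (x + s *\<^sub>R v + t *\<^sub>R w) = ?B (x + s' *\<^sub>R w + t' *\<^sub>R v)" using h by simp
  have "dist (x + s *\<^sub>R v + t *\<^sub>R w) x < d1" using near[of s t] st by (simp add: d_def)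
  from d1(2)[OF this] have a: "\<bar>?A (x + s *\<^sub>R v + t *\<^sub>R w) - ?A x\<bar> < \<epsilon>" by (simp add: dist_real_def)
  have E': "x + s' *\<^sub>R w + t' *\<^sub>R v = x + t' *\<^sub>R v + s' *\<^sub>R w" by simp
  have "dist (x + s' *\<^sub>R w + t' *\<^sub>R v) x < d2" unfolding E' using near[of t' s'] st' by (simp add: d_def)
  from d2(2)[OF this] have b: "\<bar>?B (x + s' *\<^sub>R w + t' *\<^sub>R v) - ?B x\<bar> < \<epsilon>" by (simp add: dist_real_def)
  have "\<bar>c - d\<bar> \<le> \<bar>a - c\<bar> + \<bar>b - d\<bar>" if "a = b" for a b c d :: real using that by linarith
  from this[OF eq, of "?A x" "?B x"] have "2 * \<epsilon> < \<epsilon> + \<epsilon>" using a b unfolding \<epsilon>_def by simp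
  then show False by simp
qed

section \<open>Smooth families of power series\<close>

definition smooth_fps :: "'a::real_normed_vector set \<Rightarrow> ('a \<Rightarrow> real fps) \<Rightarrow> bool" where
  "smooth_fps S F \<longleftrightarrow> (\<forall>n. smooth_on S (\<lambda>x. fps_nth (F x) n))"

lemma smooth_fps_cong: "open S \<Longrightarrow> (\<And>x. x \<in> S \<Longrightarrow> F x = G x) \<Longrightarrow> smooth_fps S F \<Longrightarrow> smooth_fps S G"
  unfolding smooth_fps_def using smooth_on_cong[of S "\<lambda>x. fps_nth (F x) n" "\<lambda>x. fps_nth (G x) n" for n] by simp

lemma smooth_fps_const: "open S \<Longrightarrow> smooth_fps S (\<lambda>x. c)"
  by (simp add: smooth_fps_def smooth_on_const)

lemma smooth_fps_fps_const: "open S \<Longrightarrow> smooth_on S f \<Longrightarrow> smooth_fps S (\<lambda>x. fps_const (f x))"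
  unfolding smooth_fps_def
proof
  fix n assume "open S" "smooth_on S f"
  then show "smooth_on S (\<lambda>x. fps_nth (fps_const (f x)) n)"
    by (cases "n = 0") (simp_all add: smooth_on_const)
qed

lemma smooth_fps_add: "open S \<Longrightarrow> smooth_fps S F \<Longrightarrow> smooth_fps S G \<Longrightarrow> smooth_fps S (\<lambda>x. F x + G x)"
  by (simp add: smooth_fps_def smooth_on_add)

lemma smooth_fps_mult: "open S \<Longrightarrow> smooth_fps S F \<Longrightarrow> smooth_fps S G \<Longrightarrow> smooth_fps S (\<lambda>x. F x * G x)"
  by (auto simp: smooth_fps_def fps_mult_nth intro!: smooth_on_sum smooth_on_mult)

lemma smooth_fps_sum: "open S \<Longrightarrow> (\<And>i. i \<in> I \<Longrightarrow> smooth_fps S (F i)) \<Longrightarrow> smooth_fps S (\<lambda>x. \<Sum>i\<in>I. F i x)"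
  by (auto simp: smooth_fps_def fps_sum_nth intro!: smooth_on_sum)

lemma smooth_fps_deriv: "open S \<Longrightarrow> smooth_fps S F \<Longrightarrow> smooth_fps S (\<lambda>x. fps_deriv (F x))"
  by (auto simp: smooth_fps_def intro!: smooth_on_mult smooth_on_const)

text \<open>
  The coefficients of the inverse are given by a recursion in which only the constant coefficient
  of the series is divided by.
\<close>

lemma smooth_fps_inverse:
  assumes S: "open S" and F: "smooth_fps S F" and nz: "\<And>x. x \<in> S \<Longrightarrow> fps_nth (F x) 0 \<noteq> 0"
  shows "smooth_fps S (\<lambda>x. inverse (F x))"
proof -
  have "smooth_on S (\<lambda>x. fps_nth (inverse (F x)) n)" for n
  proof (induction n rule: less_induct)
    case (less n)
    have F0: "smooth_on S (\<lambda>x. inverse (fps_nth (F x) 0))"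
      using F nz S by (intro smooth_on_inverse) (auto simp: smooth_fps_def)
    show ?case
    proof (cases n)
      case 0
      then show ?thesis using F0 by simp
    next
      case (Suc m)
      have rec: "fps_nth (inverse (F x)) n =
          - (inverse (fps_nth (F x) 0) * (\<Sum>i=1..n. fps_nth (F x) i * fps_nth (inverse (F x)) (n - i)))"
        if "x \<in> S" for x
      proof -
        have "F x * inverse (F x) = 1" using inverse_mult_eq_1'[OF nz[OF that]] .
        then have "fps_nth (F x * inverse (F x)) n = 0" using Suc by simp
        then have "fps_nth (F x) 0 * fps_nth (inverse (F x)) n +
            (\<Sum>i=1..n. fps_nth (F x) i * fps_nth (inverse (F x)) (n - i)) = 0"
          unfolding fps_mult_nth by (simp add: sum.atLeast_Suc_atMost)
        then have "fps_nth (F x) 0 * fps_nth (inverse (F x)) n =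
            - (\<Sum>i=1..n. fps_nth (F x) i * fps_nth (inverse (F x)) (n - i))" by linarith
        then show ?thesis using nz[OF that] by (simp add: field_simps)
      qed
      have sm: "smooth_on S (\<lambda>x. - (inverse (fps_nth (F x) 0) *
          (\<Sum>i=1..n. fps_nth (F x) i * fps_nth (inverse (F x)) (n - i))))"
        using F less Suc
        by (intro smooth_on_minus smooth_on_mult smooth_on_sum S F0) (auto simp: smooth_fps_def)
      show ?thesis by (rule smooth_on_cong[OF S rec[symmetric] sm])
    qed
  qed
  then show ?thesis by (simp add: smooth_fps_def)
qed

definition diff_fps :: "('a::real_normed_vector \<Rightarrow> real fps) \<Rightarrow> 'a \<Rightarrow> bool" where
  "diff_fps F x \<longleftrightarrow> (\<forall>n. (\<lambda>y. fps_nth (F y) n) differentiable (at x))"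

lemma smooth_fps_diff_fps: "smooth_fps S F \<Longrightarrow> x \<in> S \<Longrightarrow> diff_fps F x"
  unfolding smooth_fps_def diff_fps_def using smooth_on_differentiable by blast

lemma dir_deriv_nth:
  "fps_nth (dir_deriv F x v) n = frechet_derivative (\<lambda>y. fps_nth (F y) n) (at x) v"
  by (simp add: dir_deriv_def)

lemma dir_deriv_nthI:
  "((\<lambda>y. fps_nth (F y) n) has_derivative f') (at x) \<Longrightarrow> fps_nth (dir_deriv F x v) n = f' v"
  unfolding dir_deriv_nth using frechet_derivative_at by metis

lemma diff_fps_has_derivative:
  "diff_fps F x \<Longrightarrow> ((\<lambda>y. fps_nth (F y) n) has_derivative (\<lambda>v. fps_nth (dir_deriv F x v) n)) (at x)"
  unfolding dir_deriv_nth diff_fps_def using frechet_derivative_works by blast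

lemma smooth_fps_dir_deriv: "smooth_fps S F \<Longrightarrow> smooth_fps S (\<lambda>x. dir_deriv F x v)"
  unfolding smooth_fps_def dir_deriv_nth using smooth_on_deriv by blast

lemma dir_deriv_const: "dir_deriv (\<lambda>y. c) x v = 0"
  by (simp add: fps_eq_iff dir_deriv_nth)

lemma dir_deriv_add:
  assumes "diff_fps F x" "diff_fps G x"
  shows "dir_deriv (\<lambda>y. F y + G y) x v = dir_deriv F x v + dir_deriv G x v"
proof (rule fps_ext)
  fix n
  show "fps_nth (dir_deriv (\<lambda>y. F y + G y) x v) n = fps_nth (dir_deriv F x v + dir_deriv G x v) n"
    using dir_deriv_nthI[of "\<lambda>y. F y + G y" n _ x v]
      has_derivative_add[OF diff_fps_has_derivative[OF assms(1)] diff_fps_has_derivative[OF assms(2)], of n n]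
    by simp
qed

lemma dir_deriv_mult:
  assumes "diff_fps F x" "diff_fps G x"
  shows "dir_deriv (\<lambda>y. F y * G y) x v = dir_deriv F x v * G x + F x * dir_deriv G x v"
proof (rule fps_ext)
  fix n
  have "((\<lambda>y. \<Sum>i=0..n. fps_nth (F y) i * fps_nth (G y) (n - i)) has_derivative
     (\<lambda>v. \<Sum>i=0..n. fps_nth (F x) i * fps_nth (dir_deriv G x v) (n - i)
        + fps_nth (dir_deriv F x v) i * fps_nth (G x) (n - i))) (at x)"
    by (intro has_derivative_sum has_derivative_mult diff_fps_has_derivative assms)
  then show "fps_nth (dir_deriv (\<lambda>y. F y * G y) x v) n =
      fps_nth (dir_deriv F x v * G x + F x * dir_deriv G x v) n"
    using dir_deriv_nthI[of "\<lambda>y. F y * G y" n _ x v]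
    by (simp add: fps_mult_nth sum.distrib add.commute)
qed

lemma diff_fps_const: "diff_fps (\<lambda>y. c) x"
  by (simp add: diff_fps_def)

lemma diff_fps_add: "diff_fps F x \<Longrightarrow> diff_fps G x \<Longrightarrow> diff_fps (\<lambda>y. F y + G y) x"
  by (simp add: diff_fps_def)

lemma diff_fps_mult: "diff_fps F x \<Longrightarrow> diff_fps G x \<Longrightarrow> diff_fps (\<lambda>y. F y * G y) x"
  by (auto simp: diff_fps_def fps_mult_nth intro!: differentiable_sum)

lemma diff_fps_dir_deriv_linear:
  assumes "diff_fps F x"
  shows "dir_deriv F x (a *\<^sub>R v + b *\<^sub>R w) = fps_const a * dir_deriv F x v + fps_const b * dir_deriv F x w"
proof (rule fps_ext)
  fix n
  have l: "linear (\<lambda>v. fps_nth (dir_deriv F x v) n)"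
    using diff_fps_has_derivative[OF assms] has_derivative_linear by blast
  show "fps_nth (dir_deriv F x (a *\<^sub>R v + b *\<^sub>R w)) n =
      fps_nth (fps_const a * dir_deriv F x v + fps_const b * dir_deriv F x w) n"
    using linear_add[OF l, of "a *\<^sub>R v" "b *\<^sub>R w"] linear_scale[OF l, of a v] linear_scale[OF l, of b w]
    by simp
qed

lemma dir_deriv_fps_const:
  assumes "(f has_derivative f') (at x)"
  shows "dir_deriv (\<lambda>y. fps_const (f y)) x v = fps_const (f' v)"
proof (rule fps_ext)
  fix n
  show "fps_nth (dir_deriv (\<lambda>y. fps_const (f y)) x v) n = fps_nth (fps_const (f' v)) n"
    using dir_deriv_nthI[of "\<lambda>y. fps_const (f y)" n "\<lambda>v. if n = 0 then f' v else 0" x v] assms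
    by (cases "n = 0") auto
qed

lemma diff_fps_fps_const:
  assumes "(f has_derivative f') (at x)"
  shows "diff_fps (\<lambda>y. fps_const (f y)) x"
  unfolding diff_fps_def
proof
  fix n
  show "(\<lambda>y. fps_nth (fps_const (f y)) n) differentiable (at x)"
    using assms by (cases "n = 0") (auto simp: differentiable_def)
qed

lemma dir_deriv_compose:
  assumes "(\<psi> has_derivative \<psi>') (at x)" "diff_fps F (\<psi> x)"
  shows "dir_deriv (\<lambda>y. F (\<psi> y)) x v = dir_deriv F (\<psi> x) (\<psi>' v)"
  by (rule fps_ext, rule dir_deriv_nthI)
    (rule has_derivative_compose[OF assms(1) diff_fps_has_derivative[OF assms(2)]])

lemma diff_fps_compose:
  fixes F :: "real^3 \<Rightarrow> real fps"
  assumes "(\<psi> has_derivative \<psi>') (at x)" "diff_fps F (\<psi> x)"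
  shows "diff_fps (\<lambda>y. F (\<psi> y)) x"
  using has_derivative_compose[OF assms(1) diff_fps_has_derivative[OF assms(2)]]
  unfolding diff_fps_def differentiable_def by blast

lemma dir_deriv_cong:
  assumes "open S" "x \<in> S" "\<And>y. y \<in> S \<Longrightarrow> F y = G y" "diff_fps F x"
  shows "dir_deriv F x v = dir_deriv G x v"
proof (rule fps_ext)
  fix n
  have "((\<lambda>y. fps_nth (G y) n) has_derivative (\<lambda>v. fps_nth (dir_deriv F x v) n)) (at x)"
    by (rule has_derivative_transform_within_open[OF diff_fps_has_derivative[OF assms(4)] assms(1,2)])
      (simp add: assms(3))
  then show "fps_nth (dir_deriv F x v) n = fps_nth (dir_deriv G x v) n"
    using dir_deriv_nthI[of G n _ x v] by simp
qed

lemma dir_deriv_fps_deriv: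
  assumes "diff_fps F x"
  shows "dir_deriv (\<lambda>y. fps_deriv (F y)) x v = fps_deriv (dir_deriv F x v)"
proof (rule fps_ext)
  fix n
  have "((\<lambda>y. of_nat (n + 1) * fps_nth (F y) (n + 1)) has_derivative
      (\<lambda>v. of_nat (n + 1) * fps_nth (dir_deriv F x v) (n + 1))) (at x)"
    by (intro has_derivative_mult_right diff_fps_has_derivative assms)
  then show "fps_nth (dir_deriv (\<lambda>y. fps_deriv (F y)) x v) n = fps_nth (fps_deriv (dir_deriv F x v)) n"
    using dir_deriv_nthI[of "\<lambda>y. fps_deriv (F y)" n _ x v] by simp
qed

lemma dir_deriv_symmetric:
  assumes "open S" "x \<in> S" "smooth_fps S F"
  shows "dir_deriv (\<lambda>y. dir_deriv F y v) x w = dir_deriv (\<lambda>y. dir_deriv F y w) x v"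
  by (rule fps_ext, unfold dir_deriv_nth, rule second_derivative_symmetric[OF assms(1,2)])
    (use assms(3) in \<open>auto simp: smooth_fps_def smooth_on_def\<close>)

section \<open>Exterior derivative in coordinates\<close>

text \<open>
  The exterior derivative of a form on an open subset of \<open>real^3\<close>.
\<close>

definition coord_d :: "(real^3 \<Rightarrow> alt) \<Rightarrow> real^3 \<Rightarrow> alt" where
  "coord_d A x vs = (\<Sum>i<length vs. (-1) ^ i * dir_deriv (\<lambda>y. A y (take i vs @ drop (Suc i) vs)) x (vs ! i))"

lemma coord_d_1: "coord_d A x [v] = dir_deriv (\<lambda>y. A y []) x v"
  by (simp add: coord_d_def)

lemma coord_d_2: "coord_d A x [v, w] = dir_deriv (\<lambda>y. A y [w]) x v - dir_deriv (\<lambda>y. A y [v]) x w"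
  by (simp add: coord_d_def)

lemma coord_d_3: "coord_d A x [u, v, w] = dir_deriv (\<lambda>y. A y [v, w]) x u - dir_deriv (\<lambda>y. A y [u, w]) x v
    + dir_deriv (\<lambda>y. A y [u, v]) x w"
  by (simp add: coord_d_def numeral_3_eq_3 fps_const_minus_one)

lemma dir_deriv_eq_0:
  assumes "open N" "x \<in> N" "\<And>y. y \<in> N \<Longrightarrow> F y = 0"
  shows "dir_deriv F x v = 0"
  using dir_deriv_cong[OF assms(1,2), of "\<lambda>y. 0" F v] assms(3) by (simp add: diff_fps_const dir_deriv_const)

lemma coord_d_length:
  assumes "open N" "x \<in> N" "\<And>y. y \<in> N \<Longrightarrow> alt_form k (A y)" "length vs \<noteq> Suc k"
  shows "coord_d A x vs = 0"
  unfolding coord_d_def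
proof (intro sum.neutral ballI)
  fix i assume i: "i \<in> {..<length vs}"
  then have "length (take i vs @ drop (Suc i) vs) \<noteq> k" using assms(4) by auto
  then have "A y (take i vs @ drop (Suc i) vs) = 0" if "y \<in> N" for y
    using alt_form_length[OF assms(3)[OF that]] by blast
  then show "(-1) ^ i * dir_deriv (\<lambda>y. A y (take i vs @ drop (Suc i) vs)) x (vs ! i) = 0"
    using dir_deriv_eq_0[OF assms(1,2)] by simp
qed

lemma coord_d_cong:
  assumes "open N" "x \<in> N" "\<And>y. y \<in> N \<Longrightarrow> A y = B y" "\<And>vs. diff_fps (\<lambda>y. A y vs) x"
  shows "coord_d A x = coord_d B x"
proof
  fix vs
  have "dir_deriv (\<lambda>y. A y ws) x v = dir_deriv (\<lambda>y. B y ws) x v" for ws v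
    using assms(3) by (intro dir_deriv_cong[OF assms(1,2) _ assms(4)]) simp
  then show "coord_d A x vs = coord_d B x vs" by (simp add: coord_d_def)
qed

text \<open>
  A form of degree at most two has few enough arguments for the expanded formulas above.
\<close>

lemma alt_form_coord_d:
  assumes N: "open N" "x \<in> N" "\<And>y. y \<in> N \<Longrightarrow> alt_form k (A y)" and k: "k \<le> 2"
    and d: "\<And>vs. diff_fps (\<lambda>y. A y vs) x"
  shows "alt_form (Suc k) (coord_d A x)"
proof -
  let ?D = "\<lambda>vs v. dir_deriv (\<lambda>y. A y vs) x v"
  have l1: "?D vs (a *\<^sub>R v + b *\<^sub>R w) = fps_const a * ?D vs v + fps_const b * ?D vs w" for vs a b v w
    by (rule diff_fps_dir_deriv_linear[OF d])
  have l2: "?D (xs @ (a *\<^sub>R v + b *\<^sub>R w) # ys) u =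
      fps_const a * ?D (xs @ v # ys) u + fps_const b * ?D (xs @ w # ys) u" for xs ys a b v w u
  proof -
    have "?D (xs @ (a *\<^sub>R v + b *\<^sub>R w) # ys) u =
        dir_deriv (\<lambda>y. fps_const a * A y (xs @ v # ys) + fps_const b * A y (xs @ w # ys)) x u"
      by (rule dir_deriv_cong[OF N(1,2) _ d]) (rule alternating_linear[OF alt_form_imp_alternating[OF N(3)]])
    also have "\<dots> = fps_const a * ?D (xs @ v # ys) u + fps_const b * ?D (xs @ w # ys) u"
      by (simp add: dir_deriv_add dir_deriv_mult dir_deriv_const diff_fps_mult diff_fps_const d)
    finally show ?thesis .
  qed
  have z: "?D (xs @ v # v # ys) u = 0" for xs ys v u
  proof (rule dir_deriv_eq_0[OF N(1,2)])
    show "A y (xs @ v # v # ys) = 0" if "y \<in> N" for y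
      using alt_form_imp_alternating[OF N(3)[OF that]] unfolding alternating_def by blast
  qed
  note l2' = l2[of "[]", simplified] l2[of "[_]", simplified]
  have len: "coord_d A x vs = 0" if "length vs \<noteq> Suc k" for vs
    using coord_d_length[OF N(1,2) N(3) that] .
  have alt: "coord_d A x (xs @ v # v # zs) = 0" for xs v zs
  proof (cases "length xs + length zs + 1 = k")
    case True
    then consider "xs = []" "zs = []" | u where "xs = []" "zs = [u]" | u where "xs = [u]" "zs = []"
      using k by (cases xs; cases zs) (auto simp: length_Suc_conv le_Suc_eq)
    then show ?thesis
      using z[of "[]" _ "[]", simplified] by cases (simp_all add: coord_d_2 coord_d_3)
  next
    case False
    then show ?thesis by (intro len) simp
  qed
  have lin: "coord_d A x (vs @ (a *\<^sub>R v + b *\<^sub>R w) # ws) =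
      fps_const a * coord_d A x (vs @ v # ws) + fps_const b * coord_d A x (vs @ w # ws)" for vs ws a b v w
  proof (cases "length vs + length ws = k")
    case True
    then consider "vs = []" "ws = []" | u where "vs = []" "ws = [u]" | u where "vs = [u]" "ws = []"
      | u u' where "vs = []" "ws = [u, u']" | u u' where "vs = [u]" "ws = [u']"
      | u u' where "vs = [u, u']" "ws = []"
      using k by (cases vs rule: remdups_adj.cases; cases ws rule: remdups_adj.cases) auto
    then show ?thesis
      by cases (simp_all add: coord_d_1 coord_d_2 coord_d_3 l1 l2', simp_all add: algebra_simps)
  next
    case False
    then show ?thesis by (simp add: len)
  qed
  show ?thesis
    unfolding alt_form_iff alternating_def using len alt lin by blast
qed

text \<open>
  Differentiating \<open>\<psi>\<^sup>*B\<close> gives \<open>\<psi>\<^sup>*dB\<close> and terms that contain second derivatives of \<open>\<psi>\<close>.  These are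
  symmetric in two arguments in which the formula is antisymmetric, and cancel.
\<close>

lemma coord_d_pullback:
  assumes N: "open N" "x \<in> N" and \<psi>: "smooth_on N \<psi>"
    and A: "\<And>y. y \<in> N \<Longrightarrow> A y = pullback (frechet_derivative \<psi> (at y)) (B (\<psi> y))"
    and B: "\<And>y. y \<in> N \<Longrightarrow> alt_form k (B (\<psi> y))"
    and dB: "\<And>vs. diff_fps (\<lambda>z. B z vs) (\<psi> x)" and dA: "\<And>vs. diff_fps (\<lambda>y. A y vs) x"
    and B': "open N'" "\<psi> x \<in> N'" "\<And>z. z \<in> N' \<Longrightarrow> alt_form k (B z)"
    and k: "k \<le> 2"
  shows "coord_d A x = pullback (frechet_derivative \<psi> (at x)) (coord_d B (\<psi> x))"
proof -
  \<comment> \<open>First and second derivatives of the coordinate change.\<close>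
  define P where "P w y = frechet_derivative \<psi> (at y) w" for w y
  define Q where "Q w v = frechet_derivative (P w) (at x) v" for w v
  have \<psi>d: "(\<psi> has_derivative (\<lambda>v. P v x)) (at x)"
    unfolding P_def using smooth_on_has_derivative[OF \<psi> N(2)] by (simp add: eta_contract_eq)
  have Pd: "(P w has_derivative Q w) (at x)" for w
    unfolding Q_def P_def using smooth_on_has_derivative[OF smooth_on_deriv[OF \<psi>] N(2)] .
  have Pdi: "((\<lambda>y. P w y $ i) has_derivative (\<lambda>v. Q w v $ i)) (at x)" for w i
    using Pd[of w] by (rule bounded_linear.has_derivative[OF bounded_linear_vec_nth])
  have Qs: "Q v w = Q w v" for v w
  proof -
    have "Q v w $ i = Q w v $ i" for i
    proof -
      let ?f = "\<lambda>y. \<psi> y $ i"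
      have f: "smooth_on N ?f" by (rule smooth_on_linear[OF N(1) bounded_linear_vec_nth \<psi>])
      have e: "P w y $ i = frechet_derivative ?f (at y) w" if "y \<in> N" for y w
      proof -
        have "(?f has_derivative (\<lambda>v. frechet_derivative \<psi> (at y) v $ i)) (at y)"
          by (rule bounded_linear.has_derivative[OF bounded_linear_vec_nth smooth_on_has_derivative[OF \<psi> that]])
        then show ?thesis unfolding P_def using frechet_derivative_at by metis
      qed
      have q: "Q w v $ i = frechet_derivative (\<lambda>y. frechet_derivative ?f (at y) w) (at x) v" for v w
      proof -
        have "((\<lambda>y. frechet_derivative ?f (at y) w) has_derivative (\<lambda>v. Q w v $ i)) (at x)"
          by (rule has_derivative_transform_within_open[OF Pdi[of w i] N]) (rule e)
        then show ?thesis using frechet_derivative_at by metis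
      qed
      have "Ck_on 2 N ?f" using f by (simp add: smooth_on_def)
      then show ?thesis unfolding q using second_derivative_symmetric[OF N] by blast
    qed
    then show ?thesis by (simp add: vec_eq_iff)
  qed
  have pv: "pullback (frechet_derivative \<psi> (at y)) \<alpha> vs = \<alpha> (map (\<lambda>v. P v y) vs)" for \<alpha> y vs
    by (simp add: pullback_def P_def)
  have Ay: "A y vs = B (\<psi> y) (map (\<lambda>v. P v y) vs)" if "y \<in> N" for y vs
    unfolding A[OF that] pv ..
  have altA: "alt_form k (A y)" if "y \<in> N" for y
  proof -
    have "linear (frechet_derivative \<psi> (at y))"
      using smooth_on_has_derivative[OF \<psi> that] by (rule has_derivative_linear)
    then show ?thesis unfolding A[OF that] using B[OF that] by (rule alt_form_pullback)
  qed
  note dBc = dir_deriv_compose[OF \<psi>d dB] 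
  note fBc = diff_fps_compose[OF \<psi>d dB]
  note dP = dir_deriv_fps_const[OF Pdi]
  note fP = diff_fps_fps_const[OF Pdi]
  show ?thesis
  proof
    fix vs
    show "coord_d A x vs = pullback (frechet_derivative \<psi> (at x)) (coord_d B (\<psi> x)) vs"
    proof (cases "length vs = Suc k")
      case False
      then show ?thesis
        using coord_d_length[OF N altA False] coord_d_length[OF B', where vs = "map (\<lambda>v. P v x) vs"]
        by (simp add: pv)
    next
      case len: True
      consider "k = 0" | "k = 1" | "k = 2" using k by linarith
      then show ?thesis
      proof cases
        case 1
        then obtain v where vs: "vs = [v]" using len by (auto simp: length_Suc_conv)
        have "dir_deriv (\<lambda>y. A y []) x v = dir_deriv (\<lambda>y. B (\<psi> y) []) x v"
          by (rule dir_deriv_cong[OF N _ dA]) (simp add: Ay)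
        then show ?thesis unfolding vs pv by (simp add: coord_d_1 dBc)
      next
        case 2
        then obtain v w where vs: "vs = [v, w]" using len by (auto simp: length_Suc_conv)
        \<comment> \<open>The components of B and their derivatives in direction u.\<close>
        define b where "b i z = B z [axis i 1]" for i z
        define d where "d i u = dir_deriv (b i) (\<psi> x) u" for i u
        have fb: "diff_fps (\<lambda>y. b i (\<psi> y)) x" for i unfolding b_def by (rule fBc)
        have db: "dir_deriv (\<lambda>y. b i (\<psi> y)) x v = d i (P v x)" for i v
          unfolding d_def b_def by (rule dBc)
        have e1: "B z [u] = b 1 z * fps_const (u$1) + b 2 z * fps_const (u$2) + b 3 z * fps_const (u$3)"
          if "alt_form 1 (B z)" for z u
        proof -
          have "B z [u] = F1 (comp1 (B z)) [u]" using alt_form_1_eq[OF that] by simp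
          then show ?thesis by (simp add: comp1_def b_def)
        qed
        have D: "dir_deriv (\<lambda>y. A y [w]) x v =
            d 1 (P v x) * fps_const (P w x $ 1) + b 1 (\<psi> x) * fps_const (Q w v $ 1)
          + (d 2 (P v x) * fps_const (P w x $ 2) + b 2 (\<psi> x) * fps_const (Q w v $ 2))
          + (d 3 (P v x) * fps_const (P w x $ 3) + b 3 (\<psi> x) * fps_const (Q w v $ 3))" for v w
        proof -
          have "dir_deriv (\<lambda>y. A y [w]) x v = dir_deriv (\<lambda>y. b 1 (\<psi> y) * fps_const (P w y $ 1)
              + b 2 (\<psi> y) * fps_const (P w y $ 2) + b 3 (\<psi> y) * fps_const (P w y $ 3)) x v"
            by (rule dir_deriv_cong[OF N _ dA], simp only: Ay list.map, rule e1) (use B 2 in simp)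
          then show ?thesis
            by (simp only: dir_deriv_add dir_deriv_mult diff_fps_add diff_fps_mult fb fP db dP)
        qed
        have DB: "dir_deriv (\<lambda>z. B z [u]) (\<psi> x) u' =
            d 1 u' * fps_const (u $ 1) + d 2 u' * fps_const (u $ 2) + d 3 u' * fps_const (u $ 3)" for u u'
        proof -
          have "dir_deriv (\<lambda>z. B z [u]) (\<psi> x) u' = dir_deriv (\<lambda>z. b 1 z * fps_const (u$1)
              + b 2 z * fps_const (u$2) + b 3 z * fps_const (u$3)) (\<psi> x) u'"
            by (rule dir_deriv_cong[OF B'(1,2) _ dB]) (rule e1, use B'(3) 2 in simp)
          moreover have "diff_fps (b i) (\<psi> x)" for i unfolding b_def by (rule dB)
          ultimately show ?thesis
            by (simp add: dir_deriv_add dir_deriv_mult diff_fps_add diff_fps_mult diff_fps_const dir_deriv_const d_def)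
        qed
        show ?thesis
          unfolding vs pv list.map coord_d_2 D DB Qs[of v w] by (simp only: algebra_simps)
      next
        case 3
        then obtain u v w where vs: "vs = [u, v, w]" using len by (auto simp: length_Suc_conv numeral_2_eq_2)
        \<comment> \<open>The components of B and their derivatives in direction u.\<close>
        define b where "b i z = comp2 (B z) $ i" for i z
        define d where "d i u = dir_deriv (b i) (\<psi> x) u" for i u
        have bd: "diff_fps (b i) (\<psi> x)" for i
        proof -
          have "b i = (\<lambda>z. comp2 (B z) $ i)" for i by (simp add: b_def fun_eq_iff)
          then have "\<forall>i. diff_fps (b i) (\<psi> x)" by (simp add: forall_3 comp2_def dB)
          then show ?thesis by blast
        qed
        have fb: "diff_fps (\<lambda>y. b i (\<psi> y)) x" for i by (rule diff_fps_compose[OF \<psi>d bd])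
        have db: "dir_deriv (\<lambda>y. b i (\<psi> y)) x v = d i (P v x)" for i v
          unfolding d_def by (rule dir_deriv_compose[OF \<psi>d bd])
        have e2: "B z [p, q] = b 1 z * (fps_const (p$2) * fps_const (q$3) + (-1) * (fps_const (p$3) * fps_const (q$2)))
            + b 2 z * (fps_const (p$3) * fps_const (q$1) + (-1) * (fps_const (p$1) * fps_const (q$3)))
            + b 3 z * (fps_const (p$1) * fps_const (q$2) + (-1) * (fps_const (p$2) * fps_const (q$1)))"
          if "alt_form 2 (B z)" for z p q
        proof -
          have "B z [p, q] = F2 (comp2 (B z)) [p, q]" using alt_form_2_eq[OF that] by simp
          then show ?thesis by (simp add: b_def)
        qed
        let ?k = "fps_const :: real \<Rightarrow> real fps"
        have D: "dir_deriv (\<lambda>y. A y [w', w]) x v =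
             d 1 (P v x) * (?k (P w' x $ 2) * ?k (P w x $ 3) + (-1) * (?k (P w' x $ 3) * ?k (P w x $ 2)))
             + b 1 (\<psi> x) * (?k (Q w' v $ 2) * ?k (P w x $ 3) + ?k (P w' x $ 2) * ?k (Q w v $ 3)
                + (-1) * (?k (Q w' v $ 3) * ?k (P w x $ 2) + ?k (P w' x $ 3) * ?k (Q w v $ 2)))
           + (d 2 (P v x) * (?k (P w' x $ 3) * ?k (P w x $ 1) + (-1) * (?k (P w' x $ 1) * ?k (P w x $ 3)))
             + b 2 (\<psi> x) * (?k (Q w' v $ 3) * ?k (P w x $ 1) + ?k (P w' x $ 3) * ?k (Q w v $ 1)
                + (-1) * (?k (Q w' v $ 1) * ?k (P w x $ 3) + ?k (P w' x $ 1) * ?k (Q w v $ 3))))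
           + (d 3 (P v x) * (?k (P w' x $ 1) * ?k (P w x $ 2) + (-1) * (?k (P w' x $ 2) * ?k (P w x $ 1)))
             + b 3 (\<psi> x) * (?k (Q w' v $ 1) * ?k (P w x $ 2) + ?k (P w' x $ 1) * ?k (Q w v $ 2)
                + (-1) * (?k (Q w' v $ 2) * ?k (P w x $ 1) + ?k (P w' x $ 2) * ?k (Q w v $ 1))))" for v w w'
        proof -
          have "dir_deriv (\<lambda>y. A y [w', w]) x v = dir_deriv (\<lambda>y.
              b 1 (\<psi> y) * (?k (P w' y$2) * ?k (P w y$3) + (-1) * (?k (P w' y$3) * ?k (P w y$2)))
            + b 2 (\<psi> y) * (?k (P w' y$3) * ?k (P w y$1) + (-1) * (?k (P w' y$1) * ?k (P w y$3)))
            + b 3 (\<psi> y) * (?k (P w' y$1) * ?k (P w y$2) + (-1) * (?k (P w' y$2) * ?k (P w y$1)))) x v"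
          proof (rule dir_deriv_cong[OF N _ dA])
            fix y assume y: "y \<in> N"
            show "A y [w', w] = b 1 (\<psi> y) * (?k (P w' y$2) * ?k (P w y$3) + (-1) * (?k (P w' y$3) * ?k (P w y$2)))
            + b 2 (\<psi> y) * (?k (P w' y$3) * ?k (P w y$1) + (-1) * (?k (P w' y$1) * ?k (P w y$3)))
            + b 3 (\<psi> y) * (?k (P w' y$1) * ?k (P w y$2) + (-1) * (?k (P w' y$2) * ?k (P w y$1)))"
              unfolding Ay[OF y] list.map by (rule e2) (use B[OF y] 3 in simp)
          qed
          then show ?thesis
            by (simp only: dir_deriv_add dir_deriv_mult dir_deriv_const diff_fps_add diff_fps_mult diff_fps_const
                fb fP db dP mult_zero_left add_0_left)
        qed
        have DB: "dir_deriv (\<lambda>z. B z [p, q]) (\<psi> x) v =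
              d 1 v * (?k (p$2) * ?k (q$3) + (-1) * (?k (p$3) * ?k (q$2)))
            + d 2 v * (?k (p$3) * ?k (q$1) + (-1) * (?k (p$1) * ?k (q$3)))
            + d 3 v * (?k (p$1) * ?k (q$2) + (-1) * (?k (p$2) * ?k (q$1)))" for p q v
        proof -
          have "dir_deriv (\<lambda>z. B z [p, q]) (\<psi> x) v = dir_deriv (\<lambda>z.
              b 1 z * (?k (p$2) * ?k (q$3) + (-1) * (?k (p$3) * ?k (q$2)))
            + b 2 z * (?k (p$3) * ?k (q$1) + (-1) * (?k (p$1) * ?k (q$3)))
            + b 3 z * (?k (p$1) * ?k (q$2) + (-1) * (?k (p$2) * ?k (q$1)))) (\<psi> x) v"
            by (rule dir_deriv_cong[OF B'(1,2) _ dB]) (rule e2, use B'(3) 3 in simp)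
          then show ?thesis
            by (simp only: dir_deriv_add dir_deriv_mult diff_fps_add diff_fps_mult diff_fps_const dir_deriv_const
                bd d_def mult_zero_right add_0_right)
        qed
        show ?thesis
          unfolding vs pv list.map coord_d_3 D DB Qs[of v u] Qs[of w u] Qs[of w v]
          by (simp add: algebra_simps del: fps_const_mult fps_const_add fps_const_sub fps_const_neg)
      qed
    qed
  qed
qed

text \<open>
  Again by symmetry of second derivatives.
\<close>

lemma coord_d_coord_d:
  assumes N: "open N" "x \<in> N" and sm: "\<And>vs. smooth_fps N (\<lambda>y. A y vs)"
    and A: "\<And>y. y \<in> N \<Longrightarrow> alt_form k (A y)" and k: "k \<le> 1"
  shows "coord_d (coord_d A) x vs = 0"
proof (cases "length vs = Suc (Suc k)")
  case False
  have "alt_form (Suc k) (coord_d A y)" if "y \<in> N" for y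
    using A k by (intro alt_form_coord_d[OF N(1) that]) (auto intro: smooth_fps_diff_fps[OF sm that])
  then show ?thesis using coord_d_length[OF N _ False] by blast
next
  case True
  have sy: "dir_deriv (\<lambda>y. dir_deriv (\<lambda>y. A y us) y v) x w = dir_deriv (\<lambda>y. dir_deriv (\<lambda>y. A y us) y w) x v"
    for us v w by (rule dir_deriv_symmetric[OF N sm])
  have fd: "diff_fps (\<lambda>y. dir_deriv (\<lambda>y. A y us) y v) x" for us v
    by (rule smooth_fps_diff_fps[OF smooth_fps_dir_deriv[OF sm] N(2)])
  have dd: "dir_deriv (\<lambda>y. dir_deriv (\<lambda>y. A y us) y v - dir_deriv (\<lambda>y. A y us') y v') x w =
      dir_deriv (\<lambda>y. dir_deriv (\<lambda>y. A y us) y v) x w - dir_deriv (\<lambda>y. dir_deriv (\<lambda>y. A y us') y v') x w"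
    for us v us' v' w
  proof -
    have "dir_deriv (\<lambda>y. dir_deriv (\<lambda>y. A y us) y v + (-1) * dir_deriv (\<lambda>y. A y us') y v') x w =
      dir_deriv (\<lambda>y. dir_deriv (\<lambda>y. A y us) y v) x w + (-1) * dir_deriv (\<lambda>y. dir_deriv (\<lambda>y. A y us') y v') x w"
      by (simp only: dir_deriv_add dir_deriv_mult dir_deriv_const diff_fps_mult diff_fps_const fd mult_zero_left add_0_left)
    then show ?thesis by simp
  qed
  consider "k = 0" | "k = 1" using k by linarith
  then show ?thesis
  proof cases
    case 1
    then obtain v w where "vs = [v, w]" using True by (auto simp: length_Suc_conv)
    then show ?thesis using sy[of "[]" v w] by (simp add: coord_d_1 coord_d_2)
  next
    case 2
    then obtain u v w where "vs = [u, v, w]" using True by (auto simp: length_Suc_conv)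
    then show ?thesis using sy[of "[u]" v w] sy[of "[v]" u w] sy[of "[w]" u v] by (simp add: coord_d_2 coord_d_3 dd)
  qed
qed

lemma coord_d_scale:
  assumes "diff_fps f x" "\<And>vs. diff_fps (\<lambda>y. A y vs) x"
  shows "coord_d (\<lambda>y vs. f y * A y vs) x vs = wedge_alt (coord_d (\<lambda>y. F0 (f y)) x) (A x) vs + f x * coord_d A x vs"
proof -
  have one: "coord_d (\<lambda>y. F0 (f y)) x vs = (if length vs = 1 then dir_deriv f x (vs ! 0) else 0)" for vs
  proof (cases "length vs = 1")
    case True
    then obtain v where "vs = [v]" by (auto simp: length_Suc_conv)
    then show ?thesis by (simp add: coord_d_1)
  next
    case False
    then show ?thesis using coord_d_length[of UNIV x 0 "\<lambda>y. F0 (f y)" vs] alt_form_F0 by simp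
  qed
  have "wedge_alt (coord_d (\<lambda>y. F0 (f y)) x) (A x) vs =
      (\<Sum>i<length vs. (-1) ^ i * dir_deriv f x (vs ! i) * A x (take i vs @ drop (Suc i) vs))"
    by (subst wedge_alt_one_form) (simp_all add: one)
  then show ?thesis
    by (simp add: coord_d_def dir_deriv_mult assms algebra_simps sum.distrib sum_distrib_left)
qed

section \<open>Forms on the manifold in charts\<close>

lemma smooth_fps_F:
  assumes "open S"
  shows "smooth_fps S f \<Longrightarrow> smooth_fps S (\<lambda>x. F0 (f x) vs)"
    and "(\<And>i. smooth_fps S (\<lambda>x. a x $ i)) \<Longrightarrow> smooth_fps S (\<lambda>x. F1 (a x) vs)"
    and "(\<And>i. smooth_fps S (\<lambda>x. a x $ i)) \<Longrightarrow> smooth_fps S (\<lambda>x. F2 (a x) vs)"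
    and "smooth_fps S f \<Longrightarrow> smooth_fps S (\<lambda>x. F3 (f x) vs)"
  subgoal by (cases vs) (simp_all add: smooth_fps_const[OF assms])
  subgoal by (cases "(comp1 (\<lambda>_. 0), vs)" rule: F1.cases)
      (auto intro!: smooth_fps_const smooth_fps_add smooth_fps_mult assms)
  subgoal by (cases "(comp1 (\<lambda>_. 0), vs)" rule: F2.cases)
      (auto intro!: smooth_fps_const smooth_fps_add smooth_fps_mult assms)
  subgoal by (cases "(0 :: real fps, vs)" rule: F3.cases)
      (auto intro!: smooth_fps_const smooth_fps_mult assms)
  done

lemma smooth_fps_mat_act:
  assumes "open S" "\<And>i j. smooth_on S (\<lambda>x. A x $ i $ j)" "\<And>i. smooth_fps S (\<lambda>x. a x $ i)"
  shows "smooth_fps S (\<lambda>x. mat_act (A x) (a x) $ i)"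
  unfolding mat_act_def vec_lambda_beta by (intro smooth_fps_add smooth_fps_mult smooth_fps_fps_const assms)

lemma smooth_fps_c:
  assumes "\<And>vs. smooth_fps S (\<lambda>x. A x vs)"
  shows "smooth_fps S (\<lambda>x. comp1 (A x) $ i)" "smooth_fps S (\<lambda>x. comp2 (A x) $ i)" "smooth_fps S (\<lambda>x. comp3 (A x))"
proof -
  have "\<forall>i. smooth_fps S (\<lambda>x. comp1 (A x) $ i)" by (simp add: forall_3 comp1_def assms)
  then show "smooth_fps S (\<lambda>x. comp1 (A x) $ i)" by blast
  have "\<forall>i. smooth_fps S (\<lambda>x. comp2 (A x) $ i)" by (simp add: forall_3 comp2_def assms)
  then show "smooth_fps S (\<lambda>x. comp2 (A x) $ i)" by blast
  show "smooth_fps S (\<lambda>x. comp3 (A x))" by (simp add: comp3_def assms)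
qed

lemma smooth_cofactors:
  assumes S: "open S" and A: "\<And>i j. smooth_on S (\<lambda>x. A x $ i $ j)"
  shows "smooth_on S (\<lambda>x. cofactors (A x) $ i $ j)"
proof -
  have "\<forall>i j. smooth_on S (\<lambda>x. cofactors (A x) $ i $ j)"
    unfolding cofactors_def forall_3 vector_3 by (intro conjI smooth_on_diff smooth_on_mult S A)
  then show ?thesis by blast
qed

lemma smooth_det3:
  fixes A :: "'a::real_normed_vector \<Rightarrow> real^3^3"
  assumes S: "open S" and A: "\<And>i j. smooth_on S (\<lambda>x. A x $ i $ j)"
  shows "smooth_on S (\<lambda>x. det (A x))"
  unfolding det_3 by (intro smooth_on_diff smooth_on_add smooth_on_mult S A)

lemma hodge_alt_eq:
  assumes g: "inner_product g"
  shows "alt_form 0 \<alpha> \<Longrightarrow> hodge_alt g 0 \<alpha> = F3 (fps_const (vol g) * \<alpha> [])"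
    and "alt_form 1 \<alpha> \<Longrightarrow> hodge_alt g 1 \<alpha> = F2 (mat_act (vol g *\<^sub>R dual_gram g) (comp1 \<alpha>))"
    and "alt_form 2 \<alpha> \<Longrightarrow> hodge_alt g 2 \<alpha> = F1 (mat_act (vol g *\<^sub>R cofactors (dual_gram g)) (comp2 \<alpha>))"
    and "alt_form 3 \<alpha> \<Longrightarrow> hodge_alt g 3 \<alpha> = F0 (fps_const (vol g * det (dual_gram g)) * comp3 \<alpha>)"
  using arg_cong[OF alt_form_0_eq, of \<alpha> "hodge_alt g 0"] arg_cong[OF alt_form_1_eq, of \<alpha> "hodge_alt g 1"]
    arg_cong[OF alt_form_2_eq, of \<alpha> "hodge_alt g 2"] arg_cong[OF alt_form_3_eq, of \<alpha> "hodge_alt g 3"]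
  unfolding hodge_alt_F[OF g] by blast+

lemma smooth_dual_gram:
  assumes S: "open S" and ip: "\<And>x. x \<in> S \<Longrightarrow> inner_product (G x)"
    and G: "\<And>v w. smooth_on S (\<lambda>x. G x v w)"
  shows "smooth_on S (\<lambda>x. vol (G x))" "smooth_on S (\<lambda>x. dual_gram (G x) $ i $ j)"
proof -
  have g: "smooth_on S (\<lambda>x. gram (G x) $ i $ j)" for i j by (simp add: gram_def G)
  have pos: "det (gram (G x)) > 0" if "x \<in> S" for x using ip[OF that] by (rule det_gram_pos)
  show "smooth_on S (\<lambda>x. vol (G x))"
    unfolding vol_def by (intro smooth_on_sqrt smooth_det3 S g pos)
  have "smooth_on S (\<lambda>x. inverse (det (gram (G x))) * cofactors (gram (G x)) $ i $ j)"
    using pos[THEN less_imp_neq, THEN not_sym]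
    by (intro smooth_on_mult smooth_on_inverse smooth_det3 smooth_cofactors S g) simp
  then show "smooth_on S (\<lambda>x. dual_gram (G x) $ i $ j)" by (simp add: dual_gram_def inverse_eq_divide)
qed

text \<open>
  The formulas in components involve only rational operations on the metric coefficients and the
  square root of their positive determinant.
\<close>

lemma smooth_hodge_alt:
  assumes S: "open S" and ip: "\<And>x. x \<in> S \<Longrightarrow> inner_product (G x)"
    and G: "\<And>v w. smooth_on S (\<lambda>x. G x v w)"
    and A: "\<And>x. x \<in> S \<Longrightarrow> alt_form k (A x)" and sA: "\<And>vs. smooth_fps S (\<lambda>x. A x vs)" and k: "k \<le> 3"
  shows "smooth_fps S (\<lambda>x. hodge_alt (G x) k (A x) vs)"
proof -
  note v = smooth_dual_gram(1)[OF S ip G] and h = smooth_dual_gram(2)[OF S ip G]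
  have H1: "smooth_on S (\<lambda>x. (vol (G x) *\<^sub>R dual_gram (G x)) $ i $ j)" for i j
    using smooth_on_mult[OF S v h[of i j]] by simp
  have H2: "smooth_on S (\<lambda>x. (vol (G x) *\<^sub>R cofactors (dual_gram (G x))) $ i $ j)" for i j
    using smooth_on_mult[OF S v smooth_cofactors[OF S h, of i j]] by simp
  have H3: "smooth_on S (\<lambda>x. vol (G x) * det (dual_gram (G x)))"
    by (intro smooth_on_mult S v smooth_det3 h)
  consider "k = 0" | "k = 1" | "k = 2" | "k = 3" using k by linarith
  then show ?thesis
  proof cases
    case 1
    have e: "hodge_alt (G x) k (A x) vs = F3 (fps_const (vol (G x)) * A x []) vs" if "x \<in> S" for x
      unfolding 1 using hodge_alt_eq(1)[OF ip[OF that] A[OF that, unfolded 1]] by (rule fun_cong)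
    have f: "smooth_fps S (\<lambda>x. F3 (fps_const (vol (G x)) * A x []) vs)"
      by (intro smooth_fps_F(4)[OF S] smooth_fps_mult smooth_fps_fps_const S v sA)
    show ?thesis by (rule smooth_fps_cong[OF S e[symmetric] f])
  next
    case 2
    have e: "hodge_alt (G x) k (A x) vs = F2 (mat_act (vol (G x) *\<^sub>R dual_gram (G x)) (comp1 (A x))) vs" if "x \<in> S" for x
      unfolding 2 using hodge_alt_eq(2)[OF ip[OF that] A[OF that, unfolded 2]] by (rule fun_cong)
    have f: "smooth_fps S (\<lambda>x. F2 (mat_act (vol (G x) *\<^sub>R dual_gram (G x)) (comp1 (A x))) vs)"
      by (intro smooth_fps_F(3)[OF S] smooth_fps_mat_act S H1 smooth_fps_c sA)
    show ?thesis by (rule smooth_fps_cong[OF S e[symmetric] f])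
  next
    case 3
    have e: "hodge_alt (G x) k (A x) vs = F1 (mat_act (vol (G x) *\<^sub>R cofactors (dual_gram (G x))) (comp2 (A x))) vs" if "x \<in> S" for x
      unfolding 3 using hodge_alt_eq(3)[OF ip[OF that] A[OF that, unfolded 3]] by (rule fun_cong)
    have f: "smooth_fps S (\<lambda>x. F1 (mat_act (vol (G x) *\<^sub>R cofactors (dual_gram (G x))) (comp2 (A x))) vs)"
      by (intro smooth_fps_F(2)[OF S] smooth_fps_mat_act S H2 smooth_fps_c sA)
    show ?thesis by (rule smooth_fps_cong[OF S e[symmetric] f])
  next
    case 4
    have e: "hodge_alt (G x) k (A x) vs = F0 (fps_const (vol (G x) * det (dual_gram (G x))) * comp3 (A x)) vs" if "x \<in> S" for x
      unfolding 4 using hodge_alt_eq(4)[OF ip[OF that] A[OF that, unfolded 4]] by (rule fun_cong)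
    have f: "smooth_fps S (\<lambda>x. F0 (fps_const (vol (G x) * det (dual_gram (G x))) * comp3 (A x)) vs)"
      by (intro smooth_fps_F(1)[OF S] smooth_fps_mult smooth_fps_fps_const S H3 smooth_fps_c sA)
    show ?thesis by (rule smooth_fps_cong[OF S e[symmetric] f])
  qed
qed

locale riemannian_3manifold =
  fixes M :: "('m::t2_space, 'z) riem_manifold_scheme"
  assumes manifold: "closed_oriented_riemannian_3manifold M"
begin

lemma atlas: "oriented_smooth_atlas (charts M)"
  using manifold unfolding closed_oriented_riemannian_3manifold_def by blast

lemma ip_metric: "inner_product (metric M p)"
  using manifold unfolding closed_oriented_riemannian_3manifold_def riemannian_metric_def inner_product_def
  by blast

lemma smooth_metric: "c \<in> charts M \<Longrightarrow> smooth_on (snd c ` fst c) (\<lambda>x. local_metric M c x v w)"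
  using manifold unfolding closed_oriented_riemannian_3manifold_def riemannian_metric_def by blast

lemma chart_at: "chart_at M p \<in> charts M" "p \<in> fst (chart_at M p)"
proof -
  have "\<exists>c. c \<in> charts M \<and> p \<in> fst c" using atlas unfolding oriented_smooth_atlas_def by blast
  then have "chart_at M p \<in> charts M \<and> p \<in> fst (chart_at M p)" unfolding chart_at_def by (rule someI_ex)
  then show "chart_at M p \<in> charts M" "p \<in> fst (chart_at M p)" by blast+
qed

lemma open_chart: "c \<in> charts M \<Longrightarrow> open (fst c)" "c \<in> charts M \<Longrightarrow> open (snd c ` fst c)"
  using atlas unfolding oriented_smooth_atlas_def by blast+

lemma chart_homeo: "c \<in> charts M \<Longrightarrow> homeomorphism (fst c) (snd c ` fst c) (snd c) (chart_inv c)"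
  using atlas unfolding oriented_smooth_atlas_def by blast

lemma chart_inv_left: "c \<in> charts M \<Longrightarrow> p \<in> fst c \<Longrightarrow> chart_inv c (snd c p) = p"
  using chart_homeo unfolding homeomorphism_def by blast

lemma chart_inv_right: "c \<in> charts M \<Longrightarrow> x \<in> snd c ` fst c \<Longrightarrow> snd c (chart_inv c x) = x"
  using chart_homeo unfolding homeomorphism_def by blast

lemma chart_inv_in: "c \<in> charts M \<Longrightarrow> x \<in> snd c ` fst c \<Longrightarrow> chart_inv c x \<in> fst c"
  by (erule imageE) (simp add: chart_inv_left)

lemma open_chart_image:
  assumes c: "c \<in> charts M" and V: "open V"
  shows "open (snd c ` (fst c \<inter> V))"
proof -
  have "openin (top_of_set (fst c)) (fst c \<inter> V)" using V by (simp add: openin_open_Int)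
  then have "openin (top_of_set (snd c ` fst c)) (snd c ` (fst c \<inter> V))"
    using homeomorphism_imp_open_map[OF chart_homeo[OF c]] by blast
  then show ?thesis using open_chart(2)[OF c] openin_open_trans by blast
qed

lemma smooth_transition:
  "c \<in> charts M \<Longrightarrow> d \<in> charts M \<Longrightarrow> smooth_on (snd c ` (fst c \<inter> fst d)) (snd d \<circ> chart_inv c)"
  using atlas unfolding oriented_smooth_atlas_def by blast

lemma jac_derivative:
  assumes "c \<in> charts M" "d \<in> charts M" "p \<in> fst c" "p \<in> fst d"
  shows "((snd d \<circ> chart_inv c) has_derivative jac c d p) (at (snd c p))"
  unfolding jac_def using smooth_on_has_derivative[OF smooth_transition[OF assms(1,2)]] assms by blast

lemma linear_jac:
  assumes "c \<in> charts M" "d \<in> charts M" "p \<in> fst c" "p \<in> fst d"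
  shows "linear (jac c d p)"
  using jac_derivative[OF assms] by (rule has_derivative_linear)

lemma det_jac:
  assumes "c \<in> charts M" "d \<in> charts M" "p \<in> fst c" "p \<in> fst d"
  shows "det (matrix (jac c d p)) > 0"
  using atlas assms unfolding oriented_smooth_atlas_def by blast

lemma jac_id:
  assumes c: "c \<in> charts M" "p \<in> fst c"
  shows "jac c c p = (\<lambda>v. v)"
proof -
  have "((\<lambda>x. x) has_derivative jac c c p) (at (snd c p))"
    by (rule has_derivative_transform_within_open[OF jac_derivative[OF c(1) c(1) c(2) c(2)] open_chart(2)[OF c(1)]])
      (use c chart_inv_right in auto)
  then show ?thesis using has_derivative_unique has_derivative_ident by blast
qed

text \<open>
  The chain rule; it makes the value of a form in a chart independent of the chart that was chosen
  to identify the tangent space.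
\<close>

lemma jac_chain:
  assumes cde: "c \<in> charts M" "d \<in> charts M" "e \<in> charts M" and p: "p \<in> fst c" "p \<in> fst d" "p \<in> fst e"
  shows "jac d e p (jac c d p v) = jac c e p v"
proof -
  have "(snd d \<circ> chart_inv c) (snd c p) = snd d p" using chart_inv_left[OF cde(1) p(1)] by simp
  then have "((\<lambda>x. (snd e \<circ> chart_inv d) ((snd d \<circ> chart_inv c) x)) has_derivative
      (\<lambda>v. jac d e p (jac c d p v))) (at (snd c p))"
    using has_derivative_compose[OF jac_derivative[OF cde(1,2) p(1,2)], of "snd e \<circ> chart_inv d" "jac d e p"]
      jac_derivative[OF cde(2,3) p(2,3)] by simp
  moreover have "open (snd c ` (fst c \<inter> fst d))" by (rule open_chart_image[OF cde(1) open_chart(1)[OF cde(2)]])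
  ultimately have "((snd e \<circ> chart_inv c) has_derivative (\<lambda>v. jac d e p (jac c d p v))) (at (snd c p))"
    by (rule has_derivative_transform_within_open)
      (use p chart_inv_left[OF cde(1)] chart_inv_left[OF cde(2)] in auto)
  then have "(\<lambda>v. jac d e p (jac c d p v)) = jac c e p"
    using jac_derivative[OF cde(1,3) p(1,3)] by (rule has_derivative_unique)
  then show ?thesis by (rule fun_cong)
qed

lemma local_form_pullback:
  "local_form M c \<omega> x = pullback (jac c (chart_at M (chart_inv c x)) (chart_inv c x)) (\<omega> (chart_inv c x))"
  by (simp add: fun_eq_iff local_form_def pullback_def Let_def)

lemma local_metric_pullback:
  "local_metric M c x = pullback_ip (jac c (chart_at M (chart_inv c x)) (chart_inv c x)) (metric M (chart_inv c x))"
  by (simp add: fun_eq_iff local_metric_def pullback_ip_def Let_def)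

lemma local_form_change:
  assumes ch: "c \<in> charts M" "d \<in> charts M" and p: "p \<in> fst c" "p \<in> fst d"
  shows "local_form M c \<omega> (snd c p) = pullback (jac c d p) (local_form M d \<omega> (snd d p))"
  using jac_chain[OF ch chart_at(1) p chart_at(2)]
  by (simp add: fun_eq_iff local_form_pullback pullback_def chart_inv_left[OF ch(1) p(1)]
      chart_inv_left[OF ch(2) p(2)] o_def)

lemma local_form_own: "local_form M (chart_at M p) \<omega> (snd (chart_at M p) p) = \<omega> p"
  by (simp add: fun_eq_iff local_form_pullback pullback_def chart_inv_left[OF chart_at] jac_id[OF chart_at])

lemma jac_facts:
  assumes "c \<in> charts M" "x \<in> snd c ` fst c"
  shows "linear (jac c (chart_at M (chart_inv c x)) (chart_inv c x))"
    "det (matrix (jac c (chart_at M (chart_inv c x)) (chart_inv c x))) > 0"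
    "inj (jac c (chart_at M (chart_inv c x)) (chart_inv c x))"
proof -
  note a = assms(1) chart_at(1)[of "chart_inv c x"] chart_inv_in[OF assms] chart_at(2)[of "chart_inv c x"]
  show l: "linear (jac c (chart_at M (chart_inv c x)) (chart_inv c x))" by (rule linear_jac[OF a])
  show d: "det (matrix (jac c (chart_at M (chart_inv c x)) (chart_inv c x))) > 0" by (rule det_jac[OF a])
  then show "inj (jac c (chart_at M (chart_inv c x)) (chart_inv c x))"
    using det_nz_iff_inj[OF l] by simp
qed

lemma alt_form_local:
  assumes "c \<in> charts M" "x \<in> snd c ` fst c" "\<And>p. alt_form k (\<omega> p)"
  shows "alt_form k (local_form M c \<omega> x)"
  unfolding local_form_pullback by (rule alt_form_pullback[OF jac_facts(1)[OF assms(1,2)] assms(3)])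

lemma ip_local: "c \<in> charts M \<Longrightarrow> x \<in> snd c ` fst c \<Longrightarrow> inner_product (local_metric M c x)"
  unfolding local_metric_pullback using inner_product_pullback[OF ip_metric] jac_facts by blast

lemma smooth_form_iff:
  "smooth_form M k \<omega> \<longleftrightarrow> (\<forall>p. alt_form k (\<omega> p)) \<and>
     (\<forall>c\<in>charts M. \<forall>vs. smooth_fps (snd c ` fst c) (\<lambda>x. local_form M c \<omega> x vs))"
  unfolding smooth_form_def smooth_fps_def by blast

lemma smooth_form_alt: "smooth_form M k \<omega> \<Longrightarrow> alt_form k (\<omega> p)"
  unfolding smooth_form_def by blast

lemma smooth_form_smooth_fps: "smooth_form M k \<omega> \<Longrightarrow> c \<in> charts M \<Longrightarrow> smooth_fps (snd c ` fst c) (\<lambda>x. local_form M c \<omega> x vs)"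
  unfolding smooth_form_iff by blast

lemma smooth_form_diff_fps:
  "smooth_form M k \<omega> \<Longrightarrow> c \<in> charts M \<Longrightarrow> x \<in> snd c ` fst c \<Longrightarrow> diff_fps (\<lambda>x. local_form M c \<omega> x vs) x"
  by (rule smooth_fps_diff_fps[OF smooth_form_smooth_fps])

lemma ext_d_coord_d: "ext_d M \<omega> p = coord_d (local_form M (chart_at M p) \<omega>) (snd (chart_at M p) p)"
  by (simp add: fun_eq_iff ext_d_def coord_d_def Let_def)

text \<open>
  The exterior derivative at a point was defined in the chart chosen at that point.  By
  invariance under coordinate changes the value in any chart \<open>c\<close> is the coordinate derivative,
  with one and the same \<open>c\<close> for all points; only in this form can it be differentiated again.
\<close>

lemma ext_d_local:
  assumes \<omega>: "smooth_form M k \<omega>" and k: "k \<le> 2" and c: "c \<in> charts M" and x: "x \<in> snd c ` fst c"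
  shows "local_form M c (ext_d M \<omega>) x = coord_d (local_form M c \<omega>) x"
proof -
  define p where "p = chart_inv c x"
  define d where "d = chart_at M p"
  define \<psi> where "\<psi> = snd d \<circ> chart_inv c"
  let ?N = "snd c ` (fst c \<inter> fst d)"
  have p: "p \<in> fst c" "snd c p = x" unfolding p_def using chart_inv_in[OF c x] chart_inv_right[OF c x] by auto
  have d: "d \<in> charts M" "p \<in> fst d" unfolding d_def by (rule chart_at)+
  have \<psi>x: "\<psi> x = snd d p" by (simp add: \<psi>_def p_def)
  have N: "open ?N" "x \<in> ?N" using open_chart_image[OF c open_chart(1)[OF d(1)]] p d by auto
  have "coord_d (local_form M c \<omega>) x = pullback (frechet_derivative \<psi> (at x)) (coord_d (local_form M d \<omega>) (\<psi> x))"
  proof (rule coord_d_pullback[OF N _ _ _ _ _ _ _ _ k])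
    show "smooth_on ?N \<psi>" unfolding \<psi>_def by (rule smooth_transition[OF c d(1)])
    fix y assume "y \<in> ?N"
    then obtain q where q: "q \<in> fst c" "q \<in> fst d" "y = snd c q" by blast
    have \<psi>y: "\<psi> y = snd d q" by (simp add: \<psi>_def q chart_inv_left[OF c])
    have j: "frechet_derivative \<psi> (at y) = jac c d q" unfolding jac_def \<psi>_def q(3) ..
    show "local_form M c \<omega> y = pullback (frechet_derivative \<psi> (at y)) (local_form M d \<omega> (\<psi> y))"
      unfolding j \<psi>y unfolding q(3) by (rule local_form_change[OF c d(1) q(1,2)])
    show "alt_form k (local_form M d \<omega> (\<psi> y))"
      unfolding \<psi>y using q by (intro alt_form_local[OF d(1)] smooth_form_alt[OF \<omega>]) blast
  next
    show "diff_fps (\<lambda>z. local_form M d \<omega> z vs) (\<psi> x)" for vs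
      unfolding \<psi>x using d by (intro smooth_form_diff_fps[OF \<omega>]) auto
    show "diff_fps (\<lambda>y. local_form M c \<omega> y vs) x" for vs
      using smooth_form_diff_fps[OF \<omega> c x] .
    show "open (snd d ` fst d)" by (rule open_chart(2)[OF d(1)])
    show "\<psi> x \<in> snd d ` fst d" unfolding \<psi>x using d by blast
    show "alt_form k (local_form M d \<omega> z)" if "z \<in> snd d ` fst d" for z
      by (rule alt_form_local[OF d(1) that smooth_form_alt[OF \<omega>]])
  qed
  also have "frechet_derivative \<psi> (at x) = jac c d p" unfolding jac_def \<psi>_def p(2) ..
  also have "coord_d (local_form M d \<omega>) (\<psi> x) = ext_d M \<omega> p"
    unfolding ext_d_coord_d \<psi>x d_def ..
  finally show ?thesis unfolding local_form_pullback[of c "ext_d M \<omega>"] d_def p_def by simp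
qed

lemma smooth_ext_d:
  assumes \<omega>: "smooth_form M k \<omega>" and k: "k \<le> 2"
  shows "smooth_form M (Suc k) (ext_d M \<omega>)"
  unfolding smooth_form_iff
proof (intro conjI allI ballI)
  show "alt_form (Suc k) (ext_d M \<omega> p)" for p
    unfolding ext_d_coord_d
  proof (rule alt_form_coord_d[OF open_chart(2)[OF chart_at(1)] _ _ k])
    show "snd (chart_at M p) p \<in> snd (chart_at M p) ` fst (chart_at M p)" using chart_at by blast
    then show "diff_fps (\<lambda>y. local_form M (chart_at M p) \<omega> y vs) (snd (chart_at M p) p)" for vs
      by (rule smooth_form_diff_fps[OF \<omega> chart_at(1)])
    show "alt_form k (local_form M (chart_at M p) \<omega> y)" if "y \<in> snd (chart_at M p) ` fst (chart_at M p)" for y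
      by (rule alt_form_local[OF chart_at(1) that smooth_form_alt[OF \<omega>]])
  qed
  fix c vs assume c: "c \<in> charts M"
  note S = open_chart(2)[OF c]
  have "smooth_fps (snd c ` fst c) (\<lambda>x. coord_d (local_form M c \<omega>) x vs)"
    unfolding coord_d_def by (intro smooth_fps_sum smooth_fps_mult smooth_fps_const smooth_fps_dir_deriv smooth_form_smooth_fps[OF \<omega> c] S)
  then show "smooth_fps (snd c ` fst c) (\<lambda>x. local_form M c (ext_d M \<omega>) x vs)"
    by (rule smooth_fps_cong[OF S, rotated]) (simp add: ext_d_local[OF \<omega> k c])
qed

lemma ext_d_ext_d:
  assumes \<omega>: "smooth_form M k \<omega>" and k: "k \<le> 1"
  shows "ext_d M (ext_d M \<omega>) = 0"
proof (intro ext)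
  fix p vs
  let ?c = "chart_at M p"
  note c = chart_at(1)[of p]
  let ?S = "snd ?c ` fst ?c"
  note S = open_chart(2)[OF c]
  have x: "snd ?c p \<in> ?S" using chart_at(2) by blast
  have k2: "k \<le> 2" using k by simp
  have "ext_d M (ext_d M \<omega>) p vs = coord_d (local_form M ?c (ext_d M \<omega>)) (snd ?c p) vs"
    by (simp add: ext_d_coord_d)
  also have "coord_d (local_form M ?c (ext_d M \<omega>)) (snd ?c p) = coord_d (coord_d (local_form M ?c \<omega>)) (snd ?c p)"
    by (rule coord_d_cong[OF S x ext_d_local[OF \<omega> k2 c] smooth_form_diff_fps[OF smooth_ext_d[OF \<omega> k2] c x]])
  also have "coord_d (coord_d (local_form M ?c \<omega>)) (snd ?c p) vs = 0"
    by (rule coord_d_coord_d[OF S x smooth_form_smooth_fps[OF \<omega> c] alt_form_local[OF c _ smooth_form_alt[OF \<omega>]] k])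
  finally show "ext_d M (ext_d M \<omega>) p vs = (0 :: 'm form) p vs" by simp
qed

lemma ext_d_0: "ext_d M (\<lambda>q vs. 0) = (\<lambda>p vs. 0)"
  by (simp add: fun_eq_iff ext_d_def local_form_def dir_deriv_const)

lemma hodge_alt_0: "k \<le> 3 \<Longrightarrow> hodge_alt g k (\<lambda>vs. 0) = (\<lambda>vs. 0)"
  by (rule hodge_alt_eqI) (auto simp: is_hodge_def alt_form_def inner_alt_def wedge_alt_zero_right Let_def)

lemma part_alt: "alt_form k \<alpha> \<Longrightarrow> part j \<alpha> = (if j = k then \<alpha> else (\<lambda>vs. 0))"
  by (auto simp: fun_eq_iff part_def alt_form_length)

lemma hodge_eq:
  assumes "alt_form k (\<omega> p)" "k \<le> 3"
  shows "hodge M \<omega> p = hodge_alt (metric M p) k (\<omega> p)"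
proof -
  have "hodge M \<omega> p = (\<Sum>j\<le>3. if j = k then hodge_alt (metric M p) k (\<omega> p) else 0)"
    unfolding hodge_def part_alt[OF assms(1)]
    by (rule sum.cong) (auto simp: hodge_alt_0 zero_fun_def)
  then show ?thesis using assms(2) by simp
qed

text \<open>
  The transition maps preserve the orientation, so that the star commutes with them.
\<close>

lemma hodge_local:
  assumes \<omega>: "\<And>p. alt_form k (\<omega> p)" and k: "k \<le> 3" and c: "c \<in> charts M" and x: "x \<in> snd c ` fst c"
  shows "local_form M c (hodge M \<omega>) x = hodge_alt (local_metric M c x) k (local_form M c \<omega> x)"
  unfolding local_form_pullback local_metric_pullback hodge_eq[OF \<omega> k]
  by (rule hodge_alt_pullback[symmetric, OF ip_metric jac_facts(1,2)[OF c x] k \<omega>])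

lemma smooth_hodge:
  assumes \<omega>: "smooth_form M k \<omega>" and k: "k \<le> 3" and l: "l = 3 - k"
  shows "smooth_form M l (hodge M \<omega>)"
  unfolding smooth_form_iff
proof (intro conjI allI ballI)
  note a = smooth_form_alt[OF \<omega>]
  show "alt_form l (hodge M \<omega> p)" for p
    unfolding hodge_eq[OF a k] l by (rule alt_form_hodge_alt[OF ip_metric k a])
  fix c vs assume c: "c \<in> charts M"
  note S = open_chart(2)[OF c]
  have "smooth_fps (snd c ` fst c) (\<lambda>x. hodge_alt (local_metric M c x) k (local_form M c \<omega> x) vs)"
    by (rule smooth_hodge_alt[OF S ip_local[OF c] smooth_metric[OF c] alt_form_local[OF c _ a]
          smooth_form_smooth_fps[OF \<omega> c] k])
  then show "smooth_fps (snd c ` fst c) (\<lambda>x. local_form M c (hodge M \<omega>) x vs)"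
    by (rule smooth_fps_cong[OF S, rotated]) (simp add: hodge_local[OF a k c])
qed

end

section \<open>Algebra of forms at a point\<close>

lemma alt_form_lincomb:
  assumes "alt_form k \<alpha>" "alt_form k \<beta>"
  shows "alt_form k (\<lambda>vs. a * \<alpha> vs + b * \<beta> vs)"
proof -
  have m: "alternating \<alpha>" "alternating \<beta>" using assms by (auto dest: alt_form_imp_alternating)
  have z: "\<alpha> (xs @ v # v # zs) = 0" "\<beta> (xs @ v # v # zs) = 0" for xs v zs
    using m unfolding alternating_def by blast+
  have "alternating (\<lambda>vs. a * \<alpha> vs + b * \<beta> vs)"
    unfolding alternating_def by (simp add: z alternating_linear[OF m(1)] alternating_linear[OF m(2)]) (simp add: algebra_simps)
  then show ?thesis using assms by (simp add: alt_form_iff)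
qed

lemma hodge_alt_lincomb:
  assumes g: "inner_product g" and k: "k \<le> 3" and \<alpha>: "alt_form k \<alpha>" and \<beta>: "alt_form k \<beta>"
  shows "hodge_alt g k (\<lambda>vs. a * \<alpha> vs + b * \<beta> vs) =
    (\<lambda>vs. a * hodge_alt g k \<alpha> vs + b * hodge_alt g k \<beta> vs)"
proof (rule hodge_alt_eqI[OF k])
  note h = is_hodge_hodge_alt[OF g k \<alpha>] is_hodge_hodge_alt[OF g k \<beta>]
  have i: "inner_alt g \<gamma> (\<lambda>vs. a * \<alpha> vs + b * \<beta> vs) = a * inner_alt g \<gamma> \<alpha> + b * inner_alt g \<gamma> \<beta>" for \<gamma>
    by (simp add: inner_alt_def Let_def sum.distrib sum_distrib_left algebra_simps)
  show "is_hodge g k (\<lambda>vs. a * \<alpha> vs + b * \<beta> vs) (\<lambda>vs. a * hodge_alt g k \<alpha> vs + b * hodge_alt g k \<beta> vs)"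
    unfolding is_hodge_def
  proof (intro conjI allI impI)
    show "alt_form (3 - k) (\<lambda>vs. a * hodge_alt g k \<alpha> vs + b * hodge_alt g k \<beta> vs)"
      by (rule alt_form_lincomb[OF alt_form_hodge_alt[OF g k \<alpha>] alt_form_hodge_alt[OF g k \<beta>]])
    fix \<gamma> assume "alt_form k \<gamma>"
    then have "wedge_alt \<gamma> (hodge_alt g k \<alpha>) = (\<lambda>vs. inner_alt g \<gamma> \<alpha> * vol_alt g vs)"
      "wedge_alt \<gamma> (hodge_alt g k \<beta>) = (\<lambda>vs. inner_alt g \<gamma> \<beta> * vol_alt g vs)"
      using h unfolding is_hodge_def by blast+
    then show "wedge_alt \<gamma> (\<lambda>vs. a * hodge_alt g k \<alpha> vs + b * hodge_alt g k \<beta> vs) =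
        (\<lambda>vs. inner_alt g \<gamma> (\<lambda>vs. a * \<alpha> vs + b * \<beta> vs) * vol_alt g vs)"
      by (simp add: fun_eq_iff wedge_alt_add_right wedge_alt_scale_right i algebra_simps)
  qed
qed

lemma fps_deriv_F:
  "fps_deriv (F0 f vs) = F0 (fps_deriv f) vs"
  "fps_deriv (F1 a vs) = F1 (\<chi> i. fps_deriv (a $ i)) vs"
  "fps_deriv (F2 a vs) = F2 (\<chi> i. fps_deriv (a $ i)) vs"
  "fps_deriv (F3 f vs) = F3 (fps_deriv f) vs"
  subgoal by (cases vs) simp_all
  subgoal by (cases "(a, vs)" rule: F1.cases) simp_all
  subgoal by (cases "(a, vs)" rule: F2.cases) simp_all
  subgoal by (cases "(f, vs)" rule: F3.cases) simp_all
  done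

lemma alt_form_deriv:
  assumes "alt_form k \<alpha>"
  shows "alt_form k (\<lambda>vs. fps_deriv (\<alpha> vs))"
proof -
  have m: "alternating \<alpha>" using assms by (rule alt_form_imp_alternating)
  then have "\<alpha> (xs @ v # v # zs) = 0" for xs v zs unfolding alternating_def by blast
  then have "alternating (\<lambda>vs. fps_deriv (\<alpha> vs))"
    unfolding alternating_def by (simp add: alternating_linear[OF m])
  then show ?thesis using assms by (simp add: alt_form_iff)
qed

lemma mat_act_deriv: "(\<chi> i. fps_deriv (mat_act A a $ i)) = mat_act A (\<chi> i. fps_deriv (a $ i))"
  by (simp add: mat_act_def vec_eq_iff)

lemma hodge_alt_deriv:
  assumes g: "inner_product g" and k: "k \<le> 3" and \<alpha>: "alt_form k \<alpha>"
  shows "hodge_alt g k (\<lambda>vs. fps_deriv (\<alpha> vs)) = (\<lambda>vs. fps_deriv (hodge_alt g k \<alpha> vs))"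
  by (rule alt_form_le_3_cases[OF \<alpha> k])
    (simp_all only: fps_deriv_F hodge_alt_F[OF g] mat_act_deriv fps_deriv_mult fps_deriv_const
      mult_zero_left add_0_left add_0_right eta_contract_eq)

lemma mat_act_mat_act: "mat_act A (mat_act B a) = mat_act (A ** B) a"
proof -
  have "\<forall>i. mat_act A (mat_act B a) $ i = mat_act (A ** B) a $ i"
    unfolding forall_3 mat_act_def vec_lambda_beta matrix_matrix_mult_def sum_3 fps_const_ring
    by (intro conjI) (simp_all only: algebra_simps)
  then show ?thesis by (simp add: vec_eq_iff)
qed

lemma mat_act_1: "mat_act (mat 1) a = a"
  by (simp add: mat_act_def mat_def vec_eq_iff forall_3)

lemma vol_det: "inner_product g \<Longrightarrow> vol g * vol g * det (dual_gram g) = 1"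
  using det_gram_pos[of g] by (simp add: vol_square det_dual_gram)

lemma cofactors_dual_gram_mult:
  assumes g: "inner_product g"
  shows "dual_gram g ** cofactors (dual_gram g) = det (dual_gram g) *\<^sub>R mat 1"
proof -
  have "transpose (cofactors (dual_gram g)) = cofactors (dual_gram g)"
    using dual_gram_sym[OF g, of 1 2] dual_gram_sym[OF g, of 1 3] dual_gram_sym[OF g, of 2 3]
    by (simp add: vec_eq_iff forall_3 transpose_def cofactors_def mult_ac)
  then show ?thesis using det_cofactors[of "dual_gram g"] by simp
qed

lemma hodge_matrices:
  assumes g: "inner_product g"
  shows "(vol g *\<^sub>R dual_gram g) ** (vol g *\<^sub>R cofactors (dual_gram g)) = mat 1"
    "(vol g *\<^sub>R cofactors (dual_gram g)) ** (vol g *\<^sub>R dual_gram g) = mat 1"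
proof -
  show "(vol g *\<^sub>R dual_gram g) ** (vol g *\<^sub>R cofactors (dual_gram g)) = mat 1"
    using vol_det[OF g]
    by (simp add: matrix_scalar_ac scalar_matrix_assoc[symmetric] cofactors_dual_gram_mult[OF g] mult_ac)
  then show "(vol g *\<^sub>R cofactors (dual_gram g)) ** (vol g *\<^sub>R dual_gram g) = mat 1"
    by (simp add: matrix_left_right_inverse)
qed

text \<open>
  The two component matrices are inverse to each other, since \<open>A \<cdot> cofactors A = det A\<close> for the symmetric matrix
  \<open>A = G\<^sup>-\<^sup>1\<close> and \<open>(vol g)\<^sup>2 det A = 1\<close>.
\<close>

lemma hodge_alt_hodge_alt:
  assumes g: "inner_product g" and k: "k \<le> 3" and \<alpha>: "alt_form k \<alpha>"
  shows "hodge_alt g (3 - k) (hodge_alt g k \<alpha>) = \<alpha>"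
proof -
  have c: "fps_const (vol g) * (fps_const (vol g * det (dual_gram g)) * x) = x"
    "fps_const (vol g * det (dual_gram g)) * (fps_const (vol g) * x) = x" for x
  proof -
    have e: "fps_const (vol g) * fps_const (vol g * det (dual_gram g)) = 1"
      using vol_det[OF g] by (simp add: mult_ac)
    show "fps_const (vol g) * (fps_const (vol g * det (dual_gram g)) * x) = x"
      unfolding mult.assoc[symmetric] e by simp
    show "fps_const (vol g * det (dual_gram g)) * (fps_const (vol g) * x) = x"
      unfolding mult.assoc[symmetric] mult.commute[of "fps_const (vol g * det (dual_gram g))"] e by simp
  qed
  have d: "3 - 0 = (3::nat)" "3 - 1 = (2::nat)" "3 - 2 = (1::nat)" "3 - 3 = (0::nat)" by simp_all
  show ?thesis
    by (rule alt_form_le_3_cases[OF \<alpha> k])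
      (simp_all only: d hodge_alt_F[OF g] mat_act_mat_act hodge_matrices[OF g] mat_act_1 c)
qed

definition covec_inner :: "ip \<Rightarrow> (real fps)^3 \<Rightarrow> (real fps)^3 \<Rightarrow> real fps" where
  "covec_inner g a b = dotv a (mat_act (dual_gram g) b)"

lemma covec_inner_sym: "inner_product g \<Longrightarrow> covec_inner g a b = covec_inner g b a"
  using dual_gram_sym[of g 1 2] dual_gram_sym[of g 1 3] dual_gram_sym[of g 2 3]
  by (simp add: covec_inner_def dotv_def mat_act_def algebra_simps)

lemma wedge_hodge_1:
  assumes g: "inner_product g" and \<alpha>: "alt_form 1 \<alpha>" and \<beta>: "alt_form 1 \<beta>"
  shows "wedge_alt \<alpha> (hodge_alt g 1 \<beta>) = F3 (covec_inner g (comp1 \<alpha>) (comp1 \<beta>) * fps_const (vol g))"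
proof -
  obtain a b where ab: "\<alpha> = F1 a" "\<beta> = F1 b" using alt_form_1_eq \<alpha> \<beta> by metis
  show ?thesis unfolding ab hodge_alt_F[OF g] wedge_F1_F2 covec_inner_def dotv_mat_act_scale by simp
qed

lemma wedge_anticommute_1: "alt_form 1 \<alpha> \<Longrightarrow> alt_form 1 \<beta> \<Longrightarrow> wedge_alt \<beta> \<alpha> vs = - wedge_alt \<alpha> \<beta> vs"
proof -
  assume "alt_form 1 \<alpha>" "alt_form 1 \<beta>"
  then obtain a b where ab: "\<alpha> = F1 a" "\<beta> = F1 b" using alt_form_1_eq by metis
  have "crossv b a = - crossv a b" by (simp add: crossv_def vec_eq_iff forall_3)
  then show ?thesis unfolding ab wedge_F1_F1 by (cases "(a, vs)" rule: F2.cases) (simp_all add: algebra_simps)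
qed

lemma wedge_commute_1_2: "alt_form 1 \<alpha> \<Longrightarrow> alt_form 2 \<beta> \<Longrightarrow> wedge_alt \<beta> \<alpha> = wedge_alt \<alpha> \<beta>"
proof -
  assume "alt_form 1 \<alpha>" "alt_form 2 \<beta>"
  then obtain a b where ab: "\<alpha> = F1 a" "\<beta> = F2 b" using alt_form_1_eq alt_form_2_eq by metis
  show ?thesis unfolding ab wedge_F1_F2 wedge_F2_F1 ..
qed

lemma mat_act_cofactors_cross:
  "mat_act (cofactors A) (crossv a b) = crossv (mat_act A a) (mat_act A b)"
proof -
  have "\<forall>i. mat_act (cofactors A) (crossv a b) $ i = crossv (mat_act A a) (mat_act A b) $ i"
    unfolding forall_3 mat_act_def crossv_def cofactors_def vec_lambda_beta vector_3 fps_const_ring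
    by (intro conjI) (simp_all only: algebra_simps)
  then show ?thesis by (simp add: vec_eq_iff)
qed

lemma mat_act_scale: "mat_act (c *\<^sub>R A) a = fps_const c *s mat_act A a"
  by (simp add: mat_act_def vec_eq_iff fps_const_ring algebra_simps del: fps_const_mult)

text \<open>
  The identity \<open>a \<times> (b \<times> a) = |a|\<^sup>2 b - (b \<cdot> a) a\<close>, where \<open>\<star>(\<beta> \<wedge> \<alpha>)\<close> and \<open>\<alpha> \<wedge> _\<close> play the role of the
  two cross products.
\<close>

lemma wedge_hodge_wedge:
  assumes g: "inner_product g" and \<alpha>: "alt_form 1 \<alpha>" and \<beta>: "alt_form 1 \<beta>"
  shows "wedge_alt \<alpha> (hodge_alt g 2 (wedge_alt \<beta> \<alpha>)) vs =
    covec_inner g (comp1 \<alpha>) (comp1 \<alpha>) * hodge_alt g 1 \<beta> vs - covec_inner g (comp1 \<beta>) (comp1 \<alpha>) * hodge_alt g 1 \<alpha> vs"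
proof -
  obtain a b where ab: "\<alpha> = F1 a" "\<beta> = F1 b" using alt_form_1_eq \<alpha> \<beta> by metis
  let ?H = "mat_act (dual_gram g)" and ?v = "fps_const (vol g)"
  have "\<forall>i. crossv a (?v *s crossv (?H b) (?H a)) $ i =
      (covec_inner g a a *s (?v *s ?H b) - covec_inner g b a *s (?v *s ?H a)) $ i"
    unfolding covec_inner_def dotv_def crossv_def forall_3 covec_inner_sym[OF g, unfolded covec_inner_def dotv_def, of b a]
    using covec_inner_sym[OF g, of b a]
    by (simp add: dotv_def algebra_simps)
  then have e: "crossv a (?v *s crossv (?H b) (?H a)) = covec_inner g a a *s (?v *s ?H b) - covec_inner g b a *s (?v *s ?H a)"
    by (simp add: vec_eq_iff)
  have F2l: "F2 (s *s x - t *s y) vs = s * F2 x vs - t * F2 y vs" for s t x y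
    by (cases "(x, vs)" rule: F2.cases) (simp_all add: algebra_simps)
  show ?thesis
    unfolding ab wedge_F1_F1 hodge_alt_F[OF g] mat_act_scale mat_act_cofactors_cross e F2l comp1_F1 ..
qed

section \<open>Algebra of smooth forms\<close>

lemma scale_apply: "(f \<cdot> \<omega>) p = (\<lambda>vs. f p * \<omega> p vs)"
  by (simp add: fun_eq_iff scale_def)

lemma form0_F0: "form0 f p = F0 (f p)"
proof
  show "form0 f p vs = F0 (f p) vs" for vs by (cases vs) (simp_all add: form0_def)
qed

lemma local_form_lincomb:
  "local_form M c (\<lambda>p vs. a p * \<alpha> p vs + b p * \<beta> p vs) x =
    (\<lambda>vs. a (chart_inv c x) * local_form M c \<alpha> x vs + b (chart_inv c x) * local_form M c \<beta> x vs)"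
  by (simp add: fun_eq_iff local_form_def Let_def)

lemma smooth_fps_wedge_alt:
  assumes "open S" "\<And>vs. smooth_fps S (\<lambda>x. A x vs)" "\<And>vs. smooth_fps S (\<lambda>x. B x vs)"
  shows "smooth_fps S (\<lambda>x. wedge_alt (A x) (B x) vs)"
  unfolding wedge_alt_def by (intro smooth_fps_sum smooth_fps_mult smooth_fps_const assms)

context riemannian_3manifold
begin

abbreviation sform :: "nat \<Rightarrow> 'm form \<Rightarrow> bool" where "sform \<equiv> smooth_form M"
abbreviation sfn :: "'m fn \<Rightarrow> bool" where "sfn \<equiv> smooth_fn M"
abbreviation hod :: "'m form \<Rightarrow> 'm form" where "hod \<equiv> hodge M"
abbreviation dd :: "'m form \<Rightarrow> 'm form" where "dd \<equiv> ext_d M"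
abbreviation cod :: "'m form \<Rightarrow> 'm form" where "cod \<equiv> codiff M"

lemma sfn_iff: "sfn f \<longleftrightarrow> (\<forall>c\<in>charts M. smooth_fps (snd c ` fst c) (\<lambda>x. f (chart_inv c x)))"
  unfolding smooth_fn_def smooth_fps_def by blast

lemma sfn_const: "sfn (\<lambda>p. a)"
  by (auto simp: sfn_iff intro!: smooth_fps_const open_chart)

lemma sfn_mult: "sfn f \<Longrightarrow> sfn g \<Longrightarrow> sfn (\<lambda>p. f p * g p)"
  by (auto simp: sfn_iff intro!: smooth_fps_mult open_chart)

lemma sfn_recip: "sfn f \<Longrightarrow> (\<And>p. fps_nth (f p) 0 \<noteq> 0) \<Longrightarrow> sfn (recip f)"
  by (auto simp: sfn_iff recip_def intro!: smooth_fps_inverse open_chart)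

lemma sform_form0: "sform 0 (form0 f) \<longleftrightarrow> sfn f"
proof
  assume "sform 0 (form0 f)"
  then have "c \<in> charts M \<Longrightarrow> smooth_fps (snd c ` fst c) (\<lambda>x. local_form M c (form0 f) x [])" for c
    by (rule smooth_form_smooth_fps)
  then show "sfn f" by (simp add: sfn_iff local_form_def form0_def Let_def)
next
  assume f: "sfn f"
  have "smooth_fps (snd c ` fst c) (\<lambda>x. local_form M c (form0 f) x vs)" if "c \<in> charts M" for c vs
    using f that smooth_fps_const[OF open_chart(2)[OF that], of 0]
    by (cases vs) (simp_all add: sfn_iff local_form_def form0_def Let_def)
  then show "sform 0 (form0 f)"
    using alt_form_F0 by (simp add: smooth_form_iff form0_F0)
qed

lemma sform_0_eq: "sform 0 \<omega> \<Longrightarrow> \<omega> = form0 (fn_of \<omega>)"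
  using alt_form_0_eq[OF smooth_form_alt] by (simp add: fun_eq_iff form0_F0 fn_of_def)

lemma sform_lincomb:
  assumes "sfn a" "sfn b" "sform k \<alpha>" "sform k \<beta>"
  shows "sform k (\<lambda>p vs. a p * \<alpha> p vs + b p * \<beta> p vs)"
  unfolding smooth_form_iff
proof (intro conjI allI ballI)
  show "alt_form k (\<lambda>vs. a p * \<alpha> p vs + b p * \<beta> p vs)" for p
    by (rule alt_form_lincomb[OF smooth_form_alt[OF assms(3)] smooth_form_alt[OF assms(4)]])
  fix c vs assume c: "c \<in> charts M"
  have ab: "smooth_fps (snd c ` fst c) (\<lambda>x. a (chart_inv c x))" "smooth_fps (snd c ` fst c) (\<lambda>x. b (chart_inv c x))"
    using assms(1,2) c unfolding sfn_iff by blast+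
  show "smooth_fps (snd c ` fst c) (\<lambda>x. local_form M c (\<lambda>p vs. a p * \<alpha> p vs + b p * \<beta> p vs) x vs)"
    unfolding local_form_lincomb
    by (intro smooth_fps_add smooth_fps_mult open_chart(2)[OF c] ab smooth_form_smooth_fps[OF assms(3) c] smooth_form_smooth_fps[OF assms(4) c])
qed

lemma sform_scale: "sfn f \<Longrightarrow> sform k \<omega> \<Longrightarrow> sform k (f \<cdot> \<omega>)"
  using sform_lincomb[of f "\<lambda>p. 0" k \<omega> \<omega>] sfn_const[of 0] by (simp add: scale_def[abs_def])

lemma sform_zero: "sform k (\<lambda>p vs. 0)"
  by (simp add: smooth_form_iff alt_form_def local_form_def smooth_fps_const open_chart Let_def)

lemma sform_zero': "sform k 0"
  using sform_zero by (simp add: zero_fun_def)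

lemma sform_add: "sform k \<alpha> \<Longrightarrow> sform k \<beta> \<Longrightarrow> sform k (\<alpha> + \<beta>)"
  using sform_lincomb[OF sfn_const sfn_const, of k \<alpha> \<beta> 1 1] by (simp add: plus_fun_def)

lemma sform_minus: "sform k \<alpha> \<Longrightarrow> sform k (- \<alpha>)"
  using sform_lincomb[OF sfn_const sfn_const, of k \<alpha> \<alpha> "-1" 0] by (simp add: fun_Compl_def)

lemma sform_diff: "sform k \<alpha> \<Longrightarrow> sform k \<beta> \<Longrightarrow> sform k (\<alpha> - \<beta>)"
  using sform_lincomb[OF sfn_const sfn_const, of k \<alpha> \<beta> 1 "-1"] by (simp add: fun_diff_def)

lemma local_form_wedge: "local_form M c (\<alpha> \<wedge> \<beta>) x = wedge_alt (local_form M c \<alpha> x) (local_form M c \<beta> x)"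
  unfolding local_form_pullback wedge_pullback by (simp add: wedge_def)

lemma sform_wedge:
  assumes "sform k \<alpha>" "sform l \<beta>" "n = k + l"
  shows "sform n (\<alpha> \<wedge> \<beta>)"
  unfolding smooth_form_iff
proof (intro conjI allI ballI)
  show "alt_form n ((\<alpha> \<wedge> \<beta>) p)" for p
    unfolding wedge_def assms(3)
    by (rule alt_form_wedge[OF smooth_form_alt[OF assms(1)] smooth_form_alt[OF assms(2)]])
  fix c vs assume c: "c \<in> charts M"
  show "smooth_fps (snd c ` fst c) (\<lambda>x. local_form M c (\<alpha> \<wedge> \<beta>) x vs)"
    unfolding local_form_wedge
    by (intro smooth_fps_wedge_alt open_chart(2)[OF c] smooth_form_smooth_fps[OF assms(1) c] smooth_form_smooth_fps[OF assms(2) c])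
qed

lemma sform_dt: "sform k \<omega> \<Longrightarrow> sform k (dt_form \<omega>)"
  unfolding smooth_form_iff dt_form_def[abs_def] local_form_def Let_def
  by (auto intro!: alt_form_deriv smooth_fps_deriv open_chart)

subsection \<open>Linearity and the Leibniz rule\<close>

lemma hodge_lincomb:
  assumes "sform k \<alpha>" "sform k \<beta>" "k \<le> 3"
  shows "hod (\<lambda>p vs. a p * \<alpha> p vs + b p * \<beta> p vs) = (\<lambda>p vs. a p * (hod \<alpha>) p vs + b p * (hod \<beta>) p vs)"
proof
  fix p
  note al = smooth_form_alt[OF assms(1), of p] smooth_form_alt[OF assms(2), of p]
  have e: "hod (\<lambda>p vs. a p * \<alpha> p vs + b p * \<beta> p vs) p =
      hodge_alt (metric M p) k (\<lambda>vs. a p * \<alpha> p vs + b p * \<beta> p vs)"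
    by (rule hodge_eq[OF _ assms(3)]) (rule alt_form_lincomb[OF al])
  show "hod (\<lambda>p vs. a p * \<alpha> p vs + b p * \<beta> p vs) p = (\<lambda>vs. a p * (hod \<alpha>) p vs + b p * (hod \<beta>) p vs)"
    unfolding e hodge_eq[of k \<alpha> p, OF al(1) assms(3)] hodge_eq[of k \<beta> p, OF al(2) assms(3)]
    by (rule hodge_alt_lincomb[OF ip_metric assms(3) al])
qed

lemma hodge_scale: "sform k \<omega> \<Longrightarrow> k \<le> 3 \<Longrightarrow> hod (f \<cdot> \<omega>) = f \<cdot> hod \<omega>"
  using hodge_lincomb[of k \<omega> \<omega> f "\<lambda>p. 0"] by (simp add: scale_def[abs_def])

lemma hodge_add: "sform k \<alpha> \<Longrightarrow> sform k \<beta> \<Longrightarrow> k \<le> 3 \<Longrightarrow> hod (\<alpha> + \<beta>) = hod \<alpha> + hod \<beta>"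
  using hodge_lincomb[of k \<alpha> \<beta> "\<lambda>p. 1" "\<lambda>p. 1"] by (simp add: plus_fun_def)

lemma hodge_minus: "sform k \<alpha> \<Longrightarrow> k \<le> 3 \<Longrightarrow> hod (- \<alpha>) = - hod \<alpha>"
  using hodge_lincomb[of k \<alpha> \<alpha> "\<lambda>p. -1" "\<lambda>p. 0"] by (simp add: fun_Compl_def)

lemma hodge_zero: "hod (\<lambda>p vs. 0) = (\<lambda>p vs. 0)"
  using hodge_lincomb[OF sform_zero sform_zero, of 0 "\<lambda>p. 0" "\<lambda>p. 0"] by simp

lemma hodge_hodge:
  assumes "sform k \<omega>" "k \<le> 3"
  shows "hod (hod \<omega>) = \<omega>"
proof
  fix p
  note al = smooth_form_alt[OF assms(1), of p]
  have e: "(hod \<omega>) p = hodge_alt (metric M p) k (\<omega> p)" by (rule hodge_eq[of k \<omega> p, OF al assms(2)])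
  have "hod (hod \<omega>) p = hodge_alt (metric M p) (3 - k) ((hod \<omega>) p)"
    by (rule hodge_eq) (simp_all add: e alt_form_hodge_alt[OF ip_metric assms(2) al])
  then show "hod (hod \<omega>) p = \<omega> p"
    unfolding e using hodge_alt_hodge_alt[OF ip_metric assms(2) al] by simp
qed

lemma hodge_dt:
  assumes "sform k \<omega>" "k \<le> 3"
  shows "hod (dt_form \<omega>) = dt_form (hod \<omega>)"
proof
  fix p
  note al = smooth_form_alt[OF assms(1), of p]
  have d: "dt_form \<omega> p = (\<lambda>vs. fps_deriv (\<omega> p vs))" for \<omega> p by (simp add: dt_form_def fun_eq_iff)
  have "hod (dt_form \<omega>) p = hodge_alt (metric M p) k (dt_form \<omega> p)"
    by (rule hodge_eq[OF _ assms(2)]) (simp add: d alt_form_deriv[OF al])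
  then show "hod (dt_form \<omega>) p = dt_form (hod \<omega>) p"
    unfolding d hodge_eq[of k \<omega> p, OF al assms(2)] using hodge_alt_deriv[OF ip_metric assms(2) al] by simp
qed

lemma own_diff_fps: "sform k \<omega> \<Longrightarrow> diff_fps (\<lambda>x. local_form M (chart_at M p) \<omega> x vs) (snd (chart_at M p) p)"
  using chart_at[of p] by (intro smooth_form_diff_fps) auto

lemma ext_d_add:
  assumes "sform k \<alpha>" "sform k \<beta>"
  shows "dd (\<alpha> + \<beta>) = dd \<alpha> + dd \<beta>"
proof (intro ext)
  fix p vs
  have l: "local_form M c (\<alpha> + \<beta>) = (\<lambda>x vs. local_form M c \<alpha> x vs + local_form M c \<beta> x vs)" for c
    by (simp add: fun_eq_iff local_form_def Let_def)
  show "dd (\<alpha> + \<beta>) p vs = (dd \<alpha> + dd \<beta>) p vs"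
    by (simp add: ext_d_coord_d l coord_d_def dir_deriv_add own_diff_fps[OF assms(1)] own_diff_fps[OF assms(2)]
        sum.distrib algebra_simps)
qed

lemma ext_d_dt:
  assumes "sform k \<omega>"
  shows "dd (dt_form \<omega>) = dt_form (dd \<omega>)"
proof (intro ext)
  fix p vs
  have l: "local_form M c (dt_form \<omega>) = (\<lambda>x vs. fps_deriv (local_form M c \<omega> x vs))" for c
    by (simp add: fun_eq_iff local_form_def dt_form_def Let_def)
  have s: "fps_deriv ((-1) ^ i :: real fps) = 0" for i by (induction i) simp_all
  show "dd (dt_form \<omega>) p vs = dt_form (dd \<omega>) p vs"
    by (simp add: ext_d_coord_d l coord_d_def dir_deriv_fps_deriv own_diff_fps[OF assms] dt_form_def fps_deriv_sum s)
qed

lemma ext_d_scale: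
  assumes "sfn f" "sform k \<omega>"
  shows "dd (f \<cdot> \<omega>) = dd (form0 f) \<wedge> \<omega> + f \<cdot> dd \<omega>"
proof (intro ext)
  fix p vs
  let ?c = "chart_at M p"
  let ?f = "\<lambda>x. f (chart_inv ?c x)"
  note c = chart_at(1)[of p]
  have x: "snd ?c p \<in> snd ?c ` fst ?c" using chart_at(2) by blast
  have l: "local_form M ?c (f \<cdot> \<omega>) = (\<lambda>x vs. ?f x * local_form M ?c \<omega> x vs)"
    by (simp add: fun_eq_iff local_form_def scale_def Let_def)
  have l0: "local_form M ?c (form0 f) = (\<lambda>x. F0 (?f x))"
  proof (intro ext)
    show "local_form M ?c (form0 f) x vs = F0 (?f x) vs" for x vs
      by (cases vs) (simp_all add: local_form_def form0_def Let_def)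
  qed
  have fd: "diff_fps ?f (snd ?c p)"
    using assms(1) c x smooth_fps_diff_fps unfolding sfn_iff by blast
  have "dd (f \<cdot> \<omega>) p vs = coord_d (\<lambda>x vs. ?f x * local_form M ?c \<omega> x vs) (snd ?c p) vs"
    by (simp add: ext_d_coord_d l)
  also have "\<dots> = wedge_alt (coord_d (\<lambda>x. F0 (?f x)) (snd ?c p)) (local_form M ?c \<omega> (snd ?c p)) vs
      + ?f (snd ?c p) * coord_d (local_form M ?c \<omega>) (snd ?c p) vs"
    by (rule coord_d_scale[OF fd own_diff_fps[OF assms(2)]])
  also have "\<dots> = (dd (form0 f) \<wedge> \<omega> + f \<cdot> dd \<omega>) p vs"
    by (simp add: ext_d_coord_d l0 wedge_def scale_def local_form_own chart_inv_left[OF chart_at])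
  finally show "dd (f \<cdot> \<omega>) p vs = (dd (form0 f) \<wedge> \<omega> + f \<cdot> dd \<omega>) p vs" .
qed

lemma ext_d_scale_const:
  assumes "sform k \<omega>"
  shows "dd ((\<lambda>p. a) \<cdot> \<omega>) = (\<lambda>p. a) \<cdot> dd \<omega>"
proof -
  have e0: "dd (form0 (\<lambda>p. a)) = (\<lambda>p vs. 0)"
    by (simp add: fun_eq_iff ext_d_def local_form_def form0_def dir_deriv_const Let_def)
  show ?thesis unfolding ext_d_scale[OF sfn_const assms]
    by (simp add: fun_eq_iff e0 wedge_def wedge_alt_zero_left)
qed

subsection \<open>The codifferential\<close>

lemma smooth_ext_d': "sform k \<omega> \<Longrightarrow> k \<le> 2 \<Longrightarrow> l = Suc k \<Longrightarrow> sform l (dd \<omega>)"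
  using smooth_ext_d by blast

lemma part_sform: "sform k \<omega> \<Longrightarrow> (\<lambda>q. part i (\<omega> q)) = (if i = k then \<omega> else (\<lambda>p vs. 0))"
  by (simp add: fun_eq_iff part_alt[OF smooth_form_alt])

lemma codiff_eq:
  assumes "sform k \<omega>" "k \<le> 3"
  shows "cod \<omega> = (\<lambda>p vs. (-1) ^ (3 * k + 1) * hod (dd (hod \<omega>)) p vs)"
proof (intro ext)
  fix p vs
  have "cod \<omega> p vs = (\<Sum>i\<le>3. if i = k then (-1) ^ (3 * i + 1) * hod (dd (hod \<omega>)) p vs else 0)"
    unfolding codiff_def part_sform[OF assms(1)]
    by (intro sum.cong refl) (simp add: hodge_zero ext_d_0)
  then show "cod \<omega> p vs = (-1) ^ (3 * k + 1) * hod (dd (hod \<omega>)) p vs" using assms(2) by simp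
qed

lemma codiff_1: "sform 1 \<omega> \<Longrightarrow> cod \<omega> = hod (dd (hod \<omega>))"
  using codiff_eq[of 1 \<omega>] by (simp add: fun_eq_iff)

lemma codiff_2: "sform 2 \<omega> \<Longrightarrow> cod \<omega> = - hod (dd (hod \<omega>))"
  using codiff_eq[of 2 \<omega>] by (simp add: fun_eq_iff)

lemma codiff_3: "sform 3 \<omega> \<Longrightarrow> cod \<omega> = hod (dd (hod \<omega>))"
  using codiff_eq[of 3 \<omega>] by (simp add: fun_eq_iff)

text \<open>
  The form \<open>d\<star>\<omega>\<close> has degree four, and the star ignores parts of degree above three.
\<close>

lemma codiff_0:
  assumes "sform 0 \<omega>"
  shows "cod \<omega> = 0"
proof (intro ext)
  fix p vs
  have h: "sform 3 (hod \<omega>)" using smooth_hodge[OF assms] by simp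
  have z: "dd (hod \<omega>) p ws = 0" if "length ws \<noteq> 4" for p ws
    unfolding ext_d_coord_d
  proof (rule coord_d_length[OF open_chart(2)[OF chart_at(1)]])
    show "snd (chart_at M p) p \<in> snd (chart_at M p) ` fst (chart_at M p)" using chart_at(2) by blast
    show "alt_form 3 (local_form M (chart_at M p) (hod \<omega>) y)"
      if "y \<in> snd (chart_at M p) ` fst (chart_at M p)" for y
      by (rule alt_form_local[OF chart_at(1) that smooth_form_alt[OF h]])
  qed (use that in simp)
  have "part k (dd (hod \<omega>) p) = (\<lambda>vs. 0)" if "k \<le> 3" for k
    using z that by (auto simp: part_def fun_eq_iff)
  then have "hod (dd (hod \<omega>)) p = (\<Sum>k\<le>3::nat. 0)"
    unfolding hodge_def by (intro sum.cong) (auto simp: hodge_alt_0 zero_fun_def)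
  then show "cod \<omega> p vs = (0 :: 'm form) p vs" using codiff_eq[OF assms] by simp
qed

lemma codiff_zero: "cod (\<lambda>p vs. 0) = (\<lambda>p vs. 0)"
  using codiff_0[OF sform_zero] by (simp add: zero_fun_def)

lemma sform_codiff:
  assumes "sform (Suc k) \<omega>" "k \<le> 2"
  shows "sform k (cod \<omega>)"
proof -
  have h: "sform (2 - k) (hod \<omega>)" using assms by (intro smooth_hodge) auto
  have d: "sform (3 - k) (dd (hod \<omega>))" using assms by (intro smooth_ext_d'[OF h]) auto
  have "sform k (hod (dd (hod \<omega>)))" using assms(2) by (intro smooth_hodge[OF d]) auto
  from sform_lincomb[OF sfn_const sfn_const this this, of "(-1) ^ (3 * Suc k + 1)" 0]
  show ?thesis using codiff_eq[OF assms(1)] assms(2) by simp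
qed

lemma codiff_add:
  assumes "sform (Suc k) \<alpha>" "sform (Suc k) \<beta>" "k \<le> 2"
  shows "cod (\<alpha> + \<beta>) = cod \<alpha> + cod \<beta>"
proof -
  have h: "sform (2 - k) (hod \<alpha>)" "sform (2 - k) (hod \<beta>)" using assms by (auto intro!: smooth_hodge)
  have d: "sform (3 - k) (dd (hod \<alpha>))" "sform (3 - k) (dd (hod \<beta>))"
    using assms(3) by (auto intro!: smooth_ext_d'[OF h(1)] smooth_ext_d'[OF h(2)])
  have k: "Suc k \<le> 3" "3 - k \<le> 3" using assms(3) by simp_all
  have "hod (dd (hod (\<alpha> + \<beta>))) = hod (dd (hod \<alpha>)) + hod (dd (hod \<beta>))"
    unfolding hodge_add[OF assms(1,2) k(1)] ext_d_add[OF h] hodge_add[OF d k(2)] ..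
  then show ?thesis
    unfolding codiff_eq[OF sform_add[OF assms(1,2)] k(1)] codiff_eq[OF assms(1) k(1)] codiff_eq[OF assms(2) k(1)]
    by (simp add: fun_eq_iff algebra_simps)
qed

lemma codiff_dt:
  assumes "sform (Suc k) \<omega>" "k \<le> 2"
  shows "cod (dt_form \<omega>) = dt_form (cod \<omega>)"
proof -
  have h: "sform (2 - k) (hod \<omega>)" using assms by (auto intro!: smooth_hodge)
  have d: "sform (3 - k) (dd (hod \<omega>))" using assms by (intro smooth_ext_d'[OF h]) auto
  have k: "Suc k \<le> 3" "3 - k \<le> 3" using assms(2) by simp_all
  have "hod (dd (hod (dt_form \<omega>))) = dt_form (hod (dd (hod \<omega>)))"
    unfolding hodge_dt[OF assms(1) k(1)] ext_d_dt[OF h] hodge_dt[OF d k(2)] ..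
  moreover have "fps_deriv ((-1) ^ i * F) = (-1) ^ i * fps_deriv F" for i and F :: "real fps"
    by (induction i) (simp_all add: mult.assoc)
  ultimately show ?thesis
    unfolding codiff_eq[OF sform_dt[OF assms(1)] k(1)] codiff_eq[OF assms(1) k(1)]
    by (simp add: fun_eq_iff dt_form_def)
qed

text \<open>
  Up to sign \<open>\<delta>\<delta> = \<star>d\<star>\<star>d\<star> = \<star>dd\<star>\<close>.
\<close>

lemma codiff_codiff:
  assumes "sform (Suc (Suc k)) \<omega>" "k \<le> 1"
  shows "cod (cod \<omega>) = 0"
proof -
  have h: "sform (1 - k) (hod \<omega>)" using assms by (auto intro!: smooth_hodge)
  have d: "sform (2 - k) (dd (hod \<omega>))" using assms by (intro smooth_ext_d'[OF h]) auto
  have s: "sform (Suc k) (hod (dd (hod \<omega>)))" using assms(2) by (intro smooth_hodge[OF d]) auto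
  have k: "Suc k \<le> 3" "Suc (Suc k) \<le> 3" "2 - k \<le> 3" "1 - k \<le> 1" using assms(2) by simp_all
  \<comment> \<open>Here a is the sign of the inner codifferential.\<close>
  have c: "cod (\<lambda>p vs. a * hod (dd (hod \<omega>)) p vs) = 0" if "a = 1 \<or> a = -1" for a
  proof -
    have sa: "sform (Suc k) (\<lambda>p vs. a * hod (dd (hod \<omega>)) p vs)"
      using sform_lincomb[OF sfn_const sfn_const s s, of a 0] by simp
    have "hod (\<lambda>p vs. a * hod (dd (hod \<omega>)) p vs) = (\<lambda>p vs. a * hod (hod (dd (hod \<omega>))) p vs)"
      using hodge_lincomb[OF s s k(1), of "\<lambda>p. a" "\<lambda>p. 0"] by simp
    also have "\<dots> = (\<lambda>p vs. a * dd (hod \<omega>) p vs)" unfolding hodge_hodge[OF d k(3)] ..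
    also have "\<dots> = dd (\<lambda>p vs. a * (hod \<omega>) p vs)"
      using ext_d_scale_const[OF h, of a] by (simp add: fun_eq_iff scale_def[abs_def])
    finally have e: "dd (hod (\<lambda>p vs. a * hod (dd (hod \<omega>)) p vs)) = dd (dd (\<lambda>p vs. a * (hod \<omega>) p vs))" by simp
    have "sform (1 - k) (\<lambda>p vs. a * (hod \<omega>) p vs)"
      using sform_lincomb[OF sfn_const sfn_const h h, of a 0] by simp
    then have "dd (hod (\<lambda>p vs. a * hod (dd (hod \<omega>)) p vs)) = (\<lambda>p vs. 0)"
      unfolding e using ext_d_ext_d k(4) by (simp add: zero_fun_def)
    then show ?thesis unfolding codiff_eq[OF sa k(1)] by (simp add: hodge_zero zero_fun_def)
  qed
  have "(-1 :: real fps) ^ n = 1 \<or> (-1 :: real fps) ^ n = -1" for n by (cases "even n") auto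
  then show ?thesis unfolding codiff_eq[OF assms(1) k(2)] by (rule c)
qed

end

section \<open>The exponential of a power series\<close>

definition exp_fps :: "real fps \<Rightarrow> real fps" where
  "exp_fps f = Abs_fps (\<lambda>n. \<Sum>k. fps_nth (f ^ k) n / fact k)"

lemma exp_fn_exp_fps: "exp_fn f p = exp_fps (f p)"
  by (simp add: exp_fn_def exp_fps_def)

text \<open>
  The coefficientwise sum of \<open>s k / k!\<close>, for sequences such as \<open>s k = f ^ k\<close> and its formal derivatives
  with respect to \<open>f\<close>.
\<close>

definition exp_sums :: "(nat \<Rightarrow> real fps) \<Rightarrow> real fps \<Rightarrow> bool" where
  "exp_sums s S \<longleftrightarrow> (\<forall>n. (\<lambda>k. fps_nth (s k) n / fact k) sums fps_nth S n)"

lemma exp_sums_unique: "exp_sums s S \<Longrightarrow> exp_sums s T \<Longrightarrow> S = T"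
  unfolding exp_sums_def fps_eq_iff using sums_unique2 by blast

lemma exp_sums_eq: "exp_sums s S \<Longrightarrow> Abs_fps (\<lambda>n. \<Sum>k. fps_nth (s k) n / fact k) = S"
  unfolding exp_sums_def fps_eq_iff by (simp add: sums_iff)

lemma exp_sums_add: "exp_sums s S \<Longrightarrow> exp_sums t T \<Longrightarrow> exp_sums (\<lambda>k. s k + t k) (S + T)"
  unfolding exp_sums_def by (auto simp: add_divide_distrib intro!: sums_add)

lemma exp_sums_mult:
  assumes "exp_sums s S"
  shows "exp_sums (\<lambda>k. s k * c) (S * c)"
  unfolding exp_sums_def
proof
  fix n
  have "(\<lambda>k. \<Sum>i=0..n. fps_nth (s k) i / fact k * fps_nth c (n - i)) sums
      (\<Sum>i=0..n. fps_nth S i * fps_nth c (n - i))"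
    using assms unfolding exp_sums_def by (intro sums_sum sums_mult2) blast
  then show "(\<lambda>k. fps_nth (s k * c) n / fact k) sums fps_nth (S * c) n"
    by (simp add: fps_mult_nth sum_divide_distrib)
qed

text \<open>
  The norm \<open>\<Sum>\<^sub>j\<^sub>\<le>\<^sub>n |f\<^sub>j|\<close> on series truncated at degree \<open>n\<close> is submultiplicative.
\<close>

lemma power_coeff_bound:
  fixes f :: "real fps"
  assumes "i \<le> n"
  shows "\<bar>fps_nth (f ^ k) i\<bar> \<le> (\<Sum>j=0..n. \<bar>fps_nth f j\<bar>) ^ k"
  using assms
proof (induction k arbitrary: i)
  case 0
  then show ?case by simp
next
  case (Suc k)
  let ?B = "\<Sum>j=0..n. \<bar>fps_nth f j\<bar>"
  have "\<bar>fps_nth (f ^ Suc k) i\<bar> \<le> (\<Sum>j=0..i. \<bar>fps_nth f j * fps_nth (f ^ k) (i - j)\<bar>)"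
    by (simp add: fps_mult_nth sum_abs)
  also have "\<dots> \<le> (\<Sum>j=0..i. \<bar>fps_nth f j\<bar> * ?B ^ k)"
    using Suc by (intro sum_mono) (auto simp: abs_mult intro!: mult_left_mono)
  also have "\<dots> = (\<Sum>j=0..i. \<bar>fps_nth f j\<bar>) * ?B ^ k" by (simp add: sum_distrib_right)
  also have "\<dots> \<le> ?B * ?B ^ k"
    using Suc.prems by (intro mult_right_mono sum_mono2) (auto intro: sum_nonneg)
  finally show ?case by simp
qed

lemma exp_sums_exp_fps: "exp_sums (\<lambda>k. f ^ k) (exp_fps f)"
  unfolding exp_sums_def
proof
  fix n
  let ?B = "\<Sum>j=0..n. \<bar>fps_nth f j\<bar>"
  have s: "summable (\<lambda>k. ?B ^ k / fact k)"
    using summable_exp[of ?B] by (simp add: field_simps)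
  have b: "norm (fps_nth (f ^ k) n / fact k) \<le> ?B ^ k / fact k" for k
    using power_coeff_bound[of n n f k] by (simp add: divide_right_mono)
  have "summable (\<lambda>k. fps_nth (f ^ k) n / fact k)"
    by (rule summable_comparison_test'[OF s b])
  then show "(\<lambda>k. fps_nth (f ^ k) n / fact k) sums fps_nth (exp_fps f) n"
    by (simp add: exp_fps_def summable_sums)
qed

text \<open>
  The first and second derivatives of \<open>f ^ k\<close> with respect to \<open>f\<close>.  They arise when the \<open>k\<close>-th power of
  \<open>f + N\<close> is expanded with \<open>N\<^sup>3 = 0\<close>.
\<close>

definition dpow :: "real fps \<Rightarrow> nat \<Rightarrow> real fps" where
  "dpow f k = of_nat k * f ^ (k - 1)"

definition ddpow :: "real fps \<Rightarrow> nat \<Rightarrow> real fps" where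
  "ddpow f k = of_nat (k * (k - 1)) * f ^ (k - 2)"

lemma dpow_Suc: "dpow f (Suc k) = f * dpow f k + f ^ k" "ddpow f (Suc k) = f * ddpow f k + 2 * dpow f k"
proof -
  show "dpow f (Suc k) = f * dpow f k + f ^ k"
    by (cases k) (simp_all add: dpow_def algebra_simps)
  show "ddpow f (Suc k) = f * ddpow f k + 2 * dpow f k"
  proof (cases k)
    case (Suc j)
    then show ?thesis by (cases j) (simp_all add: dpow_def ddpow_def algebra_simps)
  qed (simp add: dpow_def ddpow_def)
qed

lemma dpow_0: "dpow f 0 = 0" "ddpow f 0 = 0"
  by (simp_all add: dpow_def ddpow_def)

lemma exp_sums_shift:
  assumes "exp_sums s S" "t 0 = 0" "\<And>k. t (Suc k) = of_nat (Suc k) * s k"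
  shows "exp_sums t S"
  unfolding exp_sums_def
proof
  fix n
  have "fps_nth (t (Suc k)) n / fact (Suc k) = fps_nth (s k) n / fact k" for k
  proof -
    have "t (Suc k) = fps_const (real (Suc k)) * s k" by (simp only: assms(3) fps_of_nat)
    then have "fps_nth (t (Suc k)) n = real (Suc k) * fps_nth (s k) n" by (simp del: of_nat_Suc)
    then show ?thesis by (simp add: fact_Suc del: of_nat_Suc)
  qed
  then have "(\<lambda>k. fps_nth (t (Suc k)) n / fact (Suc k)) sums fps_nth S n"
    using assms(1) unfolding exp_sums_def by simp
  then show "(\<lambda>k. fps_nth (t k) n / fact k) sums fps_nth S n"
    using assms(2) sums_Suc[of "\<lambda>k. fps_nth (t k) n / fact k" "fps_nth S n"] by simp
qed

text \<open>
  The exponential series reproduces itself when it is differentiated term by term.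
\<close>

lemma exp_sums_dpow: "exp_sums (dpow f) (exp_fps f)" "exp_sums (ddpow f) (exp_fps f)"
proof -
  show 1: "exp_sums (dpow f) (exp_fps f)"
    by (rule exp_sums_shift[OF exp_sums_exp_fps]) (simp_all add: dpow_def)
  show "exp_sums (ddpow f) (exp_fps f)"
    by (rule exp_sums_shift[OF 1]) (simp_all add: dpow_def ddpow_def algebra_simps)
qed

lemma exp_fps_0: "fps_nth (exp_fps f) 0 = exp (fps_nth f 0)"
  by (simp add: exp_fps_def exp_def fps_power_zeroth divide_inverse mult.commute)

lemma exp_fps_deriv: "fps_deriv (exp_fps f) = exp_fps f * fps_deriv f"
proof -
  have a: "exp_sums (\<lambda>k. dpow f k * fps_deriv f) (exp_fps f * fps_deriv f)"
    by (rule exp_sums_mult[OF exp_sums_dpow(1)])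
  have d: "dpow f k * fps_deriv f = fps_deriv (f ^ k)" for k
    by (simp add: dpow_def fps_deriv_power fps_of_nat mult_ac)
  have "exp_sums (\<lambda>k. fps_deriv (f ^ k)) (fps_deriv (exp_fps f))"
    unfolding exp_sums_def
  proof
    fix n
    have "(\<lambda>k. of_nat (n + 1) * (fps_nth (f ^ k) (n + 1) / fact k)) sums (of_nat (n + 1) * fps_nth (exp_fps f) (n + 1))"
      using exp_sums_exp_fps[of f] unfolding exp_sums_def by (intro sums_mult) blast
    then show "(\<lambda>k. fps_nth (fps_deriv (f ^ k)) n / fact k) sums fps_nth (fps_deriv (exp_fps f)) n"
      by simp
  qed
  then show ?thesis using a exp_sums_unique unfolding d by blast
qed

lemma fps_linear_ode_unique:
  fixes y z g :: "real fps"
  assumes "fps_deriv y = y * g" "fps_deriv z = z * g" "fps_nth y 0 = fps_nth z 0"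
  shows "y = z"
proof (rule fps_ext)
  fix n
  show "fps_nth y n = fps_nth z n"
  proof (induction n rule: less_induct)
    case (less n)
    show ?case
    proof (cases n)
      case 0
      then show ?thesis using assms(3) by simp
    next
      case (Suc m)
      have "of_nat (m + 1) * fps_nth y (m + 1) = fps_nth (y * g) m" using assms(1) by (metis fps_deriv_nth)
      also have "\<dots> = fps_nth (z * g) m" unfolding fps_mult_nth using less Suc by (intro sum.cong) auto
      also have "\<dots> = of_nat (m + 1) * fps_nth z (m + 1)" using assms(2) by (metis fps_deriv_nth)
      finally show ?thesis using Suc by simp
    qed
  qed
qed

definition ln_fps :: "real fps \<Rightarrow> real fps" where
  "ln_fps r = fps_integral (fps_deriv r * inverse r) (ln (fps_nth r 0))"

text \<open>
  Both sides solve \<open>y' = y r' / r\<close> with the same constant coefficient.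
\<close>

lemma exp_fps_ln_fps:
  assumes "fps_nth r 0 > 0"
  shows "exp_fps (ln_fps r) = r"
proof (rule fps_linear_ode_unique)
  have i: "inverse r * r = 1" using assms by (intro inverse_mult_eq_1) simp
  have d: "fps_deriv (ln_fps r) = fps_deriv r * inverse r" by (simp add: ln_fps_def fps_deriv_fps_integral)
  show "fps_deriv (exp_fps (ln_fps r)) = exp_fps (ln_fps r) * (fps_deriv r * inverse r)"
    unfolding exp_fps_deriv d ..
  have "r * (fps_deriv r * inverse r) = fps_deriv r * (inverse r * r)" by (simp only: mult_ac)
  then show "fps_deriv r = r * (fps_deriv r * inverse r)" using i by simp
  show "fps_nth (exp_fps (ln_fps r)) 0 = fps_nth r 0"
    using assms by (simp add: exp_fps_0 ln_fps_def fps_integral_def)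
qed

lemma smooth_fps_exp_fps:
  assumes S: "open S" and F: "smooth_fps S F"
  shows "smooth_fps S (\<lambda>x. exp_fps (F x))"
proof -
  have "smooth_on S (\<lambda>x. fps_nth (exp_fps (F x)) n)" for n
  proof (induction n rule: less_induct)
    case (less n)
    show ?case
    proof (cases n)
      case 0
      then show ?thesis using F S by (simp add: exp_fps_0 smooth_fps_def smooth_on_exp)
    next
      case (Suc m)
      have e: "inverse (of_nat (m + 1)) * (\<Sum>i=0..m. fps_nth (exp_fps (F x)) i * fps_nth (fps_deriv (F x)) (m - i)) = fps_nth (exp_fps (F x)) n" for x
      proof -
        have "fps_nth (fps_deriv (exp_fps (F x))) m = fps_nth (exp_fps (F x) * fps_deriv (F x)) m"
          unfolding exp_fps_deriv ..
        then have "of_nat (m + 1) * fps_nth (exp_fps (F x)) (m + 1) =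
            (\<Sum>i=0..m. fps_nth (exp_fps (F x)) i * fps_nth (fps_deriv (F x)) (m - i))"
          unfolding fps_mult_nth fps_deriv_nth by simp
        then show ?thesis unfolding Suc by (simp add: field_simps)
      qed
      have "smooth_on S (\<lambda>x. inverse (of_nat (m + 1)) * (\<Sum>i=0..m. fps_nth (exp_fps (F x)) i * fps_nth (fps_deriv (F x)) (m - i)))"
        using less Suc smooth_fps_deriv[OF S F]
        by (intro smooth_on_mult smooth_on_const smooth_on_sum S) (auto simp: smooth_fps_def simp del: fps_deriv_nth)
      then show ?thesis unfolding e .
    qed
  qed
  then show ?thesis by (simp add: smooth_fps_def)
qed

lemma smooth_fps_ln_fps:
  assumes S: "open S" and F: "smooth_fps S F" and pos: "\<And>x. x \<in> S \<Longrightarrow> fps_nth (F x) 0 > 0"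
  shows "smooth_fps S (\<lambda>x. ln_fps (F x))"
  unfolding smooth_fps_def
proof
  fix n
  have "smooth_fps S (\<lambda>x. fps_deriv (F x) * inverse (F x))"
    using pos[THEN less_imp_neq, THEN not_sym] by (intro smooth_fps_mult smooth_fps_deriv smooth_fps_inverse S F)
  then have g: "smooth_on S (\<lambda>x. fps_nth (fps_deriv (F x) * inverse (F x)) m)" for m by (simp add: smooth_fps_def)
  show "smooth_on S (\<lambda>x. fps_nth (ln_fps (F x)) n)"
  proof (cases n)
    case 0
    have "smooth_on S (\<lambda>x. ln (fps_nth (F x) 0))"
      using F pos by (intro smooth_on_ln S) (auto simp: smooth_fps_def)
    then show ?thesis using 0 by (simp add: ln_fps_def fps_integral_def)
  next
    case (Suc m)
    have "smooth_on S (\<lambda>x. inverse (of_nat n) * fps_nth (fps_deriv (F x) * inverse (F x)) m)"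
      by (intro smooth_on_mult smooth_on_const S g)
    then show ?thesis using Suc by (simp add: ln_fps_def fps_integral_def)
  qed
qed

section \<open>Powers and the exponential of an element of degree zero\<close>

lemma alt_form_sum':
  assumes "\<And>i. i \<in> I \<Longrightarrow> alt_form k (\<alpha> i)"
  shows "alt_form k (\<lambda>vs. \<Sum>i\<in>I. \<alpha> i vs)"
  using assms
proof (induction I rule: infinite_finite_induct)
  case (insert i I)
  then show ?case using alt_form_lincomb[of k "\<alpha> i" "\<lambda>vs. \<Sum>i\<in>I. \<alpha> i vs" 1 1] by simp
qed (simp_all add: alt_form_def)

lemma grade_sign_alt:
  assumes "alt_form l (\<omega> p)"
  shows "grade_sign n \<omega> p = (\<lambda>vs. (-1) ^ (n * l) * \<omega> p vs)"
proof
  fix vs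
  show "grade_sign n \<omega> p vs = (-1) ^ (n * l) * \<omega> p vs"
    using alt_form_length[OF assms, of vs] by (cases "length vs = l") (simp_all add: grade_sign_def)
qed

lemma alt_form_scale: "alt_form k \<alpha> \<Longrightarrow> alt_form k (\<lambda>vs. c * \<alpha> vs)"
  using alt_form_lincomb[of k \<alpha> \<alpha> c 0] by simp

lemma alt_form_elem_mult:
  assumes x: "\<And>\<mu>. alt_form (mdeg \<mu>) (x \<mu> p)" and y: "\<And>\<mu>. alt_form (mdeg \<mu>) (y \<mu> p)"
  shows "alt_form (mdeg \<mu>) (elem_mult x y \<mu> p)"
proof -
  obtain a b m where \<mu>: "\<mu> = (a, b, m)" by (cases \<mu>)
  have "alt_form (mdeg (a, b, m)) (\<lambda>vs. (if b1 \<and> a2 then -1 else 1) *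
      (x (a1, b1, m1) \<wedge> grade_sign (mdeg (a1, b1, m1)) (y (a2, b2, m - m1))) p vs)"
    if "a1 \<longrightarrow> a" "b1 \<longrightarrow> b" "m1 \<le> m" "a2 = (a \<and> \<not> a1)" "b2 = (b \<and> \<not> b1)" for a1 b1 m1 a2 b2
  proof -
    have "alt_form (mdeg (a2, b2, m - m1)) (grade_sign (mdeg (a1, b1, m1)) (y (a2, b2, m - m1)) p)"
      unfolding grade_sign_alt[of "mdeg (a2, b2, m - m1)" "y (a2, b2, m - m1)" p, OF y] by (rule alt_form_scale[OF y])
    from alt_form_wedge'[OF x this, of "(a1, b1, m1)" "mdeg (a, b, m)"]
    have "alt_form (mdeg (a, b, m)) ((x (a1, b1, m1) \<wedge> grade_sign (mdeg (a1, b1, m1)) (y (a2, b2, m - m1))) p)"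
      using that by (cases a; cases b; cases a1; cases b1) (simp_all add: wedge_def)
    then show ?thesis by (rule alt_form_scale)
  qed
  then show ?thesis
    unfolding \<mu> elem_mult.simps Let_def by (intro alt_form_sum') blast
qed

lemma alt_form_elem_power:
  assumes x: "\<And>\<mu>. alt_form (mdeg \<mu>) (x \<mu> p)"
  shows "alt_form (mdeg \<mu>) (elem_power x k \<mu> p)"
proof (induction k arbitrary: \<mu>)
  case 0
  show ?case
    using alt_form_F0 by (auto simp: elem_power_def elem_one_def tens_def form0_F0 alt_form_def zero_fun_def)
next
  case (Suc k)
  have "elem_power x (Suc k) = elem_mult x (elem_power x k)" by (simp add: elem_power_def)
  then show ?case using alt_form_elem_mult[where x = x and y = "elem_power x k" and p = p, OF x Suc] by simp
qed

lemma Collect_imp_simps: "{a. a \<longrightarrow> True} = {False, True}" "{a. a \<longrightarrow> False} = {False}"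
  by auto

text \<open>
  These seven products suffice, since in degree above three all coefficients vanish.
\<close>

lemma elem_mult_expand:
  "elem_mult x y (False, False, 0) p vs = (x (False, False, 0) \<wedge> grade_sign 0 (y (False, False, 0))) p vs"
  "elem_mult x y (True, False, 0) p vs = (x (False, False, 0) \<wedge> grade_sign 0 (y (True, False, 0))) p vs
     + (x (True, False, 0) \<wedge> grade_sign 1 (y (False, False, 0))) p vs"
  "elem_mult x y (False, True, 0) p vs = (x (False, False, 0) \<wedge> grade_sign 0 (y (False, True, 0))) p vs
     + (x (False, True, 0) \<wedge> grade_sign 1 (y (False, False, 0))) p vs"
  "elem_mult x y (True, True, 0) p vs = (x (False, False, 0) \<wedge> grade_sign 0 (y (True, True, 0))) p vs
     - (x (False, True, 0) \<wedge> grade_sign 1 (y (True, False, 0))) p vs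
     + (x (True, False, 0) \<wedge> grade_sign 1 (y (False, True, 0))) p vs
     + (x (True, True, 0) \<wedge> grade_sign 2 (y (False, False, 0))) p vs"
  "elem_mult x y (False, False, 1) p vs = (x (False, False, 0) \<wedge> grade_sign 0 (y (False, False, Suc 0))) p vs
     + (x (False, False, Suc 0) \<wedge> grade_sign 2 (y (False, False, 0))) p vs"
  "elem_mult x y (True, False, 1) p vs = (x (False, False, 0) \<wedge> grade_sign 0 (y (True, False, Suc 0))) p vs
     + (x (False, False, Suc 0) \<wedge> grade_sign 2 (y (True, False, 0))) p vs
     + (x (True, False, 0) \<wedge> grade_sign 1 (y (False, False, Suc 0))) p vs
     + (x (True, False, Suc 0) \<wedge> grade_sign 3 (y (False, False, 0))) p vs"
  "elem_mult x y (False, True, 1) p vs = (x (False, False, 0) \<wedge> grade_sign 0 (y (False, True, Suc 0))) p vs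
     + (x (False, False, Suc 0) \<wedge> grade_sign 2 (y (False, True, 0))) p vs
     + (x (False, True, 0) \<wedge> grade_sign 1 (y (False, False, Suc 0))) p vs
     + (x (False, True, Suc 0) \<wedge> grade_sign 3 (y (False, False, 0))) p vs"
  unfolding elem_mult.simps Collect_imp_simps Let_def
  by (simp_all add: numeral_2_eq_2 numeral_3_eq_3)

lemma elem_exp_eqI:
  assumes "\<And>k. elem_power x k \<mu> p vs = f ^ k * a0 + dpow f k * a1 + ddpow f k * a2"
  shows "elem_exp x \<mu> p vs = exp_fps f * (a0 + a1 + a2)"
proof -
  have "exp_sums (\<lambda>k. f ^ k * a0 + dpow f k * a1 + ddpow f k * a2) (exp_fps f * a0 + exp_fps f * a1 + exp_fps f * a2)"
    by (intro exp_sums_add exp_sums_mult exp_sums_exp_fps exp_sums_dpow)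
  then have "exp_sums (\<lambda>k. elem_power x k \<mu> p vs) (exp_fps f * (a0 + a1 + a2))"
    unfolding assms by (simp add: algebra_simps)
  from exp_sums_eq[OF this] show ?thesis unfolding elem_exp_def .
qed

lemma elem_of_simps:
  "elem_of f X V \<pi> \<sigma> \<Phi> \<Psi> (False, False, 0) = form0 f"
  "elem_of f X V \<pi> \<sigma> \<Phi> \<Psi> (True, False, 0) = X"
  "elem_of f X V \<pi> \<sigma> \<Phi> \<Psi> (False, True, 0) = V"
  "elem_of f X V \<pi> \<sigma> \<Phi> \<Psi> (True, True, 0) = \<pi>"
  "elem_of f X V \<pi> \<sigma> \<Phi> \<Psi> (False, False, Suc 0) = \<sigma>"
  "elem_of f X V \<pi> \<sigma> \<Phi> \<Psi> (True, False, Suc 0) = \<Phi>"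
  "elem_of f X V \<pi> \<sigma> \<Phi> \<Psi> (False, True, Suc 0) = \<Psi>"
  "elem_of f X V \<pi> \<sigma> \<Phi> \<Psi> (True, True, Suc 0) = 0"
  "elem_of f X V \<pi> \<sigma> \<Phi> \<Psi> (a, b, Suc (Suc m)) = 0"
  by (simp_all add: elem_of_def tens_def)

text \<open>
  Products of three coefficients other than that of 1 do not occur: \<open>dt\<close> and \<open>\<epsilon>\<close> appear at most
  once, and \<open>d\<epsilon>\<close> has degree two.  In \<open>dt \<epsilon>\<close> the two orders of \<open>X dt\<close> and \<open>V \<epsilon>\<close> both contribute
  \<open>- X V\<close>.
\<close>

lemma elem_of_power:
  assumes X: "alt_form 1 (X p)" and V: "alt_form 1 (V p)" and \<pi>: "alt_form 2 (\<pi> p)" and \<sigma>: "alt_form 2 (\<sigma> p)"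
  shows "elem_power (elem_of f X V \<pi> \<sigma> \<Phi> \<Psi>) k (False, False, 0) p = F0 (f p ^ k)
    \<and> elem_power (elem_of f X V \<pi> \<sigma> \<Phi> \<Psi>) k (True, False, 0) p = (\<lambda>vs. dpow (f p) k * X p vs)
    \<and> elem_power (elem_of f X V \<pi> \<sigma> \<Phi> \<Psi>) k (False, True, 0) p = (\<lambda>vs. dpow (f p) k * V p vs)
    \<and> elem_power (elem_of f X V \<pi> \<sigma> \<Phi> \<Psi>) k (True, True, 0) p =
        (\<lambda>vs. dpow (f p) k * \<pi> p vs - ddpow (f p) k * wedge_alt (X p) (V p) vs)
    \<and> elem_power (elem_of f X V \<pi> \<sigma> \<Phi> \<Psi>) k (False, False, 1) p = (\<lambda>vs. dpow (f p) k * \<sigma> p vs)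
    \<and> elem_power (elem_of f X V \<pi> \<sigma> \<Phi> \<Psi>) k (True, False, 1) p =
        (\<lambda>vs. dpow (f p) k * \<Phi> p vs + ddpow (f p) k * wedge_alt (X p) (\<sigma> p) vs)
    \<and> elem_power (elem_of f X V \<pi> \<sigma> \<Phi> \<Psi>) k (False, True, 1) p =
        (\<lambda>vs. dpow (f p) k * \<Psi> p vs + ddpow (f p) k * wedge_alt (V p) (\<sigma> p) vs)"
    (is "?P k")
proof (induction k)
  case 0
  show ?case by (simp add: elem_power_def elem_one_def tens_def form0_F0 dpow_0 zero_fun_def)
next
  case (Suc k)
  let ?x = "elem_of f X V \<pi> \<sigma> \<Phi> \<Psi>"
  define y where "y = elem_power ?x k"
  have S: "elem_power ?x (Suc k) = elem_mult ?x y" by (simp add: elem_power_def y_def)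
  note IH = Suc.IH[folded y_def]
  have g0: "grade_sign n (y (False, False, 0)) p = F0 (f p ^ k)" for n
    using grade_sign_alt[of 0 "y (False, False, 0)" p n] IH alt_form_F0 by simp
  have a1: "alt_form 1 (y (True, False, 0) p)" "alt_form 1 (y (False, True, 0) p)"
    using IH alt_form_scale[OF X] alt_form_scale[OF V] by simp_all
  have g1: "grade_sign n (y (True, False, 0)) p = (\<lambda>vs. ((-1) ^ n * dpow (f p) k) * X p vs)"
    "grade_sign n (y (False, True, 0)) p = (\<lambda>vs. ((-1) ^ n * dpow (f p) k) * V p vs)" for n
    using grade_sign_alt[of 1 "y (True, False, 0)" p n, OF a1(1)]
      grade_sign_alt[of 1 "y (False, True, 0)" p n, OF a1(2)] IH by (simp_all add: mult.assoc)
  have g2: "grade_sign n (y (False, False, Suc 0)) p = (\<lambda>vs. dpow (f p) k * \<sigma> p vs)" for n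
    using grade_sign_alt[of 2 "y (False, False, 1)" p n] IH alt_form_scale[OF \<sigma>] by simp
  have gz: "grade_sign 0 \<omega> = \<omega>" for \<omega> :: "'m form" by (simp add: fun_eq_iff grade_sign_def)
  have w: "wedge_alt (V p) (X p) vs = - wedge_alt (X p) (V p) vs"
    "wedge_alt (\<sigma> p) (X p) vs = wedge_alt (X p) (\<sigma> p) vs"
    "wedge_alt (\<sigma> p) (V p) vs = wedge_alt (V p) (\<sigma> p) vs" for vs
    using wedge_anticommute_1[OF X V] wedge_commute_1_2[OF X \<sigma>] wedge_commute_1_2[OF V \<sigma>] by simp_all
  have wm: "wedge_alt \<alpha> (\<lambda>ws. - \<beta> ws) vs = - wedge_alt \<alpha> \<beta> vs" for \<alpha> \<beta> vs
    using wedge_alt_scale_right[of \<alpha> "-1" \<beta> vs] by simp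
  show ?case
    unfolding S fun_eq_iff elem_mult_expand
    by (simp add: elem_of_simps wedge_def form0_F0 wedge_F0_left wedge_F0_right
        g0 g1 g2 gz wedge_alt_linear w IH[unfolded One_nat_def] F0_if wm)
      (simp add: dpow_Suc algebra_simps)
qed

lemma elem_exp_values:
  assumes X: "\<And>p. alt_form 1 (X p)" and V: "\<And>p. alt_form 1 (V p)"
    and \<pi>: "\<And>p. alt_form 2 (\<pi> p)" and \<sigma>: "\<And>p. alt_form 2 (\<sigma> p)"
    and G_def: "G = elem_exp (elem_of f X V \<pi> \<sigma> \<Phi> \<Psi>)"
  shows "G (False, False, 0) = form0 (exp_fn f)"
    "G (True, False, 0) = exp_fn f \<cdot> X" "G (False, True, 0) = exp_fn f \<cdot> V"
    "G (True, True, 0) = exp_fn f \<cdot> (\<pi> - X \<wedge> V)" "G (False, False, Suc 0) = exp_fn f \<cdot> \<sigma>"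
    "G (True, False, Suc 0) = exp_fn f \<cdot> (\<Phi> + X \<wedge> \<sigma>)" "G (False, True, Suc 0) = exp_fn f \<cdot> (\<Psi> + V \<wedge> \<sigma>)"
proof -
  let ?x = "elem_of f X V \<pi> \<sigma> \<Phi> \<Psi>"
  note P = elem_of_power[where X = X and V = V and \<pi> = \<pi> and \<sigma> = \<sigma> and f = f and \<Phi> = \<Phi> and \<Psi> = \<Psi>,
      OF X V \<pi> \<sigma>, unfolded One_nat_def]
  have "G (False, False, 0) p vs = exp_fps (f p) * (F0 1 vs + 0 + 0)" for p vs
    unfolding G_def by (rule elem_exp_eqI) (simp add: P F0_if)
  then show "G (False, False, 0) = form0 (exp_fn f)"
    by (simp add: fun_eq_iff form0_F0 exp_fn_exp_fps F0_if)
  have "G (True, False, 0) p vs = exp_fps (f p) * (0 + X p vs + 0)" for p vs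
    unfolding G_def by (rule elem_exp_eqI) (simp add: P)
  then show "G (True, False, 0) = exp_fn f \<cdot> X" by (simp add: fun_eq_iff scale_def exp_fn_exp_fps)
  have "G (False, True, 0) p vs = exp_fps (f p) * (0 + V p vs + 0)" for p vs
    unfolding G_def by (rule elem_exp_eqI) (simp add: P)
  then show "G (False, True, 0) = exp_fn f \<cdot> V" by (simp add: fun_eq_iff scale_def exp_fn_exp_fps)
  have "G (True, True, 0) p vs = exp_fps (f p) * (0 + \<pi> p vs + - wedge_alt (X p) (V p) vs)" for p vs
    unfolding G_def by (rule elem_exp_eqI) (simp add: P)
  then show "G (True, True, 0) = exp_fn f \<cdot> (\<pi> - X \<wedge> V)"
    by (simp add: fun_eq_iff scale_def exp_fn_exp_fps wedge_def)
  have "G (False, False, Suc 0) p vs = exp_fps (f p) * (0 + \<sigma> p vs + 0)" for p vs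
    unfolding G_def by (rule elem_exp_eqI) (simp add: P)
  then show "G (False, False, Suc 0) = exp_fn f \<cdot> \<sigma>" by (simp add: fun_eq_iff scale_def exp_fn_exp_fps)
  have "G (True, False, Suc 0) p vs = exp_fps (f p) * (0 + \<Phi> p vs + wedge_alt (X p) (\<sigma> p) vs)" for p vs
    unfolding G_def by (rule elem_exp_eqI) (simp add: P)
  then show "G (True, False, Suc 0) = exp_fn f \<cdot> (\<Phi> + X \<wedge> \<sigma>)"
    by (simp add: fun_eq_iff scale_def exp_fn_exp_fps wedge_def)
  have "G (False, True, Suc 0) p vs = exp_fps (f p) * (0 + \<Psi> p vs + wedge_alt (V p) (\<sigma> p) vs)" for p vs
    unfolding G_def by (rule elem_exp_eqI) (simp add: P)
  then show "G (False, True, Suc 0) = exp_fn f \<cdot> (\<Psi> + V \<wedge> \<sigma>)"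
    by (simp add: fun_eq_iff scale_def exp_fn_exp_fps wedge_def)
qed

text \<open>
  There are no nonzero forms of degree above three.
\<close>

lemma elem_exp_high:
  assumes x: "\<And>\<mu> p. alt_form (mdeg \<mu>) (x \<mu> p)" and \<mu>: "mdeg \<mu> > 3"
  shows "elem_exp x \<mu> = 0"
proof (intro ext)
  fix p vs
  have "elem_power x k \<mu> p = 0" for k
    by (rule alt_form_gt_3[OF alt_form_elem_power \<mu>]) (rule x)
  then show "elem_exp x \<mu> p vs = (0 :: 'a form) p vs"
    by (simp add: elem_exp_def fps_eq_iff)
qed

lemma ip_expand_left:
  assumes g: "inner_product g"
  shows "g w v = (\<Sum>i\<in>UNIV. w $ i * g (axis i 1) v)"
proof -
  have "w = w $ 1 *\<^sub>R e1 + w $ 2 *\<^sub>R e2 + w $ 3 *\<^sub>R e3" by (simp add: vec_eq_iff forall_3)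
  then have "g w v = g (w $ 1 *\<^sub>R e1 + w $ 2 *\<^sub>R e2 + w $ 3 *\<^sub>R e3) v" by simp
  then show ?thesis by (simp add: ip_add[OF g] ip_scale[OF g] sum_3)
qed

context riemannian_3manifold
begin

section \<open>The homotopy equations\<close>

lemma degree_zero_elem_of_iff:
  "degree_zero M (elem_of f X V \<pi> \<sigma> \<Phi> \<Psi>) \<longleftrightarrow>
    sfn f \<and> sform 1 X \<and> sform 1 V \<and> sform 2 \<pi> \<and> sform 2 \<sigma> \<and> sform 3 \<Phi> \<and> sform 3 \<Psi>"
proof
  assume d: "degree_zero M (elem_of f X V \<pi> \<sigma> \<Phi> \<Psi>)"
  then have d: "sform (mdeg \<mu>) (elem_of f X V \<pi> \<sigma> \<Phi> \<Psi> \<mu>)" for \<mu> unfolding degree_zero_def by blast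
  show "sfn f \<and> sform 1 X \<and> sform 1 V \<and> sform 2 \<pi> \<and> sform 2 \<sigma> \<and> sform 3 \<Phi> \<and> sform 3 \<Psi>"
    using d[of "(False, False, 0)"] d[of "(True, False, 0)"] d[of "(False, True, 0)"] d[of "(True, True, 0)"]
      d[of "(False, False, Suc 0)"] d[of "(True, False, Suc 0)"] d[of "(False, True, Suc 0)"]
    by (simp add: elem_of_simps sform_form0 numeral_2_eq_2 numeral_3_eq_3)
next
  assume a: "sfn f \<and> sform 1 X \<and> sform 1 V \<and> sform 2 \<pi> \<and> sform 2 \<sigma> \<and> sform 3 \<Phi> \<and> sform 3 \<Psi>"
  have "sform (mdeg (a, b, m)) (elem_of f X V \<pi> \<sigma> \<Phi> \<Psi> (a, b, m))" for a b m
  proof -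
    consider "m = 0" | "m = Suc 0" | l where "m = Suc (Suc l)" by (metis not0_implies_Suc)
    then show ?thesis
      using a by cases ((cases a; cases b; simp add: elem_of_simps sform_form0 sform_zero' numeral_2_eq_2 numeral_3_eq_3)+)
  qed
  then show "degree_zero M (elem_of f X V \<pi> \<sigma> \<Phi> \<Psi>)" unfolding degree_zero_def by (metis prod.exhaust)
qed

lemma grade_sign_sform: "sform l \<omega> \<Longrightarrow> grade_sign n \<omega> = (\<lambda>p vs. (-1) ^ (n * l) * \<omega> p vs)"
proof
  fix p assume "sform l \<omega>"
  then show "grade_sign n \<omega> p = (\<lambda>vs. (-1) ^ (n * l) * \<omega> p vs)"
    using grade_sign_alt[of l \<omega> p n] smooth_form_alt by blast
qed

lemma sfn_exp: "sfn f \<Longrightarrow> sfn (exp_fn f)"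
  by (auto simp: sfn_iff exp_fn_exp_fps intro!: smooth_fps_exp_fps open_chart)

lemma exp_fn_pos: "fps_nth (exp_fn f p) 0 > 0"
  by (simp add: exp_fn_exp_fps exp_fps_0)

text \<open>
  The coefficients of \<open>dt\<close>, \<open>\<epsilon>\<close>, \<open>dt \<epsilon>\<close>, \<open>d\<epsilon>\<close>, \<open>\<epsilon> d\<epsilon>\<close>, \<open>(d\<epsilon>)\<^sup>2\<close> and \<open>dt d\<epsilon>\<close>, in this order.
\<close>

lemma homotopy_iff:
  assumes f: "sfn f" and X: "sform 1 X" and V: "sform 1 V" and \<pi>: "sform 2 \<pi>" and \<sigma>: "sform 2 \<sigma>"
    and \<Phi>: "sform 3 \<Phi>" and \<Psi>: "sform 3 \<Psi>" and r: "r = exp_fn f"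
  shows "homotopy M (elem_of f X V \<pi> \<sigma> \<Phi> \<Psi>) \<longleftrightarrow>
     cod (r \<cdot> X) + form0 (dt_fn r) = 0 \<and>
     cod (r \<cdot> V) = 0 \<and>
     cod (r \<cdot> (\<pi> - X \<wedge> V)) - dt_form (r \<cdot> V) = 0 \<and>
     cod (r \<cdot> \<sigma>) - r \<cdot> V = 0 \<and>
     cod (r \<cdot> (\<Psi> + V \<wedge> \<sigma>)) = 0 \<and>
     r \<cdot> (\<Psi> + V \<wedge> \<sigma>) = 0 \<and>
     cod (r \<cdot> (\<Phi> + X \<wedge> \<sigma>)) + dt_form (r \<cdot> \<sigma>) - r \<cdot> (\<pi> - X \<wedge> V) = 0"
    (is "_ \<longleftrightarrow> ?E1 \<and> ?E2 \<and> ?E3 \<and> ?E4 \<and> ?E5 \<and> ?E6 \<and> ?E8")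
proof -
  let ?x = "elem_of f X V \<pi> \<sigma> \<Phi> \<Psi>"
  define G where "G = elem_exp ?x"
  have dz: "degree_zero M ?x" unfolding degree_zero_elem_of_iff using assms by blast
  then have al: "alt_form (mdeg \<mu>) (?x \<mu> p)" for \<mu> p
    unfolding degree_zero_def using smooth_form_alt by blast
  note v = elem_exp_values[where f = f and X = X and V = V and \<pi> = \<pi> and \<sigma> = \<sigma> and \<Phi> = \<Phi> and \<Psi> = \<Psi>,
      OF smooth_form_alt[OF X] smooth_form_alt[OF V] smooth_form_alt[OF \<pi>] smooth_form_alt[OF \<sigma>] G_def,
      folded r]
  have hi: "G \<mu> = 0" if "mdeg \<mu> > 3" for \<mu> unfolding G_def by (rule elem_exp_high[OF al that])
  have v0: "G (True, True, Suc m) = 0" for m by (rule hi) simp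
  have v2: "G (a, b, Suc (Suc m)) = 0" for a b m by (rule hi) simp
  have sr: "sfn r" unfolding r by (rule sfn_exp[OF f])
  have s1: "sform 1 (r \<cdot> V)" by (rule sform_scale[OF sr V])
  have sy: "sform 2 (r \<cdot> (\<pi> - X \<wedge> V))"
    by (rule sform_scale[OF sr sform_diff[OF \<pi> sform_wedge[OF X V]]]) simp
  have s3: "sform 3 (r \<cdot> (\<Psi> + V \<wedge> \<sigma>))"
    by (rule sform_scale[OF sr sform_add[OF \<Psi> sform_wedge[OF V \<sigma>]]]) simp
  have s0: "sform 0 (form0 r)" using sr by (simp add: sform_form0)
  have dt0: "dt_form (form0 r) = form0 (dt_fn r)"
    by (simp add: fun_eq_iff dt_form_def form0_def dt_fn_def)
  note gs = grade_sign_sform[OF s1, of 1] grade_sign_sform[OF sy, of 1] grade_sign_sform[OF s3, of 1]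
    grade_sign_sform[OF sform_dt[OF s0, unfolded dt0], of 1] grade_sign_sform[OF sform_dt[OF s1], of 1]
    grade_sign_sform[OF sform_dt[OF sform_scale[OF sr \<sigma>]], of 1]
    grade_sign_sform[OF sform_dt[OF s3], of 1]
  have gz: "grade_sign (Suc 0) 0 = (0 :: 'm form)" "dt_form 0 = (0 :: 'm form)" "cod 0 = 0"
    using codiff_zero by (simp_all add: fun_eq_iff grade_sign_def dt_form_def zero_fun_def)
  note simps = v v0 v2 gz gs[simplified] dt0 codiff_0[OF s0]
  \<comment> \<open>The coefficient in D7 is the time derivative of the one in D6; those in D0 vanish identically.\<close>
  have D1: "elem_diff M G (True, False, 0) = cod (r \<cdot> X) + form0 (dt_fn r)"
    and D2: "elem_diff M G (False, True, 0) = cod (r \<cdot> V)"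
    and D3: "elem_diff M G (True, True, 0) = cod (r \<cdot> (\<pi> - X \<wedge> V)) - dt_form (r \<cdot> V)"
    and D4: "elem_diff M G (False, False, Suc 0) = cod (r \<cdot> \<sigma>) - r \<cdot> V"
    and D5: "elem_diff M G (False, True, Suc 0) = cod (r \<cdot> (\<Psi> + V \<wedge> \<sigma>))"
    and D6: "elem_diff M G (False, False, Suc (Suc 0)) = - (r \<cdot> (\<Psi> + V \<wedge> \<sigma>))"
    and D7: "elem_diff M G (True, True, Suc 0) = - dt_form (r \<cdot> (\<Psi> + V \<wedge> \<sigma>))"
    and D8: "elem_diff M G (True, False, Suc 0) =
      cod (r \<cdot> (\<Phi> + X \<wedge> \<sigma>)) + dt_form (r \<cdot> \<sigma>) - r \<cdot> (\<pi> - X \<wedge> V)"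
    and D0: "elem_diff M G (False, False, 0) = 0" "elem_diff M G (True, b, Suc (Suc m)) = 0"
      "elem_diff M G (a, True, Suc (Suc m)) = 0" "elem_diff M G (a, b, Suc (Suc (Suc m))) = 0" for a b m
    by (simp_all add: simps fun_eq_iff)
  have "elem_diff M G = 0 \<longleftrightarrow> (\<forall>a b m. elem_diff M G (a, b, m) = 0)"
    by (simp add: fun_eq_iff[of "elem_diff M G"])
  also have "\<dots> \<longleftrightarrow> ?E1 \<and> ?E2 \<and> ?E3 \<and> ?E4 \<and> ?E5 \<and> ?E6 \<and> ?E8"
  proof
    assume a: "\<forall>a b m. elem_diff M G (a, b, m) = 0"
    show "?E1 \<and> ?E2 \<and> ?E3 \<and> ?E4 \<and> ?E5 \<and> ?E6 \<and> ?E8"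
    proof (intro conjI)
      show ?E1 ?E2 ?E3 ?E4 ?E5 ?E8 using a D1 D2 D3 D4 D5 D8 by metis+
      show ?E6 using a D6 by (metis neg_equal_0_iff_equal)
    qed
  next
    assume E: "?E1 \<and> ?E2 \<and> ?E3 \<and> ?E4 \<and> ?E5 \<and> ?E6 \<and> ?E8"
    have z: "elem_diff M G (True, True, Suc 0) = 0"
      unfolding D7 using E by (simp add: gz)
    have y: "elem_diff M G (False, False, Suc (Suc 0)) = 0" unfolding D6 using E by simp
    have x: "elem_diff M G (True, False, 0) = 0" "elem_diff M G (False, True, 0) = 0"
      "elem_diff M G (True, True, 0) = 0" "elem_diff M G (False, False, Suc 0) = 0"
      "elem_diff M G (False, True, Suc 0) = 0" "elem_diff M G (True, False, Suc 0) = 0"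
      unfolding D1 D2 D3 D4 D5 D8 using E by blast+
    show "\<forall>a b m. elem_diff M G (a, b, m) = 0"
    proof (intro allI)
      fix a b m
      consider "m = 0" | "m = Suc 0" | "m = Suc (Suc 0)" | l where "m = Suc (Suc (Suc l))"
        by (cases m rule: nat.exhaust; cases "m - 1"; cases "m - 2") auto
      then show "elem_diff M G (a, b, m) = 0"
        by cases (cases a; cases b; simp only: x y z D0)+
    qed
  qed
  finally show ?thesis using dz unfolding homotopy_def G_def by simp
qed

section \<open>Vector fields\<close>

text \<open>
  In components \<open>flat\<close> is the Gram matrix, hence invertible with inverse \<open>sharp\<close>.
\<close>

lemma flat_F1: "flat M u p = F1 (mat_act (gram (metric M p)) (u p))"
proof
  fix vs
  show "flat M u p vs = F1 (mat_act (gram (metric M p)) (u p)) vs"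
  proof (cases "length vs = 1")
    case True
    then obtain v where vs: "vs = [v]" by (auto simp: length_Suc_conv)
    have g: "metric M p (axis i 1) v = v$1 * gram (metric M p) $ 1 $ i + v$2 * gram (metric M p) $ 2 $ i
        + v$3 * gram (metric M p) $ 3 $ i" for i
    proof -
      have "\<forall>i. metric M p (axis i 1) v = v$1 * gram (metric M p) $ 1 $ i + v$2 * gram (metric M p) $ 2 $ i
        + v$3 * gram (metric M p) $ 3 $ i"
        using ip_sum[OF ip_metric, of p _ v] gram_sym[OF ip_metric, of p]
        by (simp add: forall_3 sum_3 axis_def)
      then show ?thesis by blast
    qed
    show ?thesis
      unfolding vs flat_def
      by (simp add: g sum_3 mat_act_def fps_const_ring del: fps_const_mult fps_const_add) (simp only: algebra_simps)
  next
    case False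
    then show ?thesis using alt_form_length[OF alt_form_F1 False] by (simp add: flat_def)
  qed
qed

lemma alt_form_flat: "alt_form 1 (flat M u p)"
  unfolding flat_F1 by (rule alt_form_F1)

lemma flat_inj: "flat M u = flat M v \<longleftrightarrow> u = v"
proof
  assume a: "flat M u = flat M v"
  show "u = v"
  proof
    fix p
    have "F1 (mat_act (gram (metric M p)) (u p)) = F1 (mat_act (gram (metric M p)) (v p))"
      using fun_cong[OF a, of p] unfolding flat_F1 .
    then have "mat_act (gram (metric M p)) (u p) = mat_act (gram (metric M p)) (v p)" by (metis comp1_F1)
    then have "mat_act (dual_gram (metric M p)) (mat_act (gram (metric M p)) (u p)) = mat_act (dual_gram (metric M p)) (mat_act (gram (metric M p)) (v p))"
      by simp
    then show "u p = v p" by (simp add: mat_act_mat_act gram_dual_gram[OF ip_metric] mat_act_1)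
  qed
qed simp

lemma flat_sharp:
  assumes "\<And>p. alt_form 1 (\<alpha> p)"
  shows "flat M (sharp M \<alpha>) = \<alpha>"
proof -
  have f: "flat M (\<lambda>p. mat_act (dual_gram (metric M p)) (comp1 (\<alpha> p))) = \<alpha>"
    using alt_form_1_eq[OF assms] by (simp add: fun_eq_iff flat_F1 mat_act_mat_act gram_dual_gram[OF ip_metric] mat_act_1)
  have "sharp M \<alpha> = (\<lambda>p. mat_act (dual_gram (metric M p)) (comp1 (\<alpha> p)))"
    unfolding sharp_def
  proof (rule the_equality)
    show "flat M (\<lambda>p. mat_act (dual_gram (metric M p)) (comp1 (\<alpha> p))) = \<alpha>" by (rule f)
    fix u assume "flat M u = \<alpha>"
    then have "flat M u = flat M (\<lambda>p. mat_act (dual_gram (metric M p)) (comp1 (\<alpha> p)))" using f by simp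
    then show "u = (\<lambda>p. mat_act (dual_gram (metric M p)) (comp1 (\<alpha> p)))" by (simp only: flat_inj)
  qed
  then show ?thesis using f by simp
qed

lemma flat_add: "flat M (u + v) = flat M u + flat M v"
  by (simp add: fun_eq_iff flat_def sum.distrib algebra_simps)

lemma flat_diff: "flat M (u - v) = flat M u - flat M v"
  by (simp add: fun_eq_iff flat_def sum_subtractf algebra_simps)

lemma flat_vscale: "flat M (f \<cdot>\<^sub>v u) = f \<cdot> flat M u"
  by (simp add: fun_eq_iff flat_def vscale_def scale_def sum_distrib_left mult_ac)

lemma flat_dt: "flat M (dt_vfield u) = dt_form (flat M u)"
  by (simp add: fun_eq_iff flat_def dt_vfield_def dt_form_def fps_deriv_sum mult_ac)

lemma flat_zero: "flat M 0 = 0"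
  by (simp add: fun_eq_iff flat_def)

lemma dot_covec_inner: "dot M u v p = covec_inner (metric M p) (comp1 (flat M u p)) (comp1 (flat M v p))"
proof -
  let ?g = "metric M p"
  have "dot M u v p = dotv (mat_act (gram ?g) (u p)) (v p)"
    using gram_sym[OF ip_metric, of p 1 2] gram_sym[OF ip_metric, of p 1 3] gram_sym[OF ip_metric, of p 2 3]
    by (simp add: dot_def sum_3 dotv_def mat_act_def gram_def algebra_simps)
  also have "v p = mat_act (dual_gram ?g) (mat_act (gram ?g) (v p))" by (simp add: mat_act_mat_act gram_dual_gram[OF ip_metric] mat_act_1)
  finally show ?thesis by (simp add: flat_F1 covec_inner_def)
qed

lemma smooth_on_vec:
  fixes f :: "real^3 \<Rightarrow> real^3"
  assumes S: "open S" and c: "\<And>i. smooth_on S (\<lambda>x. f x $ i)"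
  shows "smooth_on S f"
proof -
  have "smooth_on S (\<lambda>x. f x $ i *\<^sub>R axis i 1 :: real^3)" for i
    by (rule smooth_on_linear[OF S bounded_linear_scaleR_left c])
  then have "smooth_on S (\<lambda>x. f x $ 1 *\<^sub>R e1 + f x $ 2 *\<^sub>R e2 + f x $ 3 *\<^sub>R e3)"
    by (intro smooth_on_add S)
  moreover have "f x $ 1 *\<^sub>R e1 + f x $ 2 *\<^sub>R e2 + f x $ 3 *\<^sub>R e3 = f x" for x
    by (simp add: vec_eq_iff forall_3)
  ultimately show ?thesis by simp
qed

text \<open>
  In a chart, \<open>flat\<close> is multiplication with the Gram matrix of the local metric; this matrix and its
  inverse are smooth.
\<close>

lemma sform_flat: "sform 1 (flat M u) \<longleftrightarrow> smooth_vfield M u"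
proof -
  \<comment> \<open>The coefficient of t^n in the local expression of the vector field.\<close>
  define w where "w c n x = jac (chart_at M (chart_inv c x)) c (chart_inv c x) (\<chi> i. fps_nth (u (chart_inv c x) $ i) n)" for c n x
  have vf: "smooth_vfield M u \<longleftrightarrow> (\<forall>c\<in>charts M. \<forall>n. smooth_on (snd c ` fst c) (w c n))"
    unfolding smooth_vfield_def w_def Let_def ..
  have key: "fps_nth (local_form M c (flat M u) x [v]) n = local_metric M c x (w c n x) v"
    if c: "c \<in> charts M" and x: "x \<in> snd c ` fst c" for c x v n
  proof -
    define p where "p = chart_inv c x"
    define d where "d = chart_at M p"
    have p: "p \<in> fst c" unfolding p_def by (rule chart_inv_in[OF c x])
    have d: "d \<in> charts M" "p \<in> fst d" unfolding d_def by (rule chart_at)+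
    let ?u = "\<chi> i. fps_nth (u p $ i) n"
    have "jac c d p (jac d c p ?u) = ?u"
      using jac_chain[OF d(1) c d(1) d(2) p d(2)] jac_id[OF d] by simp
    then have "local_metric M c x (w c n x) v = metric M p ?u (jac c d p v)"
      by (simp add: local_metric_pullback pullback_ip_def w_def p_def[symmetric] d_def[symmetric])
    also have "\<dots> = (\<Sum>i\<in>UNIV. ?u $ i * metric M p (axis i 1) (jac c d p v))"
      by (rule ip_expand_left[OF ip_metric])
    also have "\<dots> = fps_nth (local_form M c (flat M u) x [v]) n"
      by (simp add: local_form_pullback pullback_def p_def[symmetric] d_def[symmetric] flat_def fps_sum_nth)
    finally show ?thesis by simp
  qed
  show ?thesis
  proof
    assume s: "sform 1 (flat M u)"
    show "smooth_vfield M u" unfolding vf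
    proof (intro ballI allI smooth_on_vec)
      fix c n i assume c: "c \<in> charts M"
      let ?S = "snd c ` fst c"
      note S = open_chart(2)[OF c]
      show "open ?S" by (rule S)
      define l where "l j x = fps_nth (local_form M c (flat M u) x [axis j 1]) n" for j x
      have sl: "smooth_on ?S (l j)" for j
        unfolding l_def using smooth_form_smooth_fps[OF s c] unfolding smooth_fps_def by blast
      have h: "smooth_on ?S (\<lambda>x. dual_gram (local_metric M c x) $ i $ j)" for i j
        by (rule smooth_dual_gram(2)[OF S ip_local[OF c] smooth_metric[OF c]])
      have "(\<Sum>j\<in>UNIV. dual_gram (local_metric M c x) $ i $ j * l j x) = w c n x $ i" if x: "x \<in> ?S" for x
      proof -
        let ?g = "local_metric M c x"
        note ip = ip_local[OF c x]
        have "l j x = (gram ?g *v w c n x) $ j" for j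
        proof -
          have "l j x = (\<Sum>i\<in>UNIV. w c n x $ i * gram ?g $ i $ j)"
            unfolding l_def key[OF c x] ip_expand_left[OF ip, of "w c n x"] by (simp add: gram_def)
          then show ?thesis
            by (simp add: matrix_vector_mult_def gram_sym[OF ip, of j] mult.commute)
        qed
        then have "(\<Sum>j\<in>UNIV. dual_gram ?g $ i $ j * l j x) = (dual_gram ?g *v (gram ?g *v w c n x)) $ i"
          by (simp add: matrix_vector_mult_def)
        then show ?thesis by (simp add: matrix_vector_mul_assoc gram_dual_gram[OF ip])
      qed
      moreover have "smooth_on ?S (\<lambda>x. \<Sum>j\<in>UNIV. dual_gram (local_metric M c x) $ i $ j * l j x)"
        by (intro smooth_on_sum smooth_on_mult S h sl)
      ultimately show "smooth_on ?S (\<lambda>x. w c n x $ i)" by (rule smooth_on_cong[OF S])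
    qed
  next
    assume "smooth_vfield M u"
    then have sw: "smooth_on (snd c ` fst c) (w c n)" if "c \<in> charts M" for c n using that unfolding vf by blast
    show "sform 1 (flat M u)"
      unfolding smooth_form_iff
    proof (intro conjI allI ballI alt_form_flat)
      fix c vs assume c: "c \<in> charts M"
      let ?S = "snd c ` fst c"
      note S = open_chart(2)[OF c]
      show "smooth_fps ?S (\<lambda>x. local_form M c (flat M u) x vs)"
      proof (cases "length vs = 1")
        case True
        then obtain v where vs: "vs = [v]" by (auto simp: length_Suc_conv)
        show ?thesis unfolding smooth_fps_def vs
        proof
          fix n
          have e: "(\<Sum>i\<in>UNIV. w c n x $ i * local_metric M c x (axis i 1) v) = fps_nth (local_form M c (flat M u) x [v]) n"
            if x: "x \<in> ?S" for x
            unfolding key[OF c x] by (rule ip_expand_left[OF ip_local[OF c x], symmetric])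
          have "smooth_on ?S (\<lambda>x. \<Sum>i\<in>UNIV. w c n x $ i * local_metric M c x (axis i 1) v)"
            by (intro smooth_on_sum smooth_on_mult S smooth_metric[OF c]
                smooth_on_linear[OF S bounded_linear_vec_nth sw[OF c]])
          then show "smooth_on ?S (\<lambda>x. fps_nth (local_form M c (flat M u) x [v]) n)"
            by (rule smooth_on_cong[OF S, rotated]) (rule e)
        qed
      next
        case False
        then have "local_form M c (flat M u) x vs = 0" for x
          by (simp add: local_form_def flat_def Let_def)
        then show ?thesis by (simp add: smooth_fps_const[OF S])
      qed
    qed
  qed
qed

end

context riemannian_3manifold
begin

section \<open>Vector calculus identities\<close>

definition form_inner :: "'m form \<Rightarrow> 'm form \<Rightarrow> 'm fn" where
  "form_inner \<alpha> \<beta> p = covec_inner (metric M p) (comp1 (\<alpha> p)) (comp1 (\<beta> p))"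

lemma form_inner_sym: "form_inner \<alpha> \<beta> = form_inner \<beta> \<alpha>"
  using covec_inner_sym[OF ip_metric] by (simp add: fun_eq_iff form_inner_def)

lemma dot_form_inner: "dot M u v = form_inner (flat M u) (flat M v)"
  by (simp add: fun_eq_iff form_inner_def dot_covec_inner)

lemma sform_wedge_hodge:
  assumes "sform 1 \<alpha>" "sform 1 \<beta>"
  shows "sform 3 (\<alpha> \<wedge> hod \<beta>)"
  by (rule sform_wedge[OF assms(1) smooth_hodge[OF assms(2), of 2]]) simp_all

text \<open>
  The defining property of the star, in the form \<open>\<star>(\<alpha> \<wedge> \<star>\<beta>) = \<langle>\<alpha>, \<beta>\<rangle>\<close>.
\<close>

lemma hodge_wedge_hodge:
  assumes \<alpha>: "sform 1 \<alpha>" and \<beta>: "sform 1 \<beta>"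
  shows "hod (\<alpha> \<wedge> hod \<beta>) = form0 (form_inner \<alpha> \<beta>)"
proof
  fix p
  let ?g = "metric M p"
  note a = smooth_form_alt[OF \<alpha>, of p] and b = smooth_form_alt[OF \<beta>, of p]
  have h: "hod \<beta> p = hodge_alt ?g 1 (\<beta> p)" by (rule hodge_eq[of 1 \<beta> p, OF b]) simp
  have w: "(\<alpha> \<wedge> hod \<beta>) p = F3 (form_inner \<alpha> \<beta> p * fps_const (vol ?g))"
    unfolding wedge_def h form_inner_def by (rule wedge_hodge_1[OF ip_metric a b])
  have "hod (\<alpha> \<wedge> hod \<beta>) p = hodge_alt ?g 3 ((\<alpha> \<wedge> hod \<beta>) p)"
    by (rule hodge_eq) (simp_all add: w alt_form_F3)
  also have "\<dots> = F0 (fps_const (vol ?g * det (dual_gram ?g)) * (form_inner \<alpha> \<beta> p * fps_const (vol ?g)))"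
    unfolding w hodge_alt_F[OF ip_metric] ..
  also have "fps_const (vol ?g * det (dual_gram ?g)) * (form_inner \<alpha> \<beta> p * fps_const (vol ?g))
      = fps_const (vol ?g * vol ?g * det (dual_gram ?g)) * form_inner \<alpha> \<beta> p"
    by (simp add: fps_const_mult[symmetric] mult_ac del: fps_const_mult)
  finally show "hod (\<alpha> \<wedge> hod \<beta>) p = form0 (form_inner \<alpha> \<beta>) p"
    by (simp add: vol_det[OF ip_metric] form0_F0)
qed

lemma sfn_form_inner: "sform 1 \<alpha> \<Longrightarrow> sform 1 \<beta> \<Longrightarrow> sfn (form_inner \<alpha> \<beta>)"
  using smooth_hodge[OF sform_wedge_hodge, of \<alpha> \<beta> 0] by (simp add: hodge_wedge_hodge sform_form0)

lemma wedge_hodge_form0: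
  assumes "sform 1 \<alpha>" "sform 1 \<beta>"
  shows "\<alpha> \<wedge> hod \<beta> = hod (form0 (form_inner \<alpha> \<beta>))"
  using hodge_hodge[OF sform_wedge_hodge[OF assms]] by (simp add: hodge_wedge_hodge[OF assms])

text \<open>
  By symmetry of the inner product, \<open>\<star>B \<wedge> \<star>X = X \<wedge> \<star>\<star>B\<close>.
\<close>

lemma hodge_wedge_hodge_2:
  assumes X: "sform 1 X" and B: "sform 2 B"
  shows "hod B \<wedge> hod X = X \<wedge> B"
proof -
  have hB: "sform 1 (hod B)" by (rule smooth_hodge[OF B]) simp_all
  have "hod B \<wedge> hod X = X \<wedge> hod (hod B)"
    unfolding wedge_hodge_form0[OF hB X] wedge_hodge_form0[OF X hB] by (simp add: form_inner_sym)
  then show ?thesis by (simp add: hodge_hodge[OF B])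
qed

lemma wedge_wedge_self:
  assumes X: "sform 1 X" and R: "sform 1 R"
  shows "X \<wedge> (R \<wedge> X) = 0"
proof (intro ext)
  fix p vs
  obtain a b where ab: "X p = F1 a" "R p = F1 b"
    using alt_form_1_eq smooth_form_alt[OF X] smooth_form_alt[OF R] by metis
  have "dotv a (crossv b a) = 0 * 0" by (simp add: dotv_def crossv_def algebra_simps)
  then have "F3 (dotv a (crossv b a)) = (\<lambda>vs. 0 * F3 0 vs)" by (simp only: F3_scale)
  then show "(X \<wedge> (R \<wedge> X)) p vs = (0 :: 'm form) p vs"
    by (simp add: wedge_def ab wedge_F1_F1 wedge_F1_F2)
qed

lemma wedge_hodge_wedge_form:
  assumes X: "sform 1 X" and R: "sform 1 R"
  shows "X \<wedge> hod (R \<wedge> X) = form_inner X X \<cdot> hod R - form_inner R X \<cdot> hod X"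
proof (intro ext)
  fix p vs
  note a = smooth_form_alt[OF X, of p] and b = smooth_form_alt[OF R, of p]
  have "alt_form 2 ((R \<wedge> X) p)" using alt_form_wedge[OF b a] by (simp add: wedge_def numeral_2_eq_2)
  then have h: "hod (R \<wedge> X) p = hodge_alt (metric M p) 2 (wedge_alt (R p) (X p))"
    using hodge_eq[of 2 "R \<wedge> X" p] by (simp add: wedge_def)
  have "hod R p = hodge_alt (metric M p) 1 (R p)" "hod X p = hodge_alt (metric M p) 1 (X p)"
    using hodge_eq[of 1 R p, OF b] hodge_eq[of 1 X p, OF a] by simp_all
  then show "(X \<wedge> hod (R \<wedge> X)) p vs = (form_inner X X \<cdot> hod R - form_inner R X \<cdot> hod X) p vs"
    using wedge_hodge_wedge[OF ip_metric a b, of p vs]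
    by (simp add: wedge_def[of X] h scale_def form_inner_def)
qed

lemma wedge_lin:
  "\<alpha> \<wedge> (\<beta> + \<gamma>) = \<alpha> \<wedge> \<beta> + \<alpha> \<wedge> \<gamma>" "\<alpha> \<wedge> (f \<cdot> \<beta>) = f \<cdot> (\<alpha> \<wedge> \<beta>)" "(f \<cdot> \<alpha>) \<wedge> \<beta> = f \<cdot> (\<alpha> \<wedge> \<beta>)"
  "\<alpha> \<wedge> (- \<beta>) = - (\<alpha> \<wedge> \<beta>)" "(- \<alpha>) \<wedge> \<beta> = - (\<alpha> \<wedge> \<beta>)"
proof -
  have ad: "wedge_alt a (b + c) vs = wedge_alt a b vs + wedge_alt a c vs" for a b c vs
    using wedge_alt_add_right[of a b c vs] by (simp add: plus_fun_def)
  have m: "wedge_alt a (\<lambda>vs. - b vs) vs = - wedge_alt a b vs" "wedge_alt (\<lambda>vs. - a vs) b vs = - wedge_alt a b vs"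
    for a b vs
    using wedge_alt_scale_right[of a "-1" b vs] wedge_alt_scale_left[of "-1" a b vs] by simp_all
  show "\<alpha> \<wedge> (\<beta> + \<gamma>) = \<alpha> \<wedge> \<beta> + \<alpha> \<wedge> \<gamma>" "\<alpha> \<wedge> (f \<cdot> \<beta>) = f \<cdot> (\<alpha> \<wedge> \<beta>)" "(f \<cdot> \<alpha>) \<wedge> \<beta> = f \<cdot> (\<alpha> \<wedge> \<beta>)"
    by (simp_all add: fun_eq_iff wedge_def scale_apply wedge_alt_linear ad)
  show "\<alpha> \<wedge> (- \<beta>) = - (\<alpha> \<wedge> \<beta>)" "(- \<alpha>) \<wedge> \<beta> = - (\<alpha> \<wedge> \<beta>)"
    by (simp_all add: fun_eq_iff wedge_def fun_Compl_def m)
qed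

lemma wedge_form0_right: "\<alpha> \<wedge> form0 f = f \<cdot> \<alpha>"
  by (simp add: fun_eq_iff wedge_def form0_F0 wedge_F0_right scale_def)

lemma wedge_0_left: "sform 0 \<omega> \<Longrightarrow> \<omega> \<wedge> \<beta> = fn_of \<omega> \<cdot> \<beta>"
  using wedge_alt_0[OF smooth_form_alt] by (simp add: fun_eq_iff wedge_def scale_def fn_of_def)

lemma scale_form0: "f \<cdot> form0 h = form0 (\<lambda>p. f p * h p)"
  by (simp add: fun_eq_iff scale_def form0_def)

lemma recip_scale:
  assumes "\<forall>p. fps_nth (r p) 0 \<noteq> 0"
  shows "recip r \<cdot> r \<cdot> \<omega> = \<omega>" "r \<cdot> recip r \<cdot> \<omega> = \<omega>"
  using inverse_mult_eq_1[OF assms[rule_format]] inverse_mult_eq_1'[OF assms[rule_format]]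
  by (simp_all add: fun_eq_iff scale_def recip_def mult.assoc[symmetric])

lemma scale_zero_iff:
  assumes "\<forall>p. fps_nth (r p) 0 \<noteq> 0"
  shows "r \<cdot> \<omega> = 0 \<longleftrightarrow> \<omega> = 0"
proof
  assume "r \<cdot> \<omega> = 0"
  then have "\<omega> = recip r \<cdot> 0" using recip_scale(1)[OF assms, of \<omega>] by simp
  then show "\<omega> = 0" by (simp add: fun_eq_iff scale_def)
qed (simp add: fun_eq_iff scale_def)

lemma sfn_half: "sfn half"
  unfolding half_def by (rule sfn_const)

section \<open>The momentum equation as an equation of forms\<close>

text \<open>
  The one-form that corresponds under the metric to the left hand side of the momentum equation.
\<close>

definition momentum_form :: "'m fn \<Rightarrow> 'm form \<Rightarrow> 'm fn \<Rightarrow> 'm form" where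
  "momentum_form r X pr = dt_form X + half \<cdot> dd (form0 (form_inner X X)) - hod (X \<wedge> hod (dd X)) + recip r \<cdot> dd (form0 pr)"

lemma vector_momentum:
  assumes r: "sfn r" and u: "smooth_vfield M u" and pr: "sfn pr"
  shows "dt_vfield u + grad M (half * dot M u u) - cross M u (curl M u) + recip r \<cdot>\<^sub>v grad M pr = 0 \<longleftrightarrow>
    momentum_form r (flat M u) pr = 0" (is "?E = 0 \<longleftrightarrow> _")
proof -
  let ?X = "flat M u"
  have X: "sform 1 ?X" using u sform_flat by blast
  have q: "sfn (form_inner ?X ?X)" by (rule sfn_form_inner[OF X X])
  have gr: "flat M (grad M f) = dd (form0 f)" if "sfn f" for f
  proof -
    have "sform 1 (dd (form0 f))" using that by (intro smooth_ext_d'[of 0]) (simp_all add: sform_form0)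
    then show ?thesis unfolding grad_def by (intro flat_sharp smooth_form_alt)
  qed
  have dX: "sform 2 (dd ?X)" by (rule smooth_ext_d'[OF X]) simp_all
  have hX: "sform 1 (hod (dd ?X))" by (rule smooth_hodge[OF dX]) simp_all
  have cu: "flat M (curl M u) = hod (dd ?X)"
    unfolding curl_def by (rule flat_sharp[OF smooth_form_alt[OF hX]])
  have XH: "sform 2 (?X \<wedge> hod (dd ?X))" by (rule sform_wedge[OF X hX]) simp
  have hXH: "sform 1 (hod (?X \<wedge> hod (dd ?X)))" by (rule smooth_hodge[OF XH]) simp_all
  have cr: "flat M (cross M u (curl M u)) = hod (?X \<wedge> hod (dd ?X))"
    unfolding cross_def cu
    by (rule flat_sharp[OF smooth_form_alt[OF hXH]])
  have "half * dot M u u = (\<lambda>p. half p * form_inner ?X ?X p)" by (simp add: fun_eq_iff dot_form_inner)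
  then have g2: "flat M (grad M (half * dot M u u)) = half \<cdot> dd (form0 (form_inner ?X ?X))"
    using gr[OF sfn_mult[OF sfn_half q]] ext_d_scale_const[of 0 "form0 (form_inner ?X ?X)"] q
    by (simp add: scale_form0[symmetric] sform_form0 half_def[abs_def])
  have "flat M ?E = momentum_form r ?X pr"
    unfolding flat_add flat_diff flat_vscale flat_dt g2 cr gr[OF pr] momentum_form_def ..
  then show ?thesis using flat_inj[of ?E 0] by (simp add: flat_zero)
qed

text \<open>
  The coefficient of \<open>dt d\<epsilon>\<close> in the homotopy condition, for \<open>\<sigma> = \<star>X\<close>.  Expanding with the Leibniz rule,
  the terms \<open>|X|\<^sup>2 \<star>dr\<close> from \<open>\<delta>(r X \<sigma>)\<close> and from \<open>X \<wedge> \<star>(dr \<wedge> X)\<close> cancel.  The multiples of \<open>\<star>X\<close> combine to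
  \<open>r' + \<langle>dr, X\<rangle> + r \<delta>X = r' + \<delta>(r X)\<close>, and the factor \<open>1/2\<close> in \<open>\<pi>\<close> turns \<open>r \<star>d|X|\<^sup>2\<close> into
  \<open>r \<star>d(|X|\<^sup>2 / 2)\<close>.
\<close>

lemma momentum_identity:
  assumes r: "sfn r" "\<forall>p. fps_nth (r p) 0 \<noteq> 0" and X: "sform 1 X" and \<Phi>: "sform 3 \<Phi>"
    and pr: "pr = fn_of (hod (r \<cdot> \<Phi>))" and V: "r \<cdot> V = - hod (dd (r \<cdot> X))"
  shows "cod (r \<cdot> (\<Phi> + X \<wedge> hod X)) + dt_form (r \<cdot> hod X) - r \<cdot> (\<pi>_of M X - X \<wedge> V) =
    r \<cdot> hod (momentum_form r X pr) + (\<lambda>p. dt_fn r p + fn_of (cod (r \<cdot> X)) p) \<cdot> hod X"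
proof -
  let ?q = "form_inner X X"
  let ?R = "dd (form0 r)" and ?dq = "dd (form0 ?q)" and ?P = "dd (form0 pr)"
  have q: "sfn ?q" by (rule sfn_form_inner[OF X X])
  have R: "sform 1 ?R" using r by (intro smooth_ext_d'[of 0]) (simp_all add: sform_form0)
  have dq: "sform 1 ?dq" using q by (intro smooth_ext_d'[of 0]) (simp_all add: sform_form0)
  have hX: "sform 2 (hod X)" by (rule smooth_hodge[OF X]) simp_all
  have dX: "sform 2 (dd X)" by (rule smooth_ext_d'[OF X]) simp_all
  have hdX: "sform 1 (hod (dd X))" by (rule smooth_hodge[OF dX]) simp_all
  have XX: "sform 3 (X \<wedge> hod X)" by (rule sform_wedge_hodge[OF X X])
  have r\<Phi>: "sform 3 (r \<cdot> \<Phi>)" by (rule sform_scale[OF r(1) \<Phi>])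
  have hr\<Phi>: "hod (r \<cdot> \<Phi>) = form0 pr"
    unfolding pr by (rule sform_0_eq[OF smooth_hodge[OF r\<Phi>]]) simp_all
  have spr: "sfn pr" using smooth_hodge[OF r\<Phi>, of 0] by (simp add: hr\<Phi> sform_form0)
  have P: "sform 1 ?P" using spr by (intro smooth_ext_d'[of 0]) (simp_all add: sform_form0)
  have rq: "sform 1 (?q \<cdot> ?R)" "sform 1 (r \<cdot> ?dq)" by (rule sform_scale[OF q R], rule sform_scale[OF r(1) dq])
  have codXX: "cod (X \<wedge> hod X) = hod ?dq"
    unfolding codiff_3[OF XX] hodge_wedge_hodge[OF X X] ..
  have "cod (r \<cdot> (X \<wedge> hod X)) = hod (dd (r \<cdot> form0 ?q))"
    unfolding codiff_3[OF sform_scale[OF r(1) XX]] hodge_scale[OF XX order_refl] hodge_wedge_hodge[OF X X] ..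
  also have "dd (r \<cdot> form0 ?q) = ?q \<cdot> ?R + r \<cdot> ?dq"
    using ext_d_scale[OF r(1), of 0 "form0 ?q"] q by (simp add: sform_form0 wedge_form0_right)
  also have "hod (?q \<cdot> ?R + r \<cdot> ?dq) = ?q \<cdot> hod ?R + r \<cdot> hod ?dq"
    using hodge_add[OF rq] hodge_scale[OF R] hodge_scale[OF dq] by simp
  finally have a1: "cod (r \<cdot> (X \<wedge> hod X)) = ?q \<cdot> hod ?R + r \<cdot> hod ?dq" .
  have s3: "r \<cdot> (\<Phi> + X \<wedge> hod X) = r \<cdot> \<Phi> + r \<cdot> (X \<wedge> hod X)" by (simp add: fun_eq_iff scale_def algebra_simps)
  have "cod (r \<cdot> (\<Phi> + X \<wedge> hod X)) = cod (r \<cdot> \<Phi>) + cod (r \<cdot> (X \<wedge> hod X))"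
    unfolding s3 using codiff_add[of 2 "r \<cdot> \<Phi>" "r \<cdot> (X \<wedge> hod X)"] r\<Phi> sform_scale[OF r(1) XX]
    by (simp add: numeral_3_eq_3)
  then have a: "cod (r \<cdot> (\<Phi> + X \<wedge> hod X)) = hod ?P + (?q \<cdot> hod ?R + r \<cdot> hod ?dq)"
    unfolding a1 codiff_3[OF r\<Phi>] hr\<Phi> .
  have b: "dt_form (r \<cdot> hod X) = dt_fn r \<cdot> hod X + r \<cdot> hod (dt_form X)"
    using hodge_dt[OF X] by (simp add: fun_eq_iff dt_form_def scale_def dt_fn_def algebra_simps)
  have c: "\<pi>_of M X = half \<cdot> hod ?dq - fn_of (cod X) \<cdot> hod X"
    unfolding \<pi>_of_def codXX using wedge_0_left[OF sform_codiff[of 0 X]] X by simp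
  have drX: "dd (r \<cdot> X) = ?R \<wedge> X + r \<cdot> dd X" by (rule ext_d_scale[OF r(1) X])
  have RX: "sform 2 (?R \<wedge> X)" by (rule sform_wedge[OF R X]) simp
  have "hod (dd (r \<cdot> X)) = hod (?R \<wedge> X) + r \<cdot> hod (dd X)"
    unfolding drX using hodge_add[OF RX sform_scale[OF r(1) dX]] hodge_scale[OF dX] by simp
  then have d: "r \<cdot> (X \<wedge> V) = - (?q \<cdot> hod ?R - form_inner ?R X \<cdot> hod X) - r \<cdot> (X \<wedge> hod (dd X))"
    unfolding wedge_lin(2)[symmetric] V wedge_lin(4)
    by (simp only: wedge_lin wedge_hodge_wedge_form[OF X R]) (simp add: fun_eq_iff)
  have "cod (r \<cdot> X) = hod (dd (r \<cdot> hod X))"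
    unfolding codiff_1[OF sform_scale[OF r(1) X]] using hodge_scale[OF X] by simp
  also have "dd (r \<cdot> hod X) = ?R \<wedge> hod X + r \<cdot> dd (hod X)" by (rule ext_d_scale[OF r(1) hX])
  also have "hod (?R \<wedge> hod X + r \<cdot> dd (hod X)) = form0 (form_inner ?R X) + r \<cdot> cod X"
  proof -
    have "sform 3 (dd (hod X))" by (rule smooth_ext_d'[OF hX]) simp_all
    then show ?thesis
      using hodge_add[OF sform_wedge_hodge[OF R X] sform_scale[OF r(1)], of "dd (hod X)"]
        hodge_scale[of 3 "dd (hod X)" r] hodge_wedge_hodge[OF R X] codiff_1[OF X] by simp
  qed
  finally have e0: "cod (r \<cdot> X) = form0 (form_inner ?R X) + r \<cdot> cod X" .
  have e: "fn_of (cod (r \<cdot> X)) p = form_inner ?R X p + r p * fn_of (cod X) p" for p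
    unfolding fn_of_def e0 by (simp add: form0_def scale_def)
  have XdX: "sform 2 (X \<wedge> hod (dd X))" by (rule sform_wedge[OF X hdX]) simp
  have s: "sform 1 (dt_form X)" "sform 1 (half \<cdot> ?dq)" "sform 1 (hod (X \<wedge> hod (dd X)))" "sform 1 (recip r \<cdot> ?P)"
    by (rule sform_dt[OF X], rule sform_scale[OF sfn_half dq], rule smooth_hodge[OF XdX], simp, simp,
        rule sform_scale[OF sfn_recip[OF r(1) r(2)[rule_format]] P])
  have m: "momentum_form r X pr = ((dt_form X + half \<cdot> ?dq) + - hod (X \<wedge> hod (dd X))) + recip r \<cdot> ?P"
    by (simp add: momentum_form_def)
  have f: "hod (momentum_form r X pr) = ((hod (dt_form X) + half \<cdot> hod ?dq) + - (X \<wedge> hod (dd X))) + recip r \<cdot> hod ?P"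
    unfolding m
    using hodge_add[OF sform_add[OF sform_add[OF s(1,2)] sform_minus[OF s(3)]] s(4)]
      hodge_add[OF sform_add[OF s(1,2)] sform_minus[OF s(3)]] hodge_add[OF s(1,2)] hodge_minus[OF s(3)]
      hodge_hodge[OF XdX] hodge_scale[OF dq] hodge_scale[OF P] by simp
  show ?thesis
  proof (intro ext)
    fix p vs
    have rr: "r p * recip r p = 1" unfolding recip_def using inverse_mult_eq_1'[OF r(2)[rule_format]] .
    have hh: "half p + half p = 1" by (simp add: half_def)
    have d': "r p * (X \<wedge> V) p vs = - (?q p * hod ?R p vs - form_inner ?R X p * hod X p vs) - r p * (X \<wedge> hod (dd X)) p vs"
      using fun_cong[OF fun_cong[OF d, of p], of vs] by (simp add: scale_def)
    define hP hR hq hX' hx w where "hP = hod ?P p vs" and "hR = hod ?R p vs" and "hq = hod ?dq p vs"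
      and "hX' = hod (dt_form X) p vs" and "hx = hod X p vs" and "w = (X \<wedge> hod (dd X)) p vs"
    note dfs = hP_def hR_def hq_def hX'_def hx_def w_def
    have "hP + (?q p * hR + r p * hq) + (dt_fn r p * hx + r p * hX')
        - (r p * (half p * hq - fn_of (cod X) p * hx) - r p * (X \<wedge> V) p vs) =
      r p * (((hX' + half p * hq) + - w) + recip r p * hP) + (dt_fn r p + (form_inner ?R X p + r p * fn_of (cod X) p)) * hx"
      using rr hh d'[folded dfs] by algebra
    then show "(cod (r \<cdot> (\<Phi> + X \<wedge> hod X)) + dt_form (r \<cdot> hod X) - r \<cdot> (\<pi>_of M X - X \<wedge> V)) p vs =
      (r \<cdot> hod (momentum_form r X pr) + (\<lambda>p. dt_fn r p + fn_of (cod (r \<cdot> X)) p) \<cdot> hod X) p vs"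
      unfolding a b c f by (simp add: scale_def e dfs right_diff_distrib)
  qed
qed

text \<open>
  \<open>r V \<wedge> \<star>X = - \<star>d(r X) \<wedge> \<star>X = - X \<wedge> d(r X)\<close>, and the part \<open>X \<wedge> dr \<wedge> X\<close> of the last form vanishes.
\<close>

lemma wedge_V_sigma:
  assumes r: "sfn r" "\<forall>p. fps_nth (r p) 0 \<noteq> 0" and X: "sform 1 X" and V: "r \<cdot> V = - hod (dd (r \<cdot> X))"
  shows "V \<wedge> hod X = - (X \<wedge> dd X)"
proof -
  have R: "sform 1 (dd (form0 r))" using r by (intro smooth_ext_d'[of 0]) (simp_all add: sform_form0)
  have drX: "sform 2 (dd (r \<cdot> X))" by (rule smooth_ext_d'[OF sform_scale[OF r(1) X]]) simp_all
  have "r \<cdot> (V \<wedge> hod X) = - (hod (dd (r \<cdot> X)) \<wedge> hod X)"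
    unfolding wedge_lin(3)[symmetric] V wedge_lin(5) ..
  also have "\<dots> = - (X \<wedge> dd (r \<cdot> X))" unfolding hodge_wedge_hodge_2[OF X drX] ..
  also have "\<dots> = - (r \<cdot> (X \<wedge> dd X))"
    unfolding ext_d_scale[OF r(1) X] wedge_lin wedge_wedge_self[OF X R] by simp
  finally have "recip r \<cdot> r \<cdot> (V \<wedge> hod X) = recip r \<cdot> r \<cdot> (- (X \<wedge> dd X))"
    by (simp add: fun_eq_iff scale_def)
  then show ?thesis unfolding recip_scale(1)[OF r(2)] .
qed

lemma codiff_rho_sigma:
  assumes r: "sfn r" and X: "sform 1 X"
  shows "cod (r \<cdot> hod X) = - hod (dd (r \<cdot> X))"
proof -
  have hX: "sform 2 (hod X)" by (rule smooth_hodge[OF X]) simp_all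
  show ?thesis
    unfolding codiff_2[OF sform_scale[OF r hX]] using hodge_scale[OF hX] hodge_hodge[OF X] by simp
qed

lemma mass_equation:
  "dt_fn r + divergence M (r \<cdot>\<^sub>v u) = 0 \<longleftrightarrow> (\<forall>p. dt_fn r p + fn_of (cod (r \<cdot> flat M u)) p = 0)"
  unfolding divergence_def flat_vscale by (simp add: fun_eq_iff)

lemma momentum_form_zero_iff:
  assumes "sfn r" "\<forall>p. fps_nth (r p) 0 \<noteq> 0" "sform 1 X" "sfn pr"
  shows "r \<cdot> hod (momentum_form r X pr) = 0 \<longleftrightarrow> momentum_form r X pr = 0"
proof -
  have q: "sfn (form_inner X X)" by (rule sfn_form_inner[OF assms(3,3)])
  have dX: "sform 2 (dd X)" by (rule smooth_ext_d'[OF assms(3)]) simp_all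
  have hdX: "sform 1 (hod (dd X))" by (rule smooth_hodge[OF dX]) simp_all
  have XdX: "sform 2 (X \<wedge> hod (dd X))" by (rule sform_wedge[OF assms(3) hdX]) simp
  have d0: "sform 1 (dd (form0 f))" if "sfn f" for f
    using that by (intro smooth_ext_d'[of 0]) (simp_all add: sform_form0)
  have h: "sform 1 (hod (X \<wedge> hod (dd X)))" by (rule smooth_hodge[OF XdX]) simp_all
  have m: "sform 1 (momentum_form r X pr)"
    unfolding momentum_form_def
    by (intro sform_add sform_diff sform_dt sform_scale sfn_half sfn_recip[OF assms(1) assms(2)[rule_format]] d0 q h assms)
  have "hod (momentum_form r X pr) = 0 \<longleftrightarrow> momentum_form r X pr = 0"
    using hodge_hodge[OF m] hodge_zero by (auto simp: zero_fun_def)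
  then show ?thesis using scale_zero_iff[OF assms(2)] by simp
qed

text \<open>
  The equations for \<open>dt\<close>, \<open>d\<epsilon>\<close>, \<open>(d\<epsilon>)\<^sup>2\<close> and \<open>dt d\<epsilon>\<close> are the continuity equation, the choices of \<open>V\<close> and
  \<open>\<Psi>\<close>, and the momentum equation.  The equations for \<open>\<epsilon>\<close> and \<open>dt \<epsilon>\<close> are \<open>\<delta>\<close> of those for \<open>d\<epsilon>\<close> and \<open>dt d\<epsilon>\<close>.
\<close>

theorem euler_imp_homotopy:
  assumes "euler_solution M \<rho> u pr"
  shows "\<exists>f X V \<pi> \<sigma> \<Phi> \<Psi>. euler_identification M \<rho> u pr f X V \<pi> \<sigma> \<Phi> \<Psi> \<and> homotopy M (elem_of f X V \<pi> \<sigma> \<Phi> \<Psi>)"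
proof -
  have r: "sfn \<rho>" and u: "smooth_vfield M u" and p: "sfn pr" and pos: "\<And>x. fps_nth (\<rho> x) 0 > 0"
    and mass: "\<And>p. dt_fn \<rho> p + fn_of (cod (\<rho> \<cdot> flat M u)) p = 0"
    using assms unfolding euler_solution_def mass_equation by blast+
  have momentum: "momentum_form \<rho> (flat M u) pr = 0"
    using assms vector_momentum[OF r u p] unfolding euler_solution_def by blast
  have nz: "\<forall>x. fps_nth (\<rho> x) 0 \<noteq> 0" using pos less_imp_neq by metis
  define f X where "f = (\<lambda>x. ln_fps (\<rho> x))" and "X = flat M u"
  define V where "V = - (recip \<rho> \<cdot> hod (dd (\<rho> \<cdot> X)))"
  define \<Phi> where "\<Phi> = recip \<rho> \<cdot> hod (form0 pr)"
  define \<Psi> where "\<Psi> = X \<wedge> dd X"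
  let ?\<sigma> = "hod X" and ?\<pi> = "\<pi>_of M X"
  have f: "exp_fn f = \<rho>" using exp_fps_ln_fps[OF pos] by (simp add: fun_eq_iff exp_fn_exp_fps f_def)
  have sf: "sfn f" using r pos by (auto simp: sfn_iff f_def intro!: smooth_fps_ln_fps open_chart)
  have X: "sform 1 X" using u sform_flat unfolding X_def by blast
  have \<sigma>: "sform 2 ?\<sigma>" by (rule smooth_hodge[OF X]) simp_all
  have sr: "sfn (recip \<rho>)" by (rule sfn_recip[OF r nz[rule_format]])
  have drX: "sform 2 (dd (\<rho> \<cdot> X))" by (rule smooth_ext_d'[OF sform_scale[OF r X]]) simp_all
  have V: "sform 1 V" unfolding V_def
    by (intro sform_minus sform_scale[OF sr] smooth_hodge[OF drX]) simp_all
  have rV: "\<rho> \<cdot> V = - hod (dd (\<rho> \<cdot> X))"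
  proof -
    have "\<rho> \<cdot> V = - (\<rho> \<cdot> recip \<rho> \<cdot> hod (dd (\<rho> \<cdot> X)))" by (simp add: V_def fun_eq_iff scale_def)
    then show ?thesis unfolding recip_scale(2)[OF nz] .
  qed
  have p0: "sform 0 (form0 pr)" using p by (simp add: sform_form0)
  have hp: "sform 3 (hod (form0 pr))" by (rule smooth_hodge[OF p0]) simp_all
  have \<Phi>: "sform 3 \<Phi>" unfolding \<Phi>_def by (rule sform_scale[OF sr hp])
  have pr: "pr = fn_of (hod (\<rho> \<cdot> \<Phi>))"
    unfolding \<Phi>_def recip_scale(2)[OF nz] hodge_hodge[OF p0, simplified] by (simp add: fun_eq_iff fn_of_def form0_def)
  have \<Psi>: "sform 3 \<Psi>" unfolding \<Psi>_def by (rule sform_wedge[OF X smooth_ext_d'[OF X]]) simp_all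
  have \<pi>: "sform 2 ?\<pi>"
  proof -
    have "sform 2 (cod (X \<wedge> hod X))" using sform_codiff[of 2] sform_wedge_hodge[OF X X] by (simp add: numeral_3_eq_3)
    moreover have "sform 0 (cod X)" using sform_codiff[of 0] X by simp
    ultimately show ?thesis unfolding \<pi>_of_def by (intro sform_diff sform_scale sfn_half sform_wedge[OF _ \<sigma>]) simp_all
  qed
  have z: "\<Psi> + V \<wedge> ?\<sigma> = 0" using wedge_V_sigma[OF r nz X rV] by (simp add: \<Psi>_def)
  have E1: "cod (\<rho> \<cdot> X) + form0 (dt_fn \<rho>) = 0"
  proof -
    have "cod (\<rho> \<cdot> X) = form0 (fn_of (cod (\<rho> \<cdot> X)))"
      by (rule sform_0_eq, rule sform_codiff) (use sform_scale[OF r X] in simp_all)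
    moreover have "fn_of (cod (\<rho> \<cdot> X)) p = - dt_fn \<rho> p" for p
      using mass[of p] by (simp add: X_def eq_neg_iff_add_eq_0 add.commute)
    ultimately show ?thesis by (simp add: fun_eq_iff form0_def)
  qed
  have E4: "cod (\<rho> \<cdot> ?\<sigma>) - \<rho> \<cdot> V = 0" unfolding codiff_rho_sigma[OF r X] rV by simp
  then have rV': "\<rho> \<cdot> V = cod (\<rho> \<cdot> ?\<sigma>)" by simp
  have r\<sigma>: "sform 2 (\<rho> \<cdot> ?\<sigma>)" by (rule sform_scale[OF r \<sigma>])
  have E2: "cod (\<rho> \<cdot> V) = 0" unfolding rV' using codiff_codiff[of 0] r\<sigma> by (simp add: numeral_2_eq_2)
  have E6: "\<rho> \<cdot> (\<Psi> + V \<wedge> ?\<sigma>) = 0" unfolding z by (simp add: fun_eq_iff scale_def)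
  have E5: "cod (\<rho> \<cdot> (\<Psi> + V \<wedge> ?\<sigma>)) = 0" unfolding E6 using codiff_zero by (simp add: zero_fun_def)
  have m0: "hod (momentum_form \<rho> X pr) = 0" using momentum hodge_zero by (simp add: X_def zero_fun_def)
  have ms: "(\<lambda>p. dt_fn \<rho> p + fn_of (cod (\<rho> \<cdot> X)) p) = (\<lambda>p. 0)" using mass by (simp add: X_def)
  have E8: "cod (\<rho> \<cdot> (\<Phi> + X \<wedge> ?\<sigma>)) + dt_form (\<rho> \<cdot> ?\<sigma>) - \<rho> \<cdot> (?\<pi> - X \<wedge> V) = 0"
    unfolding momentum_identity[OF r nz X \<Phi> pr rV] m0 ms by (simp add: fun_eq_iff scale_def)
  then have Y: "\<rho> \<cdot> (?\<pi> - X \<wedge> V) = cod (\<rho> \<cdot> (\<Phi> + X \<wedge> ?\<sigma>)) + dt_form (\<rho> \<cdot> ?\<sigma>)" by simp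
  have W: "sform 3 (\<rho> \<cdot> (\<Phi> + X \<wedge> ?\<sigma>))" by (rule sform_scale[OF r sform_add[OF \<Phi> sform_wedge_hodge[OF X X]]])
  have cW: "sform 2 (cod (\<rho> \<cdot> (\<Phi> + X \<wedge> ?\<sigma>)))" using sform_codiff[of 2] W by (simp add: numeral_3_eq_3)
  have ccW: "cod (cod (\<rho> \<cdot> (\<Phi> + X \<wedge> ?\<sigma>))) = 0" using codiff_codiff[of 1] W by (simp add: numeral_3_eq_3)
  have E3: "cod (\<rho> \<cdot> (?\<pi> - X \<wedge> V)) - dt_form (\<rho> \<cdot> V) = 0"
    unfolding Y rV' using codiff_add[of 1, OF _ _ ] cW sform_dt[OF r\<sigma>] ccW codiff_dt[of 1 "\<rho> \<cdot> ?\<sigma>"] r\<sigma>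
    by (simp add: numeral_2_eq_2)
  have "homotopy M (elem_of f X V ?\<pi> ?\<sigma> \<Phi> \<Psi>)"
    unfolding homotopy_iff[OF sf X V \<pi> \<sigma> \<Phi> \<Psi> f[symmetric]]
    using E1 E2 E3 E4 E5 E6 E8 by blast
  moreover have "euler_identification M \<rho> u pr f X V ?\<pi> ?\<sigma> \<Phi> \<Psi>"
    unfolding euler_identification_def using f by (simp add: X_def V_def \<Phi>_def \<Psi>_def)
  ultimately show ?thesis by blast
qed

theorem homotopy_imp_euler:
  assumes h: "homotopy M (elem_of f X V \<pi> \<sigma> \<Phi> \<Psi>)" and \<sigma>: "\<sigma> = hod X" and \<pi>: "\<pi> = \<pi>_of M X"
    and r: "\<rho> = exp_fn f" and pr: "pr = fn_of (hod (\<rho> \<cdot> \<Phi>))"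
  shows "euler_solution M \<rho> (sharp M X) pr \<and> euler_identification M \<rho> (sharp M X) pr f X V \<pi> \<sigma> \<Phi> \<Psi>"
proof -
  have "degree_zero M (elem_of f X V \<pi> \<sigma> \<Phi> \<Psi>)" using h unfolding homotopy_def by blast
  then have s: "sfn f" "sform 1 X" "sform 1 V" "sform 2 \<pi>" "sform 2 \<sigma>" "sform 3 \<Phi>" "sform 3 \<Psi>"
    unfolding degree_zero_elem_of_iff by blast+
  note E = h[unfolded homotopy_iff[OF s r]]
  have sr: "sfn \<rho>" unfolding r by (rule sfn_exp[OF s(1)])
  have pos: "fps_nth (\<rho> p) 0 > 0" for p unfolding r by (rule exp_fn_pos)
  have nz: "\<forall>x. fps_nth (\<rho> x) 0 \<noteq> 0" using pos less_imp_neq by metis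
  have fl: "flat M (sharp M X) = X" by (rule flat_sharp[OF smooth_form_alt[OF s(2)]])
  have u: "smooth_vfield M (sharp M X)" using s(2) sform_flat[of "sharp M X"] by (simp add: fl)
  have r\<Phi>: "sform 3 (\<rho> \<cdot> \<Phi>)" by (rule sform_scale[OF sr s(6)])
  have hp: "hod (\<rho> \<cdot> \<Phi>) = form0 pr"
    unfolding pr by (rule sform_0_eq[OF smooth_hodge[OF r\<Phi>]]) simp_all
  have spr: "sfn pr" using smooth_hodge[OF r\<Phi>, of 0] by (simp add: hp sform_form0)
  have "fn_of (cod (\<rho> \<cdot> X) + form0 (dt_fn \<rho>)) p = 0" for p using E by (simp add: fn_of_def)
  then have mass: "dt_fn \<rho> p + fn_of (cod (\<rho> \<cdot> X)) p = 0" for p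
    by (simp add: fn_of_def form0_def add.commute)
  have rV: "\<rho> \<cdot> V = - hod (dd (\<rho> \<cdot> X))"
    using E codiff_rho_sigma[OF sr s(2)] unfolding \<sigma> by simp
  have ms: "(\<lambda>p. dt_fn \<rho> p + fn_of (cod (\<rho> \<cdot> X)) p) = (\<lambda>p. 0)" using mass by simp
  have "cod (\<rho> \<cdot> (\<Phi> + X \<wedge> hod X)) + dt_form (\<rho> \<cdot> hod X) - \<rho> \<cdot> (\<pi>_of M X - X \<wedge> V) = 0"
    using E unfolding \<sigma> \<pi> by blast
  then have "\<rho> \<cdot> hod (momentum_form \<rho> X pr) + (\<lambda>p. 0) \<cdot> hod X = 0"
    unfolding momentum_identity[OF sr nz s(2) s(6) pr rV] ms .
  then have "\<rho> \<cdot> hod (momentum_form \<rho> X pr) = 0" by (simp add: fun_eq_iff scale_def)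
  then have "momentum_form \<rho> X pr = 0" using momentum_form_zero_iff[OF sr nz s(2) spr] by blast
  then have mo: "dt_vfield (sharp M X) + grad M (half * dot M (sharp M X) (sharp M X))
      - cross M (sharp M X) (curl M (sharp M X)) + recip \<rho> \<cdot>\<^sub>v grad M pr = 0"
    using vector_momentum[OF sr u spr] by (simp add: fl)
  have es: "euler_solution M \<rho> (sharp M X) pr"
    unfolding euler_solution_def mass_equation fl using sr u spr pos mass mo by blast
  have "V = recip \<rho> \<cdot> \<rho> \<cdot> V" using recip_scale(1)[OF nz] by simp
  then have V: "V = - (recip \<rho> \<cdot> hod (dd (\<rho> \<cdot> X)))" unfolding rV by (simp add: fun_eq_iff scale_def)
  have "\<rho> \<cdot> \<Phi> = hod (form0 pr)" unfolding hp[symmetric] using hodge_hodge[OF r\<Phi>] by simp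
  then have \<Phi>: "\<Phi> = recip \<rho> \<cdot> hod (form0 pr)" using recip_scale(1)[OF nz, of \<Phi>] by simp
  have "\<rho> \<cdot> (\<Psi> + V \<wedge> \<sigma>) = 0" using E by blast
  then have "\<Psi> + V \<wedge> \<sigma> = 0" using scale_zero_iff[OF nz] by blast
  then have \<Psi>: "\<Psi> = X \<wedge> dd X" unfolding \<sigma> wedge_V_sigma[OF sr nz s(2) rV] by simp
  show ?thesis
    using es V \<Phi> \<Psi> \<sigma> \<pi> r unfolding euler_identification_def fl by blast
qed

end

theorem lemma5p3:
  fixes M :: "'m::t2_space riem_manifold"
  assumes "closed_oriented_riemannian_3manifold M"
    and "connected (UNIV :: 'm set)"
    and "has_total_volume M 1"
  shows
    "(\<forall>\<rho> u pr. euler_solution M \<rho> u pr \<longrightarrow>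
        (\<exists>f X V \<pi> \<sigma> \<Phi> \<Psi>. euler_identification M \<rho> u pr f X V \<pi> \<sigma> \<Phi> \<Psi> \<and>
           homotopy M (elem_of f X V \<pi> \<sigma> \<Phi> \<Psi>)))
   \<and> (\<forall>f X V \<pi> \<sigma> \<Phi> \<Psi>.
        homotopy M (elem_of f X V \<pi> \<sigma> \<Phi> \<Psi>) \<and>
        \<sigma> = hodge M X \<and>
        \<pi> = half \<cdot> codiff M (X \<wedge> hodge M X) - codiff M X \<wedge> hodge M X \<longrightarrow>
        (let \<rho> = exp_fn f; u = sharp M X; pr = fn_of (hodge M (\<rho> \<cdot> \<Phi>)) in
           euler_solution M \<rho> u pr \<and>
           euler_identification M \<rho> u pr f X V \<pi> \<sigma> \<Phi> \<Psi>))"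
proof -
  interpret riemannian_3manifold M using assms(1) by unfold_locales
  show ?thesis
    using euler_imp_homotopy homotopy_imp_euler unfolding Let_def \<pi>_of_def by blast
qed

end
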